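(* Let $\beta>0$ and let $\sigma>0$ be such that $\phi_\beta$ has no zero on the line $\operatorname{Re}z=-\sigma$. Then $$r_{\beta,\sigma}(x)=O_{\beta,\sigma}(e^{-\sigma x}),\qquad\text{as }x\to\infty,$$ and $$U_\beta(dx)=\eta_\beta\delta_0(dx)+\Bigl[\frac1{\mu_\beta}+\sum_{\rho\in\mathcal Z_{\beta,\sigma}}u_{\beta,\rho}(x)+r_{\beta,\sigma}(x)\Bigr]dx.$$ Consequently, as $n\to\infty$, $$\mathsf E D_n=\frac{h_{n-1}}{\mu_\beta}-\frac{\phi_\beta''(0)}{2\mu_\beta^2}-\sum_{\rho\in\mathcal Z_{\beta,\sigma}}\mathcal B_{\beta,\rho}(n)+O_{\beta,\sigma}(n^{-\sigma}).$$ With the nonreal terms grouped with their complex conjugates, the displayed expressions are real. Thus, by moving the contour across any prescribed finite collection of zeros (taking $\sigma$ as large as desired), one obtains an asymptotic expansion of $\mathsf E D_n$ to arbitrary fixed algebraic order.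
   Context: $h_m=\sum_{r=1}^m1/r$ and $B(a,b)=\Gamma(a)\Gamma(b)/\Gamma(a+b)$. For $\beta>0$, $\phi_\beta$ is the meromorphic function on $\mathbb C$ given by $\phi_\beta(z)=B(\beta+2,\beta+1)-B(z+\beta+2,\beta+1)$; for $\operatorname{Re}z\ge0$ it equals $\int_0^1(1-s^z)s^{\beta+1}(1-s)^\beta\,ds$. Put $\mu_\beta=\phi_\beta'(0)$ and $\eta_\beta=B(\beta+2,\beta+1)^{-1}=\lim_{a\to\infty}1/\phi_\beta(a)$. Let $\xi$ be the subordinator with $\mathsf E e^{-z\xi_t}=e^{-t\phi_\beta(z)}$, $\operatorname{Re}z\ge0$; its potential measure is $U_\beta(dx)=\int_0^\infty\mathsf P(\xi_t\in dx)\,dt$. $\mathcal Z_\beta$ is the set of distinct nonzero zeros of $\phi_\beta$, and $\mathcal Z_{\beta,\sigma}=\{\rho\in\mathcal Z_\beta:-\sigma<\operatorname{Re}\rho<0\}$ (a finite set for $\sigma$ as in the claim). For $\rho\in\mathcal Z_\beta$ let $m_\rho$ be its multiplicity and let $\sum_{\ell=1}^{m_\rho}c_{\rho,\ell}(z-\rho)^{-\ell}$ be the principal part of $1/\phi_\beta$ at $\rho$. For $x>0$ and $n\ge2$, $$u_{\beta,\rho}(x)=e^{\rho x}\sum_{\ell=1}^{m_\rho}c_{\rho,\ell}\frac{x^{\ell-1}}{(\ell-1)!},\qquad \mathcal B_{\beta,\rho}(n)=\sum_{\ell=1}^{m_\rho}\frac{c_{\rho,\ell}}{(\ell-1)!}\frac{\partial^{\ell-1}}{\partial\rho^{\ell-1}}B(-\rho,n).$$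 Put $F_\beta(z)=1/\phi_\beta(z)-\eta_\beta$ and, for $x>0$, $$r_{\beta,\sigma}(x)=\frac1{2\pi i}\int_{-\sigma-i\infty}^{-\sigma+i\infty}e^{zx}F_\beta(z)\,dz.$$ Continuous-time beta-splitting tree on $n$ leaves: a continuous-time Markov chain $\Pi_n$ on partitions of $[n]=\{1,\dots,n\}$ started from the one-block partition, in which different blocks evolve independently, singletons are absorbing, and a block containing $m\ge2$ labels waits an exponential time of rate $\phi_\beta(m-1)$ and then splits into an ordered pair of nonempty blocks; the first has size $i$, $1\le i\le m-1$, with probability $q_\beta(m,i)=\frac{1}{2\phi_\beta(m-1)}\binom mi B(i+\beta+1,m-i+\beta+1)$, and, given $i$, the set of labels of the first block is uniform among subsets of size $i$. $D_n$ is the continuous height of a uniformly chosen leaf, i.e. the first time at which a uniformly chosen label of $[n]$ is a singleton block. *)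

theory Defs
  imports
    "HOL-Probability.Probability"
    "HOL-Complex_Analysis.Complex_Analysis"
begin

section \<open>The Laplace exponent, its zeros and the associated residue terms\<close>

text \<open>
  The library's \<^const>\<open>Gamma\<close> takes the value 0 at its poles, so the bare formula has a wrong
  value at points where both \<open>z + \<beta> + 2\<close> and \<open>z + 2 * \<beta> + 3\<close> are poles of \<open>Gamma\<close> (this happens for
  integral \<open>\<beta>\<close>, and some of these points can be zeros of the meromorphic function).
  \<^const>\<open>remove_sings\<close> restores the meromorphic function; its value at genuine poles is 0, by the
  library convention, so zeros have to be expressed by \<^const>\<open>isolated_zero\<close> and not by a vanishing
  function value.
\<close>

definition phi :: "real \<Rightarrow> complex \<Rightarrow> complex" where
  "phi \<beta> = remove_sings (\<lambda>z. Beta (of_real \<beta> + 2) (of_real \<beta> + 1)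
                              - Beta (z + of_real \<beta> + 2) (of_real \<beta> + 1))"

definition mu :: "real \<Rightarrow> complex" where
  "mu \<beta> = deriv (phi \<beta>) 0"

definition eta :: "real \<Rightarrow> real" where
  "eta \<beta> = inverse (Beta (\<beta> + 2) (\<beta> + 1))"

definition zeros :: "real \<Rightarrow> complex set" where
  "zeros \<beta> = {\<rho>. \<rho> \<noteq> 0 \<and> isolated_zero (phi \<beta>) \<rho>}"

definition zeros_strip :: "real \<Rightarrow> real \<Rightarrow> complex set" where
  "zeros_strip \<beta> \<sigma> = {\<rho> \<in> zeros \<beta>. - \<sigma> < Re \<rho> \<and> Re \<rho> < 0}"

definition zero_mult :: "real \<Rightarrow> complex \<Rightarrow> nat" where
  "zero_mult \<beta> \<rho> = nat (zorder (phi \<beta>) \<rho>)"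

definition pp_coeff :: "real \<Rightarrow> complex \<Rightarrow> nat \<Rightarrow> complex" where
  "pp_coeff \<beta> \<rho> l = fls_nth (laurent_expansion (\<lambda>z. 1 / phi \<beta> z) \<rho>) (- int l)"

definition u_term :: "real \<Rightarrow> complex \<Rightarrow> real \<Rightarrow> complex" where
  "u_term \<beta> \<rho> x = exp (\<rho> * of_real x) *
     (\<Sum>l = 1..zero_mult \<beta> \<rho>. pp_coeff \<beta> \<rho> l * of_real x ^ (l - 1) / fact (l - 1))"

definition B_term :: "real \<Rightarrow> complex \<Rightarrow> nat \<Rightarrow> complex" where
  "B_term \<beta> \<rho> n = (\<Sum>l = 1..zero_mult \<beta> \<rho>. pp_coeff \<beta> \<rho> l / fact (l - 1) *
     (deriv ^^ (l - 1)) (\<lambda>w. Beta (- w) (of_nat n)) \<rho>)"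

definition F :: "real \<Rightarrow> complex \<Rightarrow> complex" where
  "F \<beta> z = 1 / phi \<beta> z - of_real (eta \<beta>)"

text \<open>The vertical line is parametrised by \<open>z = - \<sigma> + i t\<close>; the last factor of the integrand is
  \<open>dz/dt = i\<close>.\<close>

definition remainder_integrand :: "real \<Rightarrow> real \<Rightarrow> real \<Rightarrow> real \<Rightarrow> complex" where
  "remainder_integrand \<beta> \<sigma> x t =
     (let z = Complex (- \<sigma>) t in exp (z * of_real x) * F \<beta> z * \<i>)"

definition remainder :: "real \<Rightarrow> real \<Rightarrow> real \<Rightarrow> complex" where
  "remainder \<beta> \<sigma> x =
     1 / (2 * of_real pi * \<i>) * (LINT t|lborel. remainder_integrand \<beta> \<sigma> x t)"

definition potential_density :: "real \<Rightarrow> real \<Rightarrow> real \<Rightarrow> complex" where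
  "potential_density \<beta> \<sigma> x =
     1 / mu \<beta> + (\<Sum>\<rho>\<in>zeros_strip \<beta> \<sigma>. u_term \<beta> \<rho> x) + remainder \<beta> \<sigma> x"


section \<open>Subordinators\<close>

definition subordinator :: "'a measure \<Rightarrow> (real \<Rightarrow> 'a \<Rightarrow> real) \<Rightarrow> bool" where
  "subordinator M \<xi> \<longleftrightarrow>
     prob_space M \<and>
     (\<forall>t\<ge>0. \<xi> t \<in> borel_measurable M) \<and>
     (AE \<omega> in M. \<xi> 0 \<omega> = 0 \<and> mono_on {0..} (\<lambda>t. \<xi> t \<omega>) \<and>
                  (\<forall>t\<ge>0. continuous (at_right t) (\<lambda>s. \<xi> s \<omega>))) \<and>
     (\<forall>s\<ge>0. \<forall>h\<ge>0. distr M borel (\<lambda>\<omega>. \<xi> (s + h) \<omega> - \<xi> s \<omega>) = distr M borel (\<xi> h)) \<and>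
     (\<forall>k (t :: nat \<Rightarrow> real). 0 \<le> t 0 \<and> (\<forall>i<k. t i \<le> t (Suc i)) \<longrightarrow>
        prob_space.indep_vars M (\<lambda>_. borel) (\<lambda>i \<omega>. \<xi> (t (Suc i)) \<omega> - \<xi> (t i) \<omega>) {..<k})"

definition has_laplace_exponent ::
  "'a measure \<Rightarrow> (real \<Rightarrow> 'a \<Rightarrow> real) \<Rightarrow> (complex \<Rightarrow> complex) \<Rightarrow> bool" where
  "has_laplace_exponent M \<xi> \<Phi> \<longleftrightarrow>
     (\<forall>t\<ge>0. \<forall>z. 0 \<le> Re z \<longrightarrow>
        (LINT \<omega>|M. exp (- z * of_real (\<xi> t \<omega>))) = exp (- of_real t * \<Phi> z))"

definition potential_measure :: "'a measure \<Rightarrow> (real \<Rightarrow> 'a \<Rightarrow> real) \<Rightarrow> real measure" where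
  "potential_measure M \<xi> =
     measure_of UNIV (sets borel)
       (\<lambda>A. \<integral>\<^sup>+ t \<in> {0..}. emeasure (distr M borel (\<xi> t)) A \<partial>lborel)"


section \<open>Continuous-time Markov chains on a finite state space\<close>

text \<open>\<open>Q x y\<close> for \<open>x \<noteq> y\<close> is the jump rate from \<open>x\<close> to \<open>y\<close>.\<close>

definition generator :: "'s set \<Rightarrow> ('s \<Rightarrow> 's \<Rightarrow> real) \<Rightarrow> 's \<Rightarrow> 's \<Rightarrow> real" where
  "generator S Q x y = (if x = y then - (\<Sum>z\<in>S - {x}. Q x z) else Q x y)"

primrec gen_power :: "'s set \<Rightarrow> ('s \<Rightarrow> 's \<Rightarrow> real) \<Rightarrow> nat \<Rightarrow> 's \<Rightarrow> 's \<Rightarrow> real" where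
  "gen_power S G 0 = (\<lambda>x y. of_bool (x = y))"
| "gen_power S G (Suc k) = (\<lambda>x y. \<Sum>z\<in>S. G x z * gen_power S G k z y)"

text \<open>The entries of the matrix exponential \<open>exp (t G)\<close>, i.e. the transition probabilities.\<close>

definition transition :: "'s set \<Rightarrow> ('s \<Rightarrow> 's \<Rightarrow> real) \<Rightarrow> real \<Rightarrow> 's \<Rightarrow> 's \<Rightarrow> real" where
  "transition S Q t x y = (\<Sum>k. t ^ k / fact k * gen_power S (generator S Q) k x y)"

definition markov_chain ::
  "'a measure \<Rightarrow> 's set \<Rightarrow> ('s \<Rightarrow> 's \<Rightarrow> real) \<Rightarrow> 's \<Rightarrow> (real \<Rightarrow> 'a \<Rightarrow> 's) \<Rightarrow> bool" where
  "markov_chain M S Q x\<^sub>0 X \<longleftrightarrow>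
     prob_space M \<and>
     (\<forall>t\<ge>0. X t \<in> measurable M (count_space S)) \<and>
     (\<forall>\<omega>\<in>space M. X 0 \<omega> = x\<^sub>0) \<and>
     (\<forall>\<omega>\<in>space M. \<forall>t\<ge>0. \<forall>\<^sub>F s in at_right t. X s \<omega> = X t \<omega>) \<and>
     (\<forall>k (t :: nat \<Rightarrow> real) x.
        0 \<le> t 0 \<and> (\<forall>i<k. t i \<le> t (Suc i)) \<and> (\<forall>i\<le>k. x i \<in> S) \<longrightarrow>
        measure M {\<omega>\<in>space M. \<forall>i\<le>k. X (t i) \<omega> = x i} =
          measure M {\<omega>\<in>space M. X (t 0) \<omega> = x 0} *
          (\<Prod>i<k. transition S Q (t (Suc i) - t i) (x i) (x (Suc i))))"


section \<open>The beta-splitting tree\<close>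

definition block_rate :: "real \<Rightarrow> nat \<Rightarrow> real" where
  "block_rate \<beta> m = Re (phi \<beta> (of_nat (m - 1)))"

definition q_split :: "real \<Rightarrow> nat \<Rightarrow> nat \<Rightarrow> real" where
  "q_split \<beta> m i = 1 / (2 * block_rate \<beta> m) * real (m choose i)
     * Beta (real i + \<beta> + 1) (real (m - i) + \<beta> + 1)"

definition partitions :: "nat \<Rightarrow> nat set set set" where
  "partitions n = {\<pi>. partition_on {1..n} \<pi>}"

text \<open>
  The blocks of the current partition carry independent exponential clocks, a block \<open>b\<close> of size
  \<open>m \<ge> 2\<close> ringing at rate \<open>block_rate \<beta> m\<close>; when it rings, it is replaced by the ordered pair
  \<open>(c, b - c)\<close> with probability \<open>q_split \<beta> m (card c) / (m choose card c)\<close> (size from \<open>q_split\<close>, label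
  set uniform given the size).  Both orderings of a pair lead to the same partition and are summed
  below.
\<close>

definition jump_rate :: "real \<Rightarrow> nat set set \<Rightarrow> nat set set \<Rightarrow> real" where
  "jump_rate \<beta> \<pi> \<pi>' =
     (\<Sum>(b, c) \<in> {(b, c). b \<in> \<pi> \<and> 2 \<le> card b \<and> c \<noteq> {} \<and> c \<subset> b \<and> \<pi>' = (\<pi> - {b}) \<union> {c, b - c}}.
        block_rate \<beta> (card b) * (q_split \<beta> (card b) (card c) / real (card b choose card c)))"

definition beta_splitting_chain ::
  "real \<Rightarrow> nat \<Rightarrow> 'a measure \<Rightarrow> (real \<Rightarrow> 'a \<Rightarrow> nat set set) \<Rightarrow> bool" where
  "beta_splitting_chain \<beta> n M X \<longleftrightarrow>
     markov_chain M (partitions n) (jump_rate \<beta>) {{1..n}} X"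

text \<open>The uniformly chosen label is independent of the whole process.\<close>

definition uniform_leaf ::
  "nat \<Rightarrow> 'a measure \<Rightarrow> (real \<Rightarrow> 'a \<Rightarrow> nat set set) \<Rightarrow> ('a \<Rightarrow> nat) \<Rightarrow> bool" where
  "uniform_leaf n M X J \<longleftrightarrow>
     J \<in> measurable M (count_space UNIV) \<and>
     distr M (count_space UNIV) J = measure_pmf (pmf_of_set {1..n}) \<and>
     prob_space.indep_set M
       (sets (vimage_algebra (space M) J (count_space UNIV)))
       (sets (vimage_algebra (space M) (\<lambda>\<omega>. \<lambda>t\<in>{0..}. X t \<omega>)
               (Pi\<^sub>M {0..} (\<lambda>_. count_space (partitions n)))))"

definition leaf_height :: "(real \<Rightarrow> 'a \<Rightarrow> nat set set) \<Rightarrow> ('a \<Rightarrow> nat) \<Rightarrow> 'a \<Rightarrow> real" where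
  "leaf_height X J \<omega> = Inf {t. 0 \<le> t \<and> {J \<omega>} \<in> X t \<omega>}"

text \<open>For every \<open>n \<ge> 2\<close> a realisation of the tree on \<open>n\<close> leaves with a uniform leaf; the probability
  spaces for different \<open>n\<close> are unrelated.\<close>

definition beta_splitting_trees ::
  "real \<Rightarrow> (nat \<Rightarrow> 'a measure) \<Rightarrow> (nat \<Rightarrow> real \<Rightarrow> 'a \<Rightarrow> nat set set) \<Rightarrow> (nat \<Rightarrow> 'a \<Rightarrow> nat) \<Rightarrow> bool" where
  "beta_splitting_trees \<beta> M X J \<longleftrightarrow>
     (\<forall>n\<ge>2. beta_splitting_chain \<beta> n (M n) (X n) \<and> uniform_leaf n (M n) (X n) (J n))"

end

theory Submission
  imports Defs
begin

text \<open>
  Both expansions come from moving a vertical line of integration to the left across zeros of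
  \<open>\<phi> = phi \<beta>\<close> and collecting residues.

  Two analytic facts make this possible. On the closed right half plane \<open>\<phi>\<close> has positive real part
  except at its simple zero \<open>0\<close> (\<open>Re_phi_pos\<close>), because \<open>|B(z + \<beta> + 2, \<beta> + 1)|\<close> stays below its value at
  \<open>z = 0\<close>; so all other zeros lie to the left. In every vertical strip that Beta function decays
  like \<open>|Im z| powr (-1 - min \<beta> 1)\<close> (\<open>Beta_decay_strip\<close>), so that \<open>F = 1/\<phi> - \<eta>\<close> decays integrably
  (\<open>F_decay_strip\<close>), every strip contains finitely many zeros, and \<open>vertical_contour_shift\<close>
  applies. The residues of \<open>exp (z x) F z\<close> are \<open>1/\<mu>\<close> at \<open>0\<close> and \<open>u_term\<close> at the other zeros.

  \<^bold>\<open>The potential measure.\<close> The potential measure \<open>U\<close> has Laplace transform \<open>1/\<phi>\<close>. Hence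
  \<open>\<phi>(1) exp (-x) U(dx)\<close> is a probability measure with characteristic function
  \<open>\<phi>(1) / \<phi>(1 - i s) = \<phi>(1) \<eta> + \<phi>(1) F(1 - i s)\<close>, a constant plus an integrable function. Levy's
  inversion formula turns the constant into an atom at \<open>0\<close> and the integrable part into a continuous
  density (\<open>inversion_with_atom\<close>, \<open>distribution_of_interval_masses\<close>). Undoing the tilt, the density
  of \<open>U\<close> is the integral of \<open>exp (z x) F z / (2 \<pi> i)\<close> over \<open>Re z = 1\<close>, and moving that line to
  \<open>Re z = -\<sigma>\<close> gives the stated decomposition (\<open>potential_density_eq_line_integral\<close>).

  \<^bold>\<open>The tree.\<close> Put \<open>H k = (\<Sum>j=1..k. (-1)^(j+1) (k choose j) / \<phi>(j))\<close>. The operator of one split, seen from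
  a fixed label, is diagonal in the basis of binomial coefficients with eigenvalues \<open>-\<phi>(j)\<close>
  (\<open>Beta_binomial_moment\<close>), so \<open>H\<close> solves the first-step equation \<open>mean_height_recursion\<close>. In other
  words, the generator of the partition chain maps the function "\<open>H (m - 1)\<close>, where \<open>m\<close> is the size of
  the block of label \<open>j\<close>" to minus the indicator that \<open>j\<close> is not yet a singleton
  (\<open>generator_total_height\<close>). Integrating over time identifies the mean height on \<open>n\<close> leaves as
  \<open>H (n - 1)\<close> (\<open>leaf_height_integral\<close>). Finally \<open>H k\<close> is the sum of the residues at \<open>1, ..., k\<close> of
  \<open>rice_kernel (k + 1) z / \<phi>(z)\<close>. The integral of that function over \<open>Re z = b\<close> tends to \<open>0\<close> as \<open>b \<rightarrow> \<infinity>\<close>,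
  so \<open>H k\<close> is the negative sum of the residues at \<open>0\<close> and at the zeros in the strip, up to an integral
  over \<open>Re z = -\<sigma>\<close> (\<open>rice_integral\<close>), and that integral is of the order
  \<open>\<Gamma>(n) / \<Gamma>(n + \<sigma>) = O(n powr -\<sigma>)\<close> (\<open>mean_height_asymptotics\<close>).

  Realness follows from \<open>\<phi>(cnj z) = cnj (\<phi> z)\<close>, which permutes the zeros in a strip.
\<close>

section \<open>The modulus of the complex Beta function\<close>

lemma Re_pos_not_nonpos_Int: "Re w > 0 \<Longrightarrow> w \<notin> \<int>\<^sub>\<le>\<^sub>0"
  by (auto elim!: nonpos_Ints_cases)

lemma Gamma_nonzero_Re_pos: "Re w > 0 \<Longrightarrow> Gamma w \<noteq> 0"
  by (simp add: Gamma_eq_zero_iff Re_pos_not_nonpos_Int)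

lemma cmod_Gamma_ratio_pos: "Re w > 0 \<Longrightarrow> x > 0 \<Longrightarrow> cmod (Gamma w) / Gamma x > 0"
  by (simp add: Gamma_nonzero_Re_pos Gamma_real_pos)

lemma Beta_real_pos: "x > 0 \<Longrightarrow> y > 0 \<Longrightarrow> Beta x y > (0 :: real)"
  by (simp add: Beta_def Gamma_real_pos)

text \<open>
  The logarithm of Euler's limit formula for the ratio: \<open>x\<close> and \<open>Complex x t\<close> have the same real part, so the
  powers of \<open>n\<close> cancel. Monotonicity and concavity in \<open>x\<close> can then be checked term by term.
\<close>
lemma Gamma_ratio_log_limit:
  fixes x t :: real
  assumes "x > 0"
  shows "(\<lambda>n. \<Sum>k\<le>n. ln (x + real k) - ln ((x + real k)\<^sup>2 + t\<^sup>2) / 2)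
           \<longlonglongrightarrow> ln (cmod (Gamma (Complex x t)) / Gamma x)"
proof -
  define w where "w = Complex x t"
  have w: "w \<notin> \<int>\<^sub>\<le>\<^sub>0" "x \<notin> \<int>\<^sub>\<le>\<^sub>0"
    using assms Re_pos_not_nonpos_Int[of w] by (auto simp: w_def elim!: nonpos_Ints_cases)
  have pos: "cmod (Gamma w) / Gamma x > 0"
    using assms by (intro cmod_Gamma_ratio_pos) (auto simp: w_def)
  have "(\<lambda>n. cmod (Gamma_series w n) / Gamma_series x n) \<longlonglongrightarrow> cmod (Gamma w) / Gamma x"
    using w assms by (intro tendsto_intros Gamma_series_LIMSEQ) (auto simp: Gamma_eq_zero_iff)
  hence "(\<lambda>n. ln (cmod (Gamma_series w n) / Gamma_series x n)) \<longlonglongrightarrow> ln (cmod (Gamma w) / Gamma x)"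
    using pos by (intro tendsto_ln) auto
  moreover have "ln (cmod (Gamma_series w n) / Gamma_series x n) =
      (\<Sum>k\<le>n. ln (x + real k) - ln ((x + real k)\<^sup>2 + t\<^sup>2) / 2)" for n
  proof -
    have p: "(x + real k) > 0" "(x + real k)\<^sup>2 + t\<^sup>2 > 0" for k
      using assms by (auto intro: add_pos_nonneg)
    have q: "(x + real k) / sqrt ((x + real k)\<^sup>2 + t\<^sup>2) > 0" for k
      by (intro divide_pos_pos p real_sqrt_gt_0_iff[THEN iffD2])
    have nw: "cmod (w + of_nat k) = sqrt ((x + real k)\<^sup>2 + t\<^sup>2)" for k
      by (simp add: w_def cmod_def)
    have "cmod (Gamma_series w n) / Gamma_series x n =
            pochhammer x (Suc n) / cmod (pochhammer w (Suc n))"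
    proof -
      have "cmod (exp (w * of_real (ln (real n)))) = exp (x * ln (real n))"
        by (simp add: w_def)
      moreover have "Re w = x" by (simp add: w_def)
      moreover have "pochhammer x (Suc n) > 0" using assms by (intro pochhammer_pos)
      ultimately show ?thesis
        by (simp add: Gamma_series_def norm_divide norm_mult)
    qed
    also have "\<dots> = (\<Prod>k\<le>n. (x + real k) / sqrt ((x + real k)\<^sup>2 + t\<^sup>2))"
      by (simp only: pochhammer_prod prod_norm [symmetric] nw prod_dividef [symmetric]
             lessThan_Suc_atMost atLeast0LessThan)
    finally have "ln (cmod (Gamma_series w n) / Gamma_series x n) =
      (\<Sum>k\<le>n. ln ((x + real k) / sqrt ((x + real k)\<^sup>2 + t\<^sup>2)))"
      by (simp only:) (intro ln_prod finite_atMost less_imp_neq[OF q, symmetric])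
    also have "\<dots> = (\<Sum>k\<le>n. ln (x + real k) - ln ((x + real k)\<^sup>2 + t\<^sup>2) / 2)"
      by (intro sum.cong refl) (simp add: ln_div ln_sqrt less_imp_neq[OF p(2), symmetric] less_imp_neq[OF p(1), symmetric])
    finally show ?thesis .
  qed
  ultimately show ?thesis by (simp add: w_def)
qed

lemma cmod_Gamma_ratio_mono:
  fixes x y t :: real
  assumes "0 < x" "x \<le> y"
  shows "cmod (Gamma (Complex x t)) / Gamma x \<le> cmod (Gamma (Complex y t)) / Gamma y"
proof -
  have pos: "cmod (Gamma (Complex s t)) / Gamma s > 0" if "s > 0" for s
    using that by (intro cmod_Gamma_ratio_pos) auto
  have term_mono: "ln u - ln (u\<^sup>2 + t\<^sup>2) / 2 \<le> ln v - ln (v\<^sup>2 + t\<^sup>2) / 2" if "0 < u" "u \<le> v" for u v :: real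
  proof -
    have p: "u\<^sup>2 + t\<^sup>2 > 0" "v\<^sup>2 + t\<^sup>2 > 0" "v > 0" using that by (auto intro: add_pos_nonneg)
    have "u\<^sup>2 * (v\<^sup>2 + t\<^sup>2) \<le> v\<^sup>2 * (u\<^sup>2 + t\<^sup>2)"
      using that mult_right_mono[of "u\<^sup>2" "v\<^sup>2" "t\<^sup>2"] by (simp add: algebra_simps power_mono)
    hence "ln (u\<^sup>2 * (v\<^sup>2 + t\<^sup>2)) \<le> ln (v\<^sup>2 * (u\<^sup>2 + t\<^sup>2))"
      using that p by (subst ln_le_cancel_iff) auto
    thus ?thesis using that p
      by (simp add: ln_mult ln_realpow less_imp_neq[OF p(1), symmetric] less_imp_neq[OF p(2), symmetric])
  qed
  have "ln (cmod (Gamma (Complex x t)) / Gamma x) \<le> ln (cmod (Gamma (Complex y t)) / Gamma y)"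
    using assms
    by (intro LIMSEQ_le[OF Gamma_ratio_log_limit Gamma_ratio_log_limit])
       (auto intro!: sum_mono term_mono exI[of _ 0])
  thus ?thesis using pos[of x] pos[of y] assms by (subst (asm) ln_le_cancel_iff) auto
qed

lemma log_ratio_convex:
  fixes t :: real
  shows "convex_on {0<..} (\<lambda>y. ln (y\<^sup>2 + t\<^sup>2) / 2 - ln y)"
proof (rule f''_ge0_imp_convex)
  have p: "y\<^sup>2 + t\<^sup>2 > 0" if "y > 0" for y using that by (auto intro: add_pos_nonneg)
  show "((\<lambda>y. ln (y\<^sup>2 + t\<^sup>2) / 2 - ln y) has_real_derivative (y / (y\<^sup>2 + t\<^sup>2) - 1 / y)) (at y)"
    if "y \<in> {0<..}" for y
    using that p[of y] by (auto intro!: derivative_eq_intros simp: divide_simps)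
  show "((\<lambda>y. y / (y\<^sup>2 + t\<^sup>2) - 1 / y) has_real_derivative
          ((t\<^sup>2 - y\<^sup>2) / (y\<^sup>2 + t\<^sup>2)\<^sup>2 + 1 / y\<^sup>2)) (at y)" if "y \<in> {0<..}" for y
    using that p[of y]
    by (auto intro!: derivative_eq_intros simp: power2_eq_square)
  show "0 \<le> (t\<^sup>2 - y\<^sup>2) / (y\<^sup>2 + t\<^sup>2)\<^sup>2 + 1 / y\<^sup>2" if "y \<in> {0<..}" for y
  proof -
    have "(t\<^sup>2 - y\<^sup>2) * y\<^sup>2 + (y\<^sup>2 + t\<^sup>2)\<^sup>2 = 3 * (t\<^sup>2 * y\<^sup>2) + (t\<^sup>2)\<^sup>2"
      by (simp add: power2_eq_square algebra_simps)
    moreover have "\<dots> \<ge> 0" by simp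
    moreover have "(t\<^sup>2 - y\<^sup>2) / (y\<^sup>2 + t\<^sup>2)\<^sup>2 + 1 / y\<^sup>2
       = ((t\<^sup>2 - y\<^sup>2) * y\<^sup>2 + (y\<^sup>2 + t\<^sup>2)\<^sup>2) / ((y\<^sup>2 + t\<^sup>2)\<^sup>2 * y\<^sup>2)"
      using that p[of y] by (simp add: add_frac_eq less_imp_neq[symmetric])
    ultimately show ?thesis by simp
  qed
qed auto

text \<open>
  Put \<open>R s = |\<Gamma>(s + i t)| / \<Gamma>(s)\<close>. By \<open>log_ratio_convex\<close> every term of the series for \<open>ln (R s)\<close> is concave, so
  \<open>ln R\<close> is concave; interpolation between \<open>x\<close> and \<open>x + 1\<close> with \<open>R (x + 1) = R x * |x + i t| / x\<close> gives the bound.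
\<close>
lemma cmod_Gamma_ratio_growth:
  fixes x b t :: real
  assumes "0 < x" "0 \<le> b" "b \<le> 1"
  shows "cmod (Gamma (Complex x t)) / Gamma x * (cmod (Complex x t) / x) powr b
           \<le> cmod (Gamma (Complex (x + b) t)) / Gamma (x + b)"
proof -
  define R where "R = (\<lambda>s. cmod (Gamma (Complex s t)) / Gamma s)"
  have pos: "R s > 0" if "s > 0" for s
    using that unfolding R_def by (intro cmod_Gamma_ratio_pos) auto
  have R1: "R (x + 1) = R x * (cmod (Complex x t) / x)"
  proof -
    have "Gamma (Complex x t + 1) = Complex x t * Gamma (Complex x t)"
      using assms by (intro Gamma_plus1 Re_pos_not_nonpos_Int) auto
    moreover have "Complex x t + 1 = Complex (x + 1) t" by (simp add: complex_eq_iff)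
    moreover have "Gamma (x + 1) = x * Gamma x"
      using assms by (intro Gamma_plus1) (auto elim!: nonpos_Ints_cases)
    ultimately show ?thesis by (simp add: R_def norm_mult mult_ac)
  qed
  have conv: "(1 - b) * (ln u - ln (u\<^sup>2 + t\<^sup>2) / 2) + b * (ln (1 + u) - ln ((1 + u)\<^sup>2 + t\<^sup>2) / 2)
      \<le> ln (b + u) - ln ((b + u)\<^sup>2 + t\<^sup>2) / 2" if "u > 0" for u
    using convex_onD[OF log_ratio_convex[of t], of b u "1 + u"] that assms
    by (simp add: algebra_simps)
  have "(1 - b) * ln (R x) + b * ln (R (x + 1)) \<le> ln (R (x + b))"
    unfolding R_def
  proof (rule LIMSEQ_le[OF tendsto_add[OF tendsto_mult_left tendsto_mult_left]])
    show "(\<lambda>n. \<Sum>k\<le>n. ln (x + real k) - ln ((x + real k)\<^sup>2 + t\<^sup>2) / 2)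
           \<longlonglongrightarrow> ln (cmod (Gamma (Complex x t)) / Gamma x)"
      by (rule Gamma_ratio_log_limit) fact
    show "(\<lambda>n. \<Sum>k\<le>n. ln ((x+1) + real k) - ln (((x+1) + real k)\<^sup>2 + t\<^sup>2) / 2)
           \<longlonglongrightarrow> ln (cmod (Gamma (Complex (x+1) t)) / Gamma (x+1))"
      by (rule Gamma_ratio_log_limit) (use assms in auto)
    show "(\<lambda>n. \<Sum>k\<le>n. ln ((x+b) + real k) - ln (((x+b) + real k)\<^sup>2 + t\<^sup>2) / 2)
           \<longlonglongrightarrow> ln (cmod (Gamma (Complex (x+b) t)) / Gamma (x+b))"
      by (rule Gamma_ratio_log_limit) (use assms in auto)
  qed (use assms in \<open>auto simp: sum_distrib_left sum.distrib[symmetric] add_ac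
          intro!: sum_mono conv[simplified add_ac] exI[of _ 0]\<close>)
  also have "(1 - b) * ln (R x) + b * ln (R (x + 1)) = ln (R x) + b * ln (cmod (Complex x t) / x)"
    using pos[of x] assms by (subst R1, subst ln_mult) (auto simp: complex_eq_iff algebra_simps)
  also have "\<dots> = ln (R x * (cmod (Complex x t) / x) powr b)"
    using pos[of x] assms by (subst ln_mult) (auto simp: complex_eq_iff ln_powr)
  finally have "R x * (cmod (Complex x t) / x) powr b \<le> R (x + b)"
    using pos[of x] pos[of "x+b"] assms
    by (subst (asm) ln_le_cancel_iff) (auto simp: complex_eq_iff)
  thus ?thesis by (simp only: R_def)
qed

lemma cmod_Beta_eq:
  fixes w :: complex and b :: real
  assumes "0 < Re w" "0 < b"
  shows "cmod (Beta w (of_real b)) =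
           (cmod (Gamma w) / Gamma (Re w)) / (cmod (Gamma (w + of_real b)) / Gamma (Re w + b)) * Beta (Re w) b"
proof -
  have "cmod (Beta w (of_real b)) = cmod (Gamma w) * Gamma b / cmod (Gamma (w + of_real b))"
    using assms Gamma_real_pos[of b] by (simp add: Beta_def norm_mult norm_divide Gamma_complex_of_real)
  moreover have "Gamma (Re w) > 0" "Gamma (Re w + b) > 0" "Gamma (w + of_real b) \<noteq> 0"
    using assms by (auto intro!: Gamma_real_pos Gamma_nonzero_Re_pos)
  ultimately show ?thesis
    by (simp add: Beta_def)
qed

lemma cmod_Beta_le:
  fixes w :: complex and b :: real
  assumes "0 < Re w" "0 < b"
  shows "cmod (Beta w (of_real b)) \<le> Beta (Re w) b"
proof -
  have "cmod (Gamma (w + of_real b)) / Gamma (Re w + b) > 0"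
    using assms by (intro cmod_Gamma_ratio_pos) auto
  moreover have "cmod (Gamma w) / Gamma (Re w) \<le> cmod (Gamma (w + of_real b)) / Gamma (Re w + b)"
    using cmod_Gamma_ratio_mono[of "Re w" "Re w + b" "Im w"] assms
    by (simp add: Complex_eq algebra_simps flip: complex_eq)
  moreover have "Beta (Re w) b \<ge> 0" using assms by (simp add: Beta_real_pos less_imp_le)
  ultimately have "(cmod (Gamma w) / Gamma (Re w)) / (cmod (Gamma (w + of_real b)) / Gamma (Re w + b))
      * Beta (Re w) b \<le> 1 * Beta (Re w) b"
    by (intro mult_right_mono) (simp_all only: divide_le_eq_1_pos)
  thus ?thesis using assms by (simp only: cmod_Beta_eq mult_1)
qed

text \<open>
  For \<open>b \<le> 1\<close> the growth of the Gamma ratio over a step of length \<open>b\<close> is decay of order \<open>b\<close> of the Beta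
  function.
\<close>
lemma cmod_Beta_le_powr:
  fixes w :: complex and b :: real
  assumes "0 < Re w" "0 < b" "b \<le> 1"
  shows "cmod (Beta w (of_real b)) \<le> (Re w / cmod w) powr b * Beta (Re w) b"
proof -
  have *: "Complex (Re w + b) (Im w) = w + of_real b" by (simp add: complex_eq_iff)
  have pos: "cmod (Gamma (w + of_real b)) / Gamma (Re w + b) > 0"
    using assms by (intro cmod_Gamma_ratio_pos) auto
  have w: "cmod w > 0" using assms by auto
  have "cmod (Gamma w) / Gamma (Re w) * (cmod w / Re w) powr b \<le> cmod (Gamma (w + of_real b)) / Gamma (Re w + b)"
    using cmod_Gamma_ratio_growth[of "Re w" b "Im w"] assms by (simp add: *)
  hence "(cmod (Gamma w) / Gamma (Re w)) / (cmod (Gamma (w + of_real b)) / Gamma (Re w + b)) \<le> (Re w / cmod w) powr b"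
    using pos assms w by (simp add: powr_divide field_simps)
  moreover have "Beta (Re w) b \<ge> 0" using assms by (simp add: Beta_real_pos less_imp_le)
  ultimately show ?thesis using assms
    by (simp only: cmod_Beta_eq mult_right_mono)
qed

section \<open>The Laplace exponent on the right half plane\<close>

lemma meromorphic_on_Gamma: "Gamma meromorphic_on A"
proof -
  have "(\<lambda>z::complex. inverse (rGamma z)) meromorphic_on A"
    by (intro meromorphic_intros analytic_on_imp_meromorphic_on analytic_intros)
  thus ?thesis by (simp add: Gamma_def [abs_def])
qed

definition phi_raw :: "real \<Rightarrow> complex \<Rightarrow> complex" where
  "phi_raw \<beta> z = Beta (of_real \<beta> + 2) (of_real \<beta> + 1) - Beta (z + of_real \<beta> + 2) (of_real \<beta> + 1)"

lemma phi_def': "phi \<beta> = remove_sings (phi_raw \<beta>)"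
  by (simp add: phi_def phi_raw_def [abs_def])

lemma meromorphic_on_phi_raw: "phi_raw \<beta> meromorphic_on A"
proof -
  have 1: "(\<lambda>z. Gamma (z + of_real \<beta> + 2)) meromorphic_on A"
    by (intro meromorphic_on_compose[OF meromorphic_on_Gamma[of UNIV]] analytic_intros) auto
  have 2: "(\<lambda>z. rGamma (z + of_real \<beta> + 2 + (of_real \<beta> + 1))) meromorphic_on A"
    by (intro analytic_on_imp_meromorphic_on analytic_intros)
  have "(\<lambda>z. Beta (of_real \<beta> + 2) (of_real \<beta> + 1) -
          Gamma (z + of_real \<beta> + 2) * Gamma (of_real \<beta> + 1) *
          rGamma (z + of_real \<beta> + 2 + (of_real \<beta> + 1))) meromorphic_on A"
    by (intro meromorphic_intros 1 2)
  thus ?thesis by (simp only: phi_raw_def [abs_def] Beta_altdef)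
qed

lemma nicely_meromorphic_phi: "phi \<beta> nicely_meromorphic_on A"
  unfolding phi_def' by (intro remove_sings_nicely_meromorphic meromorphic_on_phi_raw)

lemma nicely_meromorphic_inverse_phi: "(\<lambda>z. 1 / phi \<beta> z) nicely_meromorphic_on A"
  using nicely_meromorphic_on_inverse[OF nicely_meromorphic_phi[of \<beta> A]] by (simp add: inverse_eq_divide)

lemma phi_raw_analytic_at: "z + of_real \<beta> + 2 \<notin> \<int>\<^sub>\<le>\<^sub>0 \<Longrightarrow> phi_raw \<beta> analytic_on {z}"
  unfolding phi_raw_def [abs_def] Beta_altdef
  by (intro analytic_intros) auto

lemma phi_eq:
  assumes "z + of_real \<beta> + 2 \<notin> \<int>\<^sub>\<le>\<^sub>0"
  shows "phi \<beta> z = Beta (of_real \<beta> + 2) (of_real \<beta> + 1) - Beta (z + of_real \<beta> + 2) (of_real \<beta> + 1)"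
  using phi_raw_analytic_at[OF assms] by (simp add: phi_def' phi_raw_def)

lemma phi_analytic_at: "z + of_real \<beta> + 2 \<notin> \<int>\<^sub>\<le>\<^sub>0 \<Longrightarrow> phi \<beta> analytic_on {z}"
  unfolding phi_def' by (intro remove_sings_analytic_on phi_raw_analytic_at)

context
  fixes \<beta> :: real
  assumes beta_pos: "\<beta> > 0"
begin

definition "B0 = Beta (\<beta> + 2) (\<beta> + 1)"

lemma B0_pos: "B0 > 0"
  unfolding B0_def using beta_pos by (intro Beta_real_pos) auto

lemma B0_complex: "Beta (of_real \<beta> + 2) (of_real \<beta> + 1) = complex_of_real B0"
  unfolding B0_def by (simp flip: Beta_complex_of_real)

lemma eta_eq: "eta \<beta> = 1 / B0"
  by (simp add: eta_def B0_def inverse_eq_divide)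

lemma phi_eq_Re:
  assumes "Re z > - 2 - \<beta>"
  shows "phi \<beta> z = of_real B0 - Beta (z + of_real \<beta> + 2) (of_real (\<beta> + 1))"
  using phi_eq[of z \<beta>] assms by (simp add: Re_pos_not_nonpos_Int B0_complex)

lemma Im_nonzero_not_nonpos_Int: "Im z \<noteq> 0 \<Longrightarrow> z \<notin> \<int>\<^sub>\<le>\<^sub>0"
  by (auto elim!: nonpos_Ints_cases)

lemma phi_eq_Im:
  assumes "Im z \<noteq> 0"
  shows "phi \<beta> z = of_real B0 - Beta (z + of_real \<beta> + 2) (of_real (\<beta> + 1))"
  using phi_eq[of z \<beta>] Im_nonzero_not_nonpos_Int[of "z + of_real \<beta> + 2"] assms by (simp add: B0_complex)

lemma phi_analytic_Re: "Re z > - 2 - \<beta> \<Longrightarrow> phi \<beta> analytic_on {z}"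
  by (intro phi_analytic_at Re_pos_not_nonpos_Int) auto

lemma phi_0: "phi \<beta> 0 = 0"
  using beta_pos by (subst phi_eq_Re) (simp_all add: B0_def flip: Beta_complex_of_real)

lemma Beta_real_strict_antimono:
  assumes "0 < x" "x < y" "(0::real) < b"
  shows "Beta y b < Beta x b"
proof (rule DERIV_neg_imp_decreasing[OF assms(2)])
  fix s assume s: "x \<le> s" "s \<le> y"
  have "((\<lambda>s. Beta s b) has_real_derivative (Beta s b * (Digamma s - Digamma (s + b)))) (at s)"
    using s assms by (intro has_field_derivative_Beta1) (auto elim!: nonpos_Ints_cases)
  moreover have "Beta s b * (Digamma s - Digamma (s + b)) < 0"
    using s assms Digamma_real_strict_mono[of s "s + b"]
    by (intro mult_pos_neg Beta_real_pos) auto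
  ultimately show "\<exists>y. ((\<lambda>s. Beta s b) has_real_derivative y) (at s) \<and> y < 0" by blast
qed

lemma Beta_shift:
  fixes x y :: "'a :: {Gamma, real_normed_field}"
  assumes "x \<notin> \<int>\<^sub>\<le>\<^sub>0" "y \<notin> \<int>\<^sub>\<le>\<^sub>0" "x + y \<noteq> 0"
  shows "x * Beta x (y + 1) = y * Beta (x + 1) y"
proof -
  have "(x + y) * (x * Beta x (y + 1)) = x * ((x + y) * Beta x (y + 1))" by (simp add: algebra_simps)
  also have "\<dots> = x * (y * Beta x y)" using Beta_plus1_right[OF assms(2), of x] by simp
  also have "\<dots> = y * (x * Beta x y)" by (simp add: algebra_simps)
  also have "\<dots> = y * ((x + y) * Beta (x + 1) y)" using Beta_plus1_left[OF assms(1), of y] by simp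
  also have "\<dots> = (x + y) * (y * Beta (x + 1) y)" by (simp add: algebra_simps)
  finally show ?thesis using assms(3) by simp
qed

text \<open>
  One unit of the second parameter is traded for a factor \<open>1 / |w|\<close>. This is the source of decay faster than
  what \<open>cmod_Beta_le_powr\<close> gives for exponents up to one.
\<close>
lemma cmod_Beta_shift_le:
  fixes w :: complex and b :: real
  assumes "0 < Re w" "0 < b"
  shows "cmod (Beta w (of_real (b + 1))) \<le> b / cmod w * cmod (Beta (w + 1) (of_real b))"
proof -
  have "of_real b \<notin> (\<int>\<^sub>\<le>\<^sub>0 :: complex set)" "w \<notin> \<int>\<^sub>\<le>\<^sub>0"
    using assms by (auto intro!: Re_pos_not_nonpos_Int)
  moreover have "w + of_real b \<noteq> 0" using assms by (auto simp: complex_eq_iff)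
  ultimately have "w * Beta w (of_real b + 1) = of_real b * Beta (w + 1) (of_real b)"
    by (intro Beta_shift)
  hence "cmod w * cmod (Beta w (of_real b + 1)) = b * cmod (Beta (w + 1) (of_real b))"
    using assms by (simp flip: norm_mult) (simp add: norm_mult)
  moreover have "cmod w > 0" using assms by auto
  ultimately show ?thesis by (simp add: field_simps)
qed

text \<open>
  After one shift the modulus carries the factor \<open>\<beta> / |w|\<close>, which off the real axis is strictly smaller than
  \<open>\<beta> / Re w\<close>, while the other factor is at most its value at \<open>Re w + 1\<close>.
\<close>
lemma cmod_Beta_less:
  fixes w :: complex
  assumes "0 < Re w" "Im w \<noteq> 0"
  shows "cmod (Beta w (of_real (\<beta> + 1))) < Beta (Re w) (\<beta> + 1)"
proof -
  have "(Re w)\<^sup>2 < (cmod w)\<^sup>2" using assms by (simp add: cmod_power2)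
  hence w: "cmod w > Re w" by (rule power2_less_imp_less) auto
  have "cmod (Beta w (of_real (\<beta> + 1))) \<le> \<beta> / cmod w * cmod (Beta (w + 1) (of_real \<beta>))"
    using assms beta_pos by (intro cmod_Beta_shift_le)
  also have "\<dots> \<le> \<beta> / cmod w * Beta (Re w + 1) \<beta>"
    using assms beta_pos cmod_Beta_le[of "w + 1" \<beta>] by (intro mult_left_mono) auto
  also have "\<dots> < \<beta> / Re w * Beta (Re w + 1) \<beta>"
    using assms beta_pos w by (intro mult_strict_right_mono divide_strict_left_mono Beta_real_pos mult_pos_pos) auto
  also have "\<dots> = Beta (Re w) (\<beta> + 1)"
  proof -
    have "Re w \<notin> \<int>\<^sub>\<le>\<^sub>0" "\<beta> \<notin> \<int>\<^sub>\<le>\<^sub>0"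
      using assms beta_pos by (auto elim!: nonpos_Ints_cases)
    thus ?thesis using Beta_shift[of "Re w" \<beta>] assms beta_pos by (simp add: field_simps)
  qed
  finally show ?thesis .
qed

text \<open>
  With \<open>w = z + \<beta> + 2\<close>, the modulus of \<open>B(w, \<beta> + 1)\<close> is strictly below \<open>B0\<close>: for real \<open>z > 0\<close> by strict monotonicity,
  and off the real axis by \<open>cmod_Beta_less\<close>.
\<close>
lemma Re_phi_pos:
  assumes "Re z \<ge> 0" "z \<noteq> 0"
  shows "Re (phi \<beta> z) > 0"
proof -
  let ?w = "z + of_real \<beta> + 2"
  have "cmod (Beta ?w (of_real (\<beta> + 1))) < B0"
  proof (cases "Im z = 0")
    case True
    hence "Re z > 0" using assms by (auto simp: complex_eq_iff)
    have "cmod (Beta ?w (of_real (\<beta> + 1))) \<le> Beta (Re ?w) (\<beta> + 1)"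
      using assms beta_pos by (intro cmod_Beta_le) auto
    also have "\<dots> < B0" unfolding B0_def
      using \<open>Re z > 0\<close> beta_pos by (intro Beta_real_strict_antimono) auto
    finally show ?thesis .
  next
    case False
    have "cmod (Beta ?w (of_real (\<beta> + 1))) < Beta (Re ?w) (\<beta> + 1)"
      using assms beta_pos False by (intro cmod_Beta_less) auto
    also have "\<dots> \<le> B0" unfolding B0_def
      using assms beta_pos by (intro Beta_real_mono) auto
    finally show ?thesis .
  qed
  hence "Re (Beta ?w (of_real (\<beta> + 1))) < B0" using complex_Re_le_cmod order_le_less_trans by blast
  thus ?thesis using assms beta_pos by (subst phi_eq_Re) auto
qed

text \<open>
  This uniform lower bound allows a line of integration to be moved to \<open>Re z \<rightarrow> \<infinity>\<close>.
\<close>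
lemma cmod_phi_ge:
  assumes "Re z \<ge> 1"
  shows "cmod (phi \<beta> z) \<ge> Re (phi \<beta> 1)" "Re (phi \<beta> 1) > 0"
proof -
  show "Re (phi \<beta> 1) > 0" by (intro Re_phi_pos) auto
  let ?w = "z + of_real \<beta> + 2"
  have "cmod (Beta ?w (of_real (\<beta> + 1))) \<le> Beta (Re ?w) (\<beta> + 1)"
    using assms beta_pos by (intro cmod_Beta_le) auto
  also have "\<dots> \<le> Beta (\<beta> + 3) (\<beta> + 1)"
    using assms beta_pos by (intro Beta_real_mono) auto
  also have "\<dots> = B0 - Re (phi \<beta> 1)"
  proof -
    have "1 + of_real \<beta> + 2 = complex_of_real (\<beta> + 3)" by simp
    thus ?thesis using beta_pos by (subst phi_eq_Re) (simp_all only: Beta_complex_of_real, simp_all)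
  qed
  finally have "Re (Beta ?w (of_real (\<beta> + 1))) \<le> B0 - Re (phi \<beta> 1)"
    using complex_Re_le_cmod order_trans by blast
  hence "Re (phi \<beta> z) \<ge> Re (phi \<beta> 1)" using assms beta_pos by (subst phi_eq_Re) auto
  thus "cmod (phi \<beta> z) \<ge> Re (phi \<beta> 1)" using complex_Re_le_cmod order_trans by blast
qed

end

section \<open>Zeros of the Laplace exponent\<close>

lemma filtermap_cnj_at: "filtermap cnj (at z) = at (cnj z)"
proof -
  have "eventually Q (filtermap cnj (at z)) \<longleftrightarrow> eventually Q (at (cnj z))" for Q
  proof -
    have d: "dist (cnj a) (cnj b) = dist a b" for a b
      by (simp add: dist_norm flip: complex_cnj_diff)
    have "eventually Q (filtermap cnj (at z)) \<longleftrightarrow> (\<exists>d>0. \<forall>x. x \<noteq> z \<and> dist x z < d \<longrightarrow> Q (cnj x))"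
      by (simp add: eventually_filtermap eventually_at)
    also have "\<dots> \<longleftrightarrow> (\<exists>d>0. \<forall>x. x \<noteq> cnj z \<and> dist x (cnj z) < d \<longrightarrow> Q x)"
      using d by (metis complex_cnj_cnj)
    finally show ?thesis by (simp add: eventually_at)
  qed
  thus ?thesis by (simp add: filter_eq_iff)
qed

lemma tendsto_at_cnj_iff:
  assumes "\<And>z. f (cnj z) = cnj (f z)"
  shows "(f \<longlongrightarrow> cnj c) (at (cnj z)) \<longleftrightarrow> (f \<longlongrightarrow> c) (at z)"
proof -
  have "(f \<longlongrightarrow> cnj c) (at (cnj z)) \<longleftrightarrow> ((\<lambda>z. cnj (f z)) \<longlongrightarrow> cnj c) (at z)"
    by (simp add: filtermap_cnj_at[symmetric] filterlim_filtermap assms)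
  thus ?thesis by (simp only: lim_cnj)
qed

lemma remove_sings_cnj:
  assumes "\<And>z. f (cnj z) = cnj (f z)"
  shows "remove_sings f (cnj z) = cnj (remove_sings f z)"
proof (cases "\<exists>c. f \<midarrow>z\<rightarrow> c")
  case True
  then obtain c where c: "f \<midarrow>z\<rightarrow> c" by blast
  hence "f \<midarrow>cnj z\<rightarrow> cnj c" by (simp add: tendsto_at_cnj_iff assms)
  with c show ?thesis by (metis remove_sings_eqI)
next
  case False
  hence "\<nexists>c. f \<midarrow>cnj z\<rightarrow> c" using tendsto_at_cnj_iff[of f _ z, OF assms] by (metis complex_cnj_cnj)
  with False show ?thesis by (simp add: remove_sings_def)
qed

lemma phi_cnj: "phi \<beta> (cnj z) = cnj (phi \<beta> z)"
  unfolding phi_def'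
proof (rule remove_sings_cnj)
  show "phi_raw \<beta> (cnj w) = cnj (phi_raw \<beta> w)" for w
    by (simp add: phi_raw_def Beta_def cnj_Gamma)
qed

lemma isolated_zero_phi_cnj: "isolated_zero (phi \<beta>) (cnj z) \<longleftrightarrow> isolated_zero (phi \<beta>) z"
  using tendsto_at_cnj_iff[of "phi \<beta>" 0 z, OF phi_cnj]
  by (simp add: isolated_zero_def filtermap_cnj_at[symmetric] eventually_filtermap phi_cnj)

context
  fixes \<beta> :: real
  assumes beta_pos: "\<beta> > 0"
begin

abbreviation "\<delta> \<equiv> min \<beta> 1"

lemma phi_eventually_nonzero: "eventually (\<lambda>w. phi \<beta> w \<noteq> 0) (at z)"
proof (rule ccontr)
  assume "\<not> ?thesis"
  hence "frequently (\<lambda>w. phi \<beta> w = 0) (at z)" by (simp add: frequently_def)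
  hence "phi \<beta> 1 = 0"
    by (rule frequently_eq_meromorphic_imp_constant[OF _ nicely_meromorphic_phi[of \<beta> UNIV]]) auto
  thus False using Re_phi_pos[OF beta_pos, of 1] by simp
qed

text \<open>
  At a pole of \<open>\<phi>\<close> the value of \<open>phi\<close> is \<open>0\<close> and so is that of \<open>1 / phi\<close>, as it should be. Hence the reciprocal is
  analytic at the poles too, and its singularities are exactly the zeros.
\<close>
lemma inverse_phi_analytic_iff: "(\<lambda>w. 1 / phi \<beta> w) analytic_on {z} \<longleftrightarrow> \<not> isolated_zero (phi \<beta>) z"
proof
  assume "\<not> isolated_zero (phi \<beta>) z"
  hence "\<not> is_pole (\<lambda>w. inverse (phi \<beta> w)) z" by (simp add: is_pole_inverse_iff)
  thus "(\<lambda>w. 1 / phi \<beta> w) analytic_on {z}"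
    using nicely_meromorphic_on_imp_analytic_at[OF nicely_meromorphic_inverse_phi[of \<beta> UNIV]]
    by (simp add: inverse_eq_divide)
next
  assume "(\<lambda>w. 1 / phi \<beta> w) analytic_on {z}"
  hence "\<not> is_pole (\<lambda>w. inverse (phi \<beta> w)) z"
    using analytic_at_imp_no_pole by (auto simp: inverse_eq_divide)
  thus "\<not> isolated_zero (phi \<beta>) z" by (simp add: is_pole_inverse_iff)
qed

lemma isolated_zero_phi_0: "isolated_zero (phi \<beta>) 0"
proof -
  have "phi \<beta> analytic_on {0}" using phi_analytic_Re[OF beta_pos, of 0] beta_pos by simp
  hence "phi \<beta> \<midarrow>0\<rightarrow> phi \<beta> 0" by (intro isContD analytic_at_imp_isCont)
  thus ?thesis using phi_eventually_nonzero[of 0] phi_0[OF beta_pos] by (simp add: isolated_zero_def)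
qed

lemma zeros_Re_neg:
  assumes "isolated_zero (phi \<beta>) z" "z \<noteq> 0"
  shows "Re z < 0"
proof (rule ccontr)
  assume "\<not> Re z < 0"
  hence "phi \<beta> z = 0" using zero_isolated_zero_nicely_meromorphic[OF assms(1) nicely_meromorphic_phi] by simp
  thus False using Re_phi_pos[OF beta_pos, of z] assms(2) \<open>\<not> Re z < 0\<close> by simp
qed

section \<open>Decay in vertical strips\<close>

lemma powr_minus_one_minus: "y > (0 :: real) \<Longrightarrow> y powr (-1-b) = y powr (-b) / y"
  using powr_add[of y "-b" "-1"] by (simp add: powr_minus divide_inverse add.commute)

text \<open>
  One shift gives \<open>1 / |Im w|\<close> and leaves \<open>B(w + 1, \<beta>)\<close>. For \<open>\<beta> \<le> 1\<close> this decays with exponent \<open>\<beta>\<close>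
  by \<open>cmod_Beta_le_powr\<close>; for \<open>\<beta> > 1\<close> a second shift gives another factor \<open>1 / |Im w|\<close>. This explains the
  exponent \<open>\<delta> = min \<beta> 1\<close>.
\<close>
lemma Beta_decay_right:
  assumes "K \<ge> 1"
  shows "\<exists>C>0. \<forall>w. 1 \<le> Re w \<longrightarrow> Re w \<le> K \<longrightarrow> \<bar>Im w\<bar> \<ge> 1 \<longrightarrow>
     cmod (Beta w (of_real (\<beta> + 1))) \<le> C * \<bar>Im w\<bar> powr (-1-\<delta>)"
proof (cases "\<beta> \<le> 1")
  case True
  show ?thesis
  proof (intro exI[of _ "\<beta> * ((K + 1) powr \<beta> * Beta 1 \<beta>)"] conjI allI impI)
    show "\<beta> * ((K + 1) powr \<beta> * Beta 1 \<beta>) > 0" using assms beta_pos by (auto intro!: mult_pos_pos Beta_real_pos)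
    fix w assume w: "1 \<le> Re w" "Re w \<le> K" "\<bar>Im w\<bar> \<ge> 1"
    have im: "\<bar>Im w\<bar> \<le> cmod w" "\<bar>Im w\<bar> \<le> cmod (w + 1)"
      using abs_Im_le_cmod[of w] abs_Im_le_cmod[of "w + 1"] by auto
    have "cmod (Beta (w + 1) (of_real \<beta>)) \<le> (Re (w+1) / cmod (w+1)) powr \<beta> * Beta (Re (w+1)) \<beta>"
      using w beta_pos True by (intro cmod_Beta_le_powr) auto
    also have "\<dots> \<le> ((K + 1) / \<bar>Im w\<bar>) powr \<beta> * Beta 1 \<beta>"
      using w beta_pos im by (intro mult_mono powr_mono2 frac_le Beta_real_mono less_imp_le[OF Beta_real_pos]) auto
    also have "\<dots> = (K + 1) powr \<beta> * Beta 1 \<beta> * \<bar>Im w\<bar> powr (-\<beta>)"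
      using w assms by (simp add: powr_divide powr_minus_divide)
    finally have 1: "cmod (Beta (w + 1) (of_real \<beta>)) \<le> (K + 1) powr \<beta> * Beta 1 \<beta> * \<bar>Im w\<bar> powr (-\<beta>)" .
    have "cmod (Beta w (of_real (\<beta> + 1))) \<le> \<beta> / cmod w * cmod (Beta (w + 1) (of_real \<beta>))"
      using w beta_pos by (intro cmod_Beta_shift_le[OF beta_pos]) auto
    also have "\<dots> \<le> \<beta> / \<bar>Im w\<bar> * ((K + 1) powr \<beta> * Beta 1 \<beta> * \<bar>Im w\<bar> powr (-\<beta>))"
      using w beta_pos im 1 by (intro mult_mono frac_le) auto
    also have "\<dots> = \<beta> * ((K + 1) powr \<beta> * Beta 1 \<beta>) * \<bar>Im w\<bar> powr (-1-\<beta>)"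
      using w by (simp add: powr_minus_one_minus mult_ac)
    finally show "cmod (Beta w (of_real (\<beta> + 1))) \<le> \<beta> * ((K + 1) powr \<beta> * Beta 1 \<beta>) * \<bar>Im w\<bar> powr (-1-\<delta>)"
      using True by simp
  qed
next
  case False
  show ?thesis
  proof (intro exI[of _ "\<beta> * ((\<beta> - 1) * Beta 1 (\<beta> - 1))"] conjI allI impI)
    show "\<beta> * ((\<beta> - 1) * Beta 1 (\<beta> - 1)) > 0" using False beta_pos by (auto intro!: mult_pos_pos Beta_real_pos)
    fix w assume w: "1 \<le> Re w" "Re w \<le> K" "\<bar>Im w\<bar> \<ge> 1"
    have im: "\<bar>Im w\<bar> \<le> cmod w" "\<bar>Im w\<bar> \<le> cmod (w + 1)"
      using abs_Im_le_cmod[of w] abs_Im_le_cmod[of "w + 1"] by auto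
    have "cmod (Beta (w + 1) (of_real (\<beta> - 1 + 1))) \<le> (\<beta> - 1) / cmod (w + 1) * cmod (Beta (w + 1 + 1) (of_real (\<beta> - 1)))"
      using w False by (intro cmod_Beta_shift_le[OF beta_pos]) auto
    also have "\<dots> \<le> (\<beta> - 1) / \<bar>Im w\<bar> * Beta 1 (\<beta> - 1)"
    proof (intro mult_mono frac_le)
      have "cmod (Beta (w + 1 + 1) (of_real (\<beta> - 1))) \<le> Beta (Re (w + 1 + 1)) (\<beta> - 1)"
        using w False by (intro cmod_Beta_le) auto
      also have "\<dots> \<le> Beta 1 (\<beta> - 1)" using w False by (intro Beta_real_mono) auto
      finally show "cmod (Beta (w + 1 + 1) (of_real (\<beta> - 1))) \<le> Beta 1 (\<beta> - 1)" .
    qed (use w False im in auto)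
    finally have 1: "cmod (Beta (w + 1) (of_real \<beta>)) \<le> (\<beta> - 1) / \<bar>Im w\<bar> * Beta 1 (\<beta> - 1)" by simp
    have "cmod (Beta w (of_real (\<beta> + 1))) \<le> \<beta> / cmod w * cmod (Beta (w + 1) (of_real \<beta>))"
      using w beta_pos by (intro cmod_Beta_shift_le[OF beta_pos]) auto
    also have "\<dots> \<le> \<beta> / \<bar>Im w\<bar> * ((\<beta> - 1) / \<bar>Im w\<bar> * Beta 1 (\<beta> - 1))"
      using w beta_pos im 1 by (intro mult_mono frac_le) auto
    also have "\<dots> = \<beta> * ((\<beta> - 1) * Beta 1 (\<beta> - 1)) * \<bar>Im w\<bar> powr (-2)"
      using w powr_minus_one_minus[of "\<bar>Im w\<bar>" 1] by (simp add: powr_minus_divide)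
    finally show "cmod (Beta w (of_real (\<beta> + 1))) \<le> \<beta> * ((\<beta> - 1) * Beta 1 (\<beta> - 1)) * \<bar>Im w\<bar> powr (-1-\<delta>)"
      using False by simp
  qed
qed

text \<open>
  Moving the first argument by one multiplies the Beta function by \<open>(v + b) / v\<close>, which is at most \<open>1 + b\<close> in
  modulus when \<open>|Im v| \<ge> 1\<close>. Hence an estimate to the right extends to any strip.
\<close>
lemma cmod_Beta_shift_left_le:
  fixes w :: complex
  assumes "\<bar>Im w\<bar> \<ge> 1" "b > 0"
  shows "cmod (Beta w (of_real b)) \<le> (1 + b) ^ N * cmod (Beta (w + of_nat N) (of_real b))"
proof (induction N)
  case (Suc N)
  let ?v = "w + of_nat N"
  have v: "\<bar>Im ?v\<bar> \<ge> 1" using assms by simp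
  hence "?v \<notin> \<int>\<^sub>\<le>\<^sub>0" using Im_nonzero_not_nonpos_Int[OF beta_pos, of ?v] by auto
  hence "(?v + of_real b) * Beta (?v + 1) (of_real b) = ?v * Beta ?v (of_real b)"
    by (intro Beta_plus1_left)
  hence "cmod ?v * cmod (Beta ?v (of_real b)) = cmod (?v + of_real b) * cmod (Beta (?v + 1) (of_real b))"
    by (metis norm_mult)
  also have "\<dots> \<le> (cmod ?v * (1 + b)) * cmod (Beta (?v + 1) (of_real b))"
  proof (intro mult_right_mono)
    have "cmod ?v \<ge> 1" using abs_Im_le_cmod[of ?v] v by linarith
    have "cmod (?v + of_real b) \<le> cmod ?v + b" using assms norm_triangle_ineq[of ?v "of_real b"] by simp
    also have "\<dots> \<le> cmod ?v * (1 + b)" using \<open>cmod ?v \<ge> 1\<close> assms mult_right_mono[of 1 "cmod ?v" b] by (simp add: algebra_simps)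
    finally show "cmod (?v + of_real b) \<le> cmod ?v * (1 + b)" .
  qed auto
  finally have "cmod ?v * cmod (Beta ?v (of_real b)) \<le> cmod ?v * ((1 + b) * cmod (Beta (?v + 1) (of_real b)))"
    by (simp add: mult_ac)
  moreover have "cmod ?v > 0" using v abs_Im_le_cmod[of ?v] by linarith
  ultimately have "cmod (Beta ?v (of_real b)) \<le> (1 + b) * cmod (Beta (?v + 1) (of_real b))"
    by (simp only: mult_le_cancel_left_pos)
  hence "(1 + b) ^ N * cmod (Beta ?v (of_real b)) \<le> (1 + b) ^ N * ((1 + b) * cmod (Beta (?v + 1) (of_real b)))"
    using assms by (intro mult_left_mono) auto
  with Suc.IH show ?case by (simp add: algebra_simps)
qed auto

lemma Beta_decay_strip:
  "\<exists>C>0. \<forall>w. \<bar>Re w\<bar> \<le> K \<longrightarrow> \<bar>Im w\<bar> \<ge> 1 \<longrightarrow>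
     cmod (Beta w (of_real (\<beta> + 1))) \<le> C * \<bar>Im w\<bar> powr (-1-\<delta>)"
proof -
  obtain N where N: "real N \<ge> \<bar>K\<bar> + 1" using real_arch_simple by blast
  obtain C where C: "C > 0" "\<And>w. \<lbrakk>1 \<le> Re w; Re w \<le> \<bar>K\<bar> + real N; \<bar>Im w\<bar> \<ge> 1\<rbrakk> \<Longrightarrow>
     cmod (Beta w (of_real (\<beta> + 1))) \<le> C * \<bar>Im w\<bar> powr (-1-\<delta>)"
    using Beta_decay_right[of "\<bar>K\<bar> + real N"] N by fastforce
  show ?thesis
  proof (intro exI[of _ "(1 + (\<beta> + 1)) ^ N * C"] conjI allI impI)
    show "(1 + (\<beta> + 1)) ^ N * C > 0" using C beta_pos by auto
    fix w assume w: "\<bar>Re w\<bar> \<le> K" "\<bar>Im w\<bar> \<ge> 1"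
    have "cmod (Beta w (of_real (\<beta> + 1))) \<le> (1 + (\<beta> + 1)) ^ N * cmod (Beta (w + of_nat N) (of_real (\<beta> + 1)))"
      using w beta_pos by (intro cmod_Beta_shift_left_le) auto
    also have "\<dots> \<le> (1 + (\<beta> + 1)) ^ N * (C * \<bar>Im (w + of_nat N)\<bar> powr (-1-\<delta>))"
      using w N beta_pos by (intro mult_left_mono C) auto
    finally show "cmod (Beta w (of_real (\<beta> + 1))) \<le> (1 + (\<beta> + 1)) ^ N * C * \<bar>Im w\<bar> powr (-1-\<delta>)"
      by simp
  qed
qed

text \<open>
  Let \<open>b\<close> be the Beta function in \<open>\<phi> = B0 - b\<close>. Then \<open>F = b / (B0 \<phi>)\<close>, and high up in the strip \<open>|b| \<le> B0 / 2\<close>,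
  so \<open>\<phi>\<close> is bounded away from zero and \<open>F\<close> inherits the decay of \<open>b\<close>.
\<close>
lemma F_decay_strip:
  "\<exists>C>0. \<exists>T\<ge>1. \<forall>z. \<bar>Re z\<bar> \<le> K \<longrightarrow> \<bar>Im z\<bar> \<ge> T \<longrightarrow> phi \<beta> z \<noteq> 0 \<and> cmod (F \<beta> z) \<le> C * \<bar>Im z\<bar> powr (-1-\<delta>)"
proof -
  obtain C where C: "C > 0" "\<And>w. \<lbrakk>\<bar>Re w\<bar> \<le> \<bar>K\<bar> + \<beta> + 2; \<bar>Im w\<bar> \<ge> 1\<rbrakk> \<Longrightarrow>
     cmod (Beta w (of_real (\<beta> + 1))) \<le> C * \<bar>Im w\<bar> powr (-1-\<delta>)"
    using Beta_decay_strip[of "\<bar>K\<bar> + \<beta> + 2"] by blast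
  define B where "B = B0 \<beta>"
  have B: "B > 0" using B0_pos[OF beta_pos] by (simp add: B_def)
  \<comment> \<open>beyond height \<open>T\<close> the Beta function is at most half of \<open>B0\<close>\<close>
  define T where "T = max 1 (2 * C / B)"
  show ?thesis
  proof (rule exI[of _ "2 / B\<^sup>2 * C"], intro conjI exI[of _ T] allI impI)
    show "2 / B\<^sup>2 * C > 0" using C B by simp
    show "T \<ge> 1" by (simp add: T_def)
    fix z assume z: "\<bar>Re z\<bar> \<le> K" "\<bar>Im z\<bar> \<ge> T"
    define b where "b = Beta (z + of_real \<beta> + 2) (of_real (\<beta> + 1))"
    have z1: "\<bar>Im z\<bar> \<ge> 1" using z by (simp add: T_def)
    have b: "cmod b \<le> C * \<bar>Im z\<bar> powr (-1-\<delta>)"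
      using C(2)[of "z + of_real \<beta> + 2"] z z1 beta_pos by (simp add: b_def)
    also have "\<dots> \<le> C * \<bar>Im z\<bar> powr (-1)"
      using z1 C beta_pos by (intro mult_left_mono powr_mono) auto
    also have "\<dots> = C / \<bar>Im z\<bar>" using z1 by (simp add: powr_minus_divide)
    also have "\<dots> \<le> C / (2 * C / B)" using z C B by (intro divide_left_mono mult_pos_pos) (auto simp: T_def)
    also have "\<dots> = B / 2" using C B by simp
    finally have b2: "cmod b \<le> B / 2" .
    have phi: "phi \<beta> z = of_real B - b" using z1 phi_eq_Im[OF beta_pos, of z] by (auto simp: b_def B_def)
    have n: "cmod (phi \<beta> z) \<ge> B / 2" using norm_triangle_ineq2[of "of_real B" b] b2 B unfolding phi by simp
    hence nz: "phi \<beta> z \<noteq> 0" using B by auto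
    have "F \<beta> z = b / (of_real B * phi \<beta> z)"
      using nz B by (simp add: F_def eta_eq[OF beta_pos] flip: B_def) (simp add: phi field_simps)
    hence "cmod (F \<beta> z) = cmod b / (B * cmod (phi \<beta> z))" using B by (simp add: norm_divide norm_mult)
    also have "\<dots> \<le> (C * \<bar>Im z\<bar> powr (-1-\<delta>)) / (B * (B / 2))"
      using b n B C(1) by (intro frac_le mult_left_mono) auto
    finally have "cmod (F \<beta> z) \<le> 2 / B\<^sup>2 * C * \<bar>Im z\<bar> powr (-1-\<delta>)"
      using B by (simp add: power2_eq_square mult_ac)
    with nz show "phi \<beta> z \<noteq> 0" "cmod (F \<beta> z) \<le> 2 / B\<^sup>2 * C * \<bar>Im z\<bar> powr (-1-\<delta>)" by auto
  qed
qed

text \<open>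
  Zeros are isolated, and by \<open>F_decay_strip\<close> those of a strip lie in a compact rectangle.
\<close>
lemma finite_zeros_Re: "finite {z. isolated_zero (phi \<beta>) z \<and> \<bar>Re z\<bar> \<le> K}"
proof -
  obtain C T where T: "C > 0" "T \<ge> 1"
    "\<And>z. \<lbrakk>\<bar>Re z\<bar> \<le> K; \<bar>Im z\<bar> \<ge> T\<rbrakk> \<Longrightarrow> phi \<beta> z \<noteq> 0 \<and> cmod (F \<beta> z) \<le> C * \<bar>Im z\<bar> powr (-1-\<delta>)"
    using F_decay_strip[of K] by blast
  have "eventually (\<lambda>z. \<not> isolated_zero (phi \<beta>) z) (cosparse UNIV)"
    by (intro meromorphic_on_imp_not_zero_cosparse)
       (use nicely_meromorphic_phi in \<open>auto simp: nicely_meromorphic_on_def\<close>)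
  hence "{z. isolated_zero (phi \<beta>) z} sparse_in UNIV" by (simp add: eventually_cosparse)
  hence "{z. isolated_zero (phi \<beta>) z} sparse_in cbox (Complex (-\<bar>K\<bar>) (-T)) (Complex \<bar>K\<bar> T)"
    by (rule sparse_in_subset) auto
  hence "finite ({z. isolated_zero (phi \<beta>) z} \<inter> cbox (Complex (-\<bar>K\<bar>) (-T)) (Complex \<bar>K\<bar> T))"
    by (metis sparse_in_compact_finite compact_cbox inf_commute)
  moreover have "{z. isolated_zero (phi \<beta>) z \<and> \<bar>Re z\<bar> \<le> K} \<subseteq>
      {z. isolated_zero (phi \<beta>) z} \<inter> cbox (Complex (-\<bar>K\<bar>) (-T)) (Complex \<bar>K\<bar> T)"
  proof safe
    fix z assume z: "isolated_zero (phi \<beta>) z" "\<bar>Re z\<bar> \<le> K"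
    have "phi \<beta> z = 0" using zero_isolated_zero_nicely_meromorphic[OF z(1) nicely_meromorphic_phi] .
    hence "\<bar>Im z\<bar> < T" using T(3)[of z] z(2) by force
    thus "z \<in> cbox (Complex (-\<bar>K\<bar>) (-T)) (Complex \<bar>K\<bar> T)" using z(2) by (auto simp: in_cbox_complex_iff)
  qed
  ultimately show ?thesis by (rule rev_finite_subset)
qed

lemma finite_zeros_strip: "finite (zeros_strip \<beta> \<sigma>)"
  by (rule finite_subset[OF _ finite_zeros_Re[of "\<bar>\<sigma>\<bar>"]]) (auto simp: zeros_strip_def zeros_def)

text \<open>
  The derivative is \<open>B0\<close> times a difference of two values of the strictly increasing digamma function.
\<close>
lemma mu_eq: "\<exists>m>0. mu \<beta> = complex_of_real m"
proof -
  define m where "m = B0 \<beta> * (Digamma (2 * \<beta> + 3) - Digamma (\<beta> + 2))"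
  have "m > 0" unfolding m_def
    using B0_pos[OF beta_pos] Digamma_real_strict_mono[of "\<beta> + 2" "2 * \<beta> + 3"] beta_pos by auto
  have "((\<lambda>z. Beta (z + of_real \<beta> + 2) (of_real (\<beta> + 1))) has_field_derivative
           Beta (0 + of_real \<beta> + 2) (of_real (\<beta> + 1)) *
             (Digamma (0 + of_real \<beta> + 2) - Digamma (0 + of_real \<beta> + 2 + of_real (\<beta> + 1))) * (1 + 0 + 0)) (at (0::complex))"
    by (intro DERIV_chain2[OF has_field_derivative_Beta1] derivative_intros Re_pos_not_nonpos_Int)
       (use beta_pos in auto)
  moreover have "0 + of_real \<beta> + 2 = complex_of_real (\<beta> + 2)" "0 + of_real \<beta> + 2 + of_real (\<beta> + 1) = complex_of_real (2 * \<beta> + 3)"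
    by simp_all
  ultimately have "((\<lambda>z. Beta (z + of_real \<beta> + 2) (of_real (\<beta> + 1))) has_field_derivative (- of_real m)) (at (0::complex))"
    using beta_pos
    by (simp only: Beta_complex_of_real Polygamma_of_real) (simp add: m_def B0_def Polygamma_of_real algebra_simps)
  hence "((\<lambda>z. of_real (B0 \<beta>) - Beta (z + of_real \<beta> + 2) (of_real (\<beta> + 1))) has_field_derivative (0 - (- of_real m))) (at (0::complex))"
    by (intro derivative_intros)
  moreover have "eventually (\<lambda>z. phi \<beta> z = of_real (B0 \<beta>) - Beta (z + of_real \<beta> + 2) (of_real (\<beta> + 1))) (nhds 0)"
  proof -
    have "eventually (\<lambda>z. z \<in> {z. Re z > - 2 - \<beta>}) (nhds (0::complex))"
      using beta_pos by (intro eventually_nhds_in_open open_halfspace_Re_gt) auto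
    thus ?thesis by eventually_elim (use phi_eq_Re[OF beta_pos] in auto)
  qed
  ultimately have "(phi \<beta> has_field_derivative of_real m) (at (0::complex))"
    by (subst DERIV_cong_ev[OF refl _ refl]) auto
  thus ?thesis using \<open>m > 0\<close> by (auto simp: mu_def dest: DERIV_imp_deriv)
qed

end

section \<open>Moving a vertical line of integration\<close>

lemma integrable_of_powr_decay:
  fixes f :: "real \<Rightarrow> complex"
  assumes cont: "continuous_on UNIV f"
    and bound: "\<And>t. \<bar>t\<bar> \<ge> T \<Longrightarrow> cmod (f t) \<le> C * \<bar>t\<bar> powr (-1-d)"
    and "T \<ge> 1" "d > 0"
  shows "integrable lborel f"
proof -
  define h where "h = (\<lambda>t::real. indicator {1..} t * t powr (-1-d))"
  have h_int: "integrable lborel h"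
  proof -
    have "((\<lambda>t. t powr (-1-d)) has_integral -(1 powr (-1-d+1)) / (-1-d+1)) {1..}"
      using assms by (intro has_integral_powr_to_inf) auto
    hence "(\<lambda>t. t powr (-1-d)) absolutely_integrable_on {1..}"
      by (intro nonnegative_absolutely_integrable_1) auto
    hence "integrable (completion lborel) h"
      by (simp add: h_def[abs_def] set_integrable_def)
    moreover have "h \<in> borel_measurable lborel" unfolding h_def by measurable
    ultimately show ?thesis by (simp add: integrable_completion)
  qed
  have h_int': "integrable lborel (\<lambda>t. h (- t))"
    using lborel_integrable_real_affine[OF h_int, of "-1" 0] by simp
  obtain M where M: "\<And>t. t \<in> {-T..T} \<Longrightarrow> cmod (f t) \<le> M"
  proof -
    have "compact (f ` {-T..T})" by (intro compact_continuous_image continuous_on_subset[OF cont]) auto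
    thus ?thesis using that compact_imp_bounded by (metis bounded_iff imageI)
  qed
  have "0 \<in> {-T..T}" using \<open>T \<ge> 1\<close> by auto
  hence M0: "M \<ge> 0" using M order_trans[OF norm_ge_zero] by blast
  have C0: "C \<ge> 0"
  proof -
    have "0 \<le> C * \<bar>T\<bar> powr (-1-d)" by (rule order_trans[OF norm_ge_zero bound]) simp
    thus ?thesis using \<open>T \<ge> 1\<close> by (simp add: zero_le_mult_iff)
  qed
  show ?thesis
  proof (rule Bochner_Integration.integrable_bound)
    show "integrable lborel (\<lambda>t. M * indicator {-T..T} t + C * (h t + h (- t)))"
      using h_int h_int' by (intro Bochner_Integration.integrable_add integrable_mult_right integrable_real_indicator)
           (auto simp: emeasure_lborel_Icc_eq)
    show "f \<in> borel_measurable lborel" using borel_measurable_continuous_onI[OF cont] by simp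
    show "AE t in lborel. cmod (f t) \<le> norm (M * indicator {-T..T} t + C * (h t + h (- t)))"
    proof (intro AE_I2)
      fix t :: real
      have h0: "h s \<ge> 0" for s by (simp add: h_def)
      have nn: "M * indicator {-T..T} t + C * (h t + h (- t)) \<ge> 0"
        using M0 C0 h0 by (intro add_nonneg_nonneg mult_nonneg_nonneg) auto
      show "cmod (f t) \<le> norm (M * indicator {-T..T} t + C * (h t + h (- t)))"
      proof (cases "\<bar>t\<bar> \<le> T")
        case True
        hence "t \<in> {-T..T}" by auto
        hence "cmod (f t) \<le> M * indicator {-T..T} t" using M[of t] by simp
        also have "\<dots> \<le> M * indicator {-T..T} t + C * (h t + h (- t))" using C0 h0 by simp
        finally show ?thesis using nn by simp
      next
        case False
        hence "cmod (f t) \<le> C * \<bar>t\<bar> powr (-1-d)" by (intro bound) auto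
        also have "\<bar>t\<bar> powr (-1-d) = h t + h (- t)"
          using False \<open>T \<ge> 1\<close> by (auto simp: h_def indicator_def abs_if)
        finally show ?thesis using nn M0 by (auto simp: indicator_def)
      qed
    qed
  qed
qed

lemma symmetric_truncation_limit:
  fixes f :: "real \<Rightarrow> complex"
  assumes int: "integrable lborel f"
  shows "(\<lambda>n. LINT t|lborel. indicator {-real n..real n} t *\<^sub>R f t) \<longlonglongrightarrow> (LINT t|lborel. f t)"
proof (rule integral_dominated_convergence[where w = "\<lambda>t. norm (f t)"])
  have meas [measurable]: "f \<in> borel_measurable borel" using borel_measurable_integrable[OF int] by simp
  show "AE t in lborel. (\<lambda>n. indicator {-real n..real n} t *\<^sub>R f t) \<longlonglongrightarrow> f t"
  proof (intro AE_I2 tendsto_eventually)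
    fix t :: real
    obtain N where "real N \<ge> \<bar>t\<bar>" using real_arch_simple by blast
    thus "eventually (\<lambda>n. indicator {-real n..real n} t *\<^sub>R f t = f t) sequentially"
      by (intro eventually_sequentiallyI[of N]) (auto simp: indicator_def)
  qed
  show "(\<lambda>t. indicator {-real n..real n} t *\<^sub>R f t) \<in> borel_measurable lborel" for n by measurable
  show "AE t in lborel. norm (indicator {-real n..real n} t *\<^sub>R f t) \<le> norm (f t)" for n
    by (intro AE_I2) (simp add: indicator_def)
qed (use int in simp_all)

lemma LINT_symmetric_limit:
  fixes f :: "real \<Rightarrow> complex"
  assumes int: "integrable lborel f"
  shows "(\<lambda>n. integral {-real n..real n} f) \<longlonglongrightarrow> (LINT t|lborel. f t)"
proof -
  have "(LINT t|lborel. indicator {-real n..real n} t *\<^sub>R f t) = integral {-real n..real n} f" for n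
  proof -
    have "set_integrable lborel {-real n..real n} f"
      using int unfolding set_integrable_def by (intro integrable_mult_indicator) auto
    thus ?thesis using set_borel_integral_eq_integral(2)[of "{-real n..real n}" f]
      by (simp add: set_lebesgue_integral_def)
  qed
  thus ?thesis using symmetric_truncation_limit[OF int] by simp
qed

lemma contour_integral_rectpath_eq:
  assumes "a < b" "T > 0"
    and cont: "continuous_on (path_image (rectpath (Complex a (-T)) (Complex b T))) f"
  shows "contour_integral (rectpath (Complex a (-T)) (Complex b T)) f =
    contour_integral (linepath (Complex a (-T)) (Complex b (-T))) f + \<i> * integral {-T..T} (\<lambda>t. f (Complex b t))
    - contour_integral (linepath (Complex a T) (Complex b T)) f - \<i> * integral {-T..T} (\<lambda>t. f (Complex a t))"
proof -
  define p1 p2 p3 p4 where "p1 = Complex a (-T)" and "p2 = Complex b (-T)" and "p3 = Complex b T" and "p4 = Complex a T"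
  have rp: "rectpath p1 p3 = linepath p1 p2 +++ linepath p2 p3 +++ linepath p3 p4 +++ linepath p4 p1"
    by (simp add: rectpath_def Let_def p1_def p2_def p3_def p4_def)
  have pim: "path_image (rectpath p1 p3) = closed_segment p1 p2 \<union> closed_segment p2 p3 \<union> closed_segment p3 p4 \<union> closed_segment p4 p1"
    unfolding rp by (simp add: path_image_join Un_assoc)
  have ci: "f contour_integrable_on linepath p1 p2" "f contour_integrable_on linepath p2 p3"
     "f contour_integrable_on linepath p3 p4" "f contour_integrable_on linepath p4 p1"
    by (intro contour_integrable_continuous_linepath continuous_on_subset[OF cont[folded p1_def p3_def]],
        simp add: pim subset_eq)+
  have "contour_integral (rectpath p1 p3) f = contour_integral (linepath p1 p2) f + (contour_integral (linepath p2 p3) f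
     + (contour_integral (linepath p3 p4) f + contour_integral (linepath p4 p1) f))"
    unfolding rp using ci by simp
  moreover have "contour_integral (linepath p2 p3) f = \<i> * integral {-T..T} (\<lambda>t. f (Complex b t))"
    using assms by (intro contour_integral_linepath_same_Re) (auto simp: p2_def p3_def)
  moreover have "contour_integral (linepath p4 p1) f = - (\<i> * integral {-T..T} (\<lambda>t. f (Complex a t)))"
  proof -
    have "contour_integral (linepath p1 p4) f = \<i> * integral {-T..T} (\<lambda>t. f (Complex a t))"
      using assms by (intro contour_integral_linepath_same_Re) (auto simp: p1_def p4_def)
    thus ?thesis using contour_integral_reversepath[of "linepath p1 p4" f] by simp
  qed
  moreover have "contour_integral (linepath p3 p4) f = - contour_integral (linepath p4 p3) f"
    using contour_integral_reversepath[of "linepath p4 p3" f] by simp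
  ultimately show ?thesis by (simp add: p1_def p2_def p3_def p4_def)
qed

text \<open>
  The sign \<open>s\<close> selects the top or the bottom side of the rectangles.
\<close>
lemma contour_integral_horizontal_limit:
  assumes "a < b" "d > 0" "T \<ge> 1"
    and cont: "\<And>t. \<bar>t\<bar> \<ge> T \<Longrightarrow> continuous_on {z. Im z = t \<and> a \<le> Re z \<and> Re z \<le> b} f"
    and bound: "\<And>z. \<lbrakk>a \<le> Re z; Re z \<le> b; \<bar>Im z\<bar> \<ge> T\<rbrakk> \<Longrightarrow> cmod (f z) \<le> C * \<bar>Im z\<bar> powr (-1-d)"
    and s: "\<bar>s\<bar> = (1::real)"
  shows "(\<lambda>n. contour_integral (linepath (Complex a (s * real n)) (Complex b (s * real n))) f) \<longlonglongrightarrow> 0"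
proof (rule Lim_null_comparison)
  have C0: "C \<ge> 0"
  proof -
    have "0 \<le> C * \<bar>Im (Complex a T)\<bar> powr (-1-d)"
      by (rule order_trans[OF norm_ge_zero bound]) (use assms in auto)
    hence "0 \<le> C * \<bar>T\<bar> powr (-1-d)" by simp
    thus ?thesis using \<open>T \<ge> 1\<close> by (simp add: zero_le_mult_iff)
  qed
  have "(\<lambda>n. C * real n powr (-1-d) * (b - a)) \<longlonglongrightarrow> C * 0 * (b - a)"
    using assms by (intro tendsto_intros tendsto_neg_powr filterlim_real_sequentially) auto
  thus "(\<lambda>n. C * real n powr (-1-d) * (b - a)) \<longlonglongrightarrow> 0" by simp
  show "eventually (\<lambda>n. cmod (contour_integral (linepath (Complex a (s * real n)) (Complex b (s * real n))) f)
                    \<le> C * real n powr (-1-d) * (b - a)) sequentially"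
  proof (rule eventually_sequentiallyI[of "nat \<lceil>T\<rceil>"])
    fix n assume "n \<ge> nat \<lceil>T\<rceil>"
    hence n: "real n \<ge> T" by linarith
    let ?p = "Complex a (s * real n)" and ?q = "Complex b (s * real n)"
    have sn: "\<bar>s * real n\<bar> = real n" using s by (simp add: abs_mult)
    have seg: "closed_segment ?p ?q \<subseteq> {z. Im z = s * real n \<and> a \<le> Re z \<and> Re z \<le> b}"
      using \<open>a < b\<close> by (subst closed_segment_same_Im) (auto simp: closed_segment_eq_real_ivl)
    have "cmod (contour_integral (linepath ?p ?q) f) \<le> (C * real n powr (-1-d)) * cmod (?q - ?p)"
    proof (rule contour_integral_bound_linepath)
      show "f contour_integrable_on linepath ?p ?q"
        by (intro contour_integrable_continuous_linepath continuous_on_subset[OF cont[of "s * real n"] seg])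
           (use sn n in simp)
      show "0 \<le> C * real n powr (-1-d)" using C0 by simp
      show "cmod (f x) \<le> C * real n powr (-1-d)" if "x \<in> closed_segment ?p ?q" for x
        using bound[of x] that seg sn n by auto
    qed
    also have "cmod (?q - ?p) = b - a" using \<open>a < b\<close> by (simp add: cmod_def)
    finally show "cmod (contour_integral (linepath ?p ?q) f) \<le> C * real n powr (-1-d) * (b - a)" .
  qed
qed

text \<open>
  The residue theorem on rectangles of height tending to infinity: the horizontal sides vanish in the limit by
  the decay of \<open>f\<close>, and the vertical sides become the two line integrals. The margin \<open>e\<close> puts the
  rectangles inside an open strip.
\<close>
theorem vertical_contour_shift:
  assumes "a < b" "e > 0" "d > 0" "T \<ge> 1" "finite P"
    and holo: "f holomorphic_on {z. a - e < Re z \<and> Re z < b + e} - P"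
    and avoid: "\<And>p. p \<in> P \<Longrightarrow> Re p \<noteq> a \<and> Re p \<noteq> b"
    and bound: "\<And>z. \<lbrakk>a \<le> Re z; Re z \<le> b; \<bar>Im z\<bar> \<ge> T\<rbrakk> \<Longrightarrow> cmod (f z) \<le> C * \<bar>Im z\<bar> powr (-1-d)"
  shows "integrable lborel (\<lambda>t. f (Complex a t))" "integrable lborel (\<lambda>t. f (Complex b t))"
    "(LINT t|lborel. f (Complex b t)) - (LINT t|lborel. f (Complex a t)) =
        2 * of_real pi * (\<Sum>p \<in> {p\<in>P. a < Re p \<and> Re p < b}. residue f p)"
proof -
  let ?S = "{z. a - e < Re z \<and> Re z < b + e}"
  have cont: "continuous_on (?S - P) f" using holo by (rule holomorphic_on_imp_continuous_on)
  have cv: "continuous_on UNIV (\<lambda>t. f (Complex c t))" if "c = a \<or> c = b" for c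
  proof (rule continuous_on_compose2[OF cont])
    show "continuous_on UNIV (Complex c)" by (intro continuous_intros)
    show "range (Complex c) \<subseteq> ?S - P" using that \<open>a < b\<close> \<open>e > 0\<close> by (auto dest!: avoid)
  qed
  have int: "integrable lborel (\<lambda>t. f (Complex c t))" if "c = a \<or> c = b" for c
    using that \<open>a < b\<close> \<open>T \<ge> 1\<close> \<open>d > 0\<close>
    by (intro integrable_of_powr_decay[where T = T and C = C and d = d] cv) (auto intro!: order.trans[OF bound])
  show "integrable lborel (\<lambda>t. f (Complex a t))" "integrable lborel (\<lambda>t. f (Complex b t))"
    using int by auto
  obtain M where M: "\<And>p. p \<in> P \<Longrightarrow> \<bar>Im p\<bar> < M" "M > T"
  proof -
    define N where "N = Max (insert T ((\<lambda>p. \<bar>Im p\<bar>) ` P))"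
    have *: "x \<le> N" if "x \<in> insert T ((\<lambda>p. \<bar>Im p\<bar>) ` P)" for x
      unfolding N_def by (rule Max_ge) (use that \<open>finite P\<close> in auto)
    show ?thesis
    proof (rule that[of "N + 1"])
      show "\<bar>Im p\<bar> < N + 1" if "p \<in> P" for p using *[of "\<bar>Im p\<bar>"] that by simp
      show "T < N + 1" using *[of T] by simp
    qed
  qed
  define I where "I = (\<lambda>n. contour_integral (linepath (Complex a (-1 * real n)) (Complex b (-1 * real n))) f
     + \<i> * integral {-real n..real n} (\<lambda>t. f (Complex b t))
     - contour_integral (linepath (Complex a (1 * real n)) (Complex b (1 * real n))) f
     - \<i> * integral {-real n..real n} (\<lambda>t. f (Complex a t)))"
  have hcont: "continuous_on {z. Im z = t \<and> a \<le> Re z \<and> Re z \<le> b} f" if "\<bar>t\<bar> \<ge> M" for t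
    using that M \<open>e > 0\<close> by (intro continuous_on_subset[OF cont]) force
  have lim1: "I \<longlonglongrightarrow> 0 + \<i> * (LINT t|lborel. f (Complex b t)) - 0 - \<i> * (LINT t|lborel. f (Complex a t))"
    unfolding I_def
    by (intro tendsto_intros LINT_symmetric_limit int
          contour_integral_horizontal_limit[where T = M and C = C and d = d] hcont bound)
       (use assms M in auto)
  have "eventually (\<lambda>n. I n = 2 * of_real pi * \<i> * (\<Sum>p \<in> {p\<in>P. a < Re p \<and> Re p < b}. residue f p)) sequentially"
  proof (rule eventually_sequentiallyI[of "nat \<lceil>M\<rceil>"])
    fix n assume "n \<ge> nat \<lceil>M\<rceil>"
    hence n: "real n \<ge> M" by linarith
    hence n0: "real n > 0" using M \<open>T \<ge> 1\<close> by linarith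
    let ?p = "Complex a (-real n)" and ?q = "Complex b (real n)"
    have pim: "path_image (rectpath ?p ?q) \<subseteq> ?S - P"
      using n n0 M(1) avoid assms by (subst path_image_rectpath) force+
    have "contour_integral (rectpath ?p ?q) f =
        2 * pi * \<i> * (\<Sum>p\<in>P. winding_number (rectpath ?p ?q) p * residue f p)"
    proof (rule Residue_theorem[OF _ _ \<open>finite P\<close> holo _ _ pim])
      have S: "?S = {z. a - e < Re z} \<inter> {z. Re z < b + e}" by auto
      show "open ?S" unfolding S by (intro open_Int open_halfspace_Re_gt open_halfspace_Re_lt)
      show "connected ?S" unfolding S
        by (intro convex_connected convex_Int convex_halfspace_Re_gt convex_halfspace_Re_lt)
      show "\<forall>z. z \<notin> ?S \<longrightarrow> winding_number (rectpath ?p ?q) z = 0"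
        using assms n0 by (auto intro!: winding_number_rectpath_outside simp: in_cbox_complex_iff)
    qed auto
    also have "(\<Sum>p\<in>P. winding_number (rectpath ?p ?q) p * residue f p) =
       (\<Sum>p\<in>P. if a < Re p \<and> Re p < b then residue f p else 0)"
    proof (intro sum.cong refl)
      fix p assume p: "p \<in> P"
      have "\<bar>Im p\<bar> < real n" using M(1)[OF p] n by linarith
      show "winding_number (rectpath ?p ?q) p * residue f p = (if a < Re p \<and> Re p < b then residue f p else 0)"
      proof (cases "a < Re p \<and> Re p < b")
        case True
        hence "p \<in> box ?p ?q" using \<open>\<bar>Im p\<bar> < real n\<close> by (auto simp: in_box_complex_iff)
        from winding_number_rectpath[OF this] True show ?thesis by simp
      next
        case False
        hence "p \<notin> cbox ?p ?q" using avoid[OF p] by (auto simp: in_cbox_complex_iff)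
        hence "winding_number (rectpath ?p ?q) p = 0"
          using \<open>a < b\<close> n0 by (intro winding_number_rectpath_outside) auto
        thus ?thesis using False by auto
      qed
    qed
    also have "\<dots> = (\<Sum>p \<in> {p\<in>P. a < Re p \<and> Re p < b}. residue f p)"
      using \<open>finite P\<close> by (subst sum.inter_filter) auto
    also have "contour_integral (rectpath ?p ?q) f = I n"
      using contour_integral_rectpath_eq[OF \<open>a < b\<close> n0 continuous_on_subset[OF cont pim]] by (simp add: I_def)
    finally show "I n = 2 * of_real pi * \<i> * (\<Sum>p \<in> {p\<in>P. a < Re p \<and> Re p < b}. residue f p)" by simp
  qed
  hence "I \<longlonglongrightarrow> 2 * of_real pi * \<i> * (\<Sum>p \<in> {p\<in>P. a < Re p \<and> Re p < b}. residue f p)"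
    by (rule tendsto_eventually)
  with lim1 have "0 + \<i> * (LINT t|lborel. f (Complex b t)) - 0 - \<i> * (LINT t|lborel. f (Complex a t))
      = 2 * of_real pi * \<i> * (\<Sum>p \<in> {p\<in>P. a < Re p \<and> Re p < b}. residue f p)"
    by (rule LIMSEQ_unique)
  hence "\<i> * ((LINT t|lborel. f (Complex b t)) - (LINT t|lborel. f (Complex a t)))
      = \<i> * (2 * of_real pi * (\<Sum>p \<in> {p\<in>P. a < Re p \<and> Re p < b}. residue f p))"
    by (simp add: algebra_simps)
  thus "(LINT t|lborel. f (Complex b t)) - (LINT t|lborel. f (Complex a t)) =
        2 * of_real pi * (\<Sum>p \<in> {p\<in>P. a < Re p \<and> Re p < b}. residue f p)" by simp
qed

section \<open>Residues at the zeros\<close>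

text \<open>
  In the Cauchy product for the coefficient of \<open>1 / (z - \<rho>)\<close> only the principal part of \<open>g\<close> meets the
  Taylor coefficients of \<open>f\<close>. Any bound \<open>m\<close> on the order of the pole will do.
\<close>
lemma residue_analytic_mult_laurent:
  assumes f: "f analytic_on {\<rho>}"
    and G: "(\<lambda>x. g (\<rho> + x)) has_laurent_expansion G"
    and order: "\<And>n. n < - int m \<Longrightarrow> fls_nth G n = 0"
  shows "residue (\<lambda>z. f z * g z) \<rho> =
           (\<Sum>l = 1..m. fls_nth G (- int l) / fact (l - 1) * (deriv ^^ (l - 1)) f \<rho>)"
proof -
  define A where "A = fps_to_fls (fps_expansion f \<rho>)"
  have A: "(\<lambda>x. f (\<rho> + x)) has_laurent_expansion A"
    unfolding A_def by (intro has_laurent_expansion_fps analytic_at_imp_has_fps_expansion f)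
  have An: "fls_nth A i = (if i < 0 then 0 else (deriv ^^ nat i) f \<rho> / fact (nat i))" for i
    by (simp add: A_def fps_expansion_def)
  have "residue (\<lambda>z. f z * g z) \<rho> = fls_residue (A * G)"
    using has_laurent_expansion_residue[OF has_laurent_expansion_mult[OF A G]] .
  also have "\<dots> = (\<Sum>i = fls_subdegree A..-1 - fls_subdegree G. fls_nth A i * fls_nth G (-1 - i))"
    by (simp add: fls_times_nth(2))
  also have "\<dots> = (\<Sum>i \<in> {0..int m - 1}. fls_nth A i * fls_nth G (-1 - i))"
  proof (intro sum.mono_neutral_cong refl)
    fix i assume i: "i \<in> {0..int m - 1} - {fls_subdegree A..- 1 - fls_subdegree G}"
    hence "i < fls_subdegree A \<or> - 1 - i < fls_subdegree G" by auto
    thus "fls_nth A i * fls_nth G (-1 - i) = 0" by auto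
  next
    fix i assume i: "i \<in> {fls_subdegree A..- 1 - fls_subdegree G} - {0..int m - 1}"
    hence "i < 0 \<or> - 1 - i < - int m" by auto
    thus "fls_nth A i * fls_nth G (-1 - i) = 0" using order by (auto simp: An)
  qed auto
  also have "\<dots> = (\<Sum>i \<in> {0..int m - 1}. fls_nth A i * fls_nth G (- (i + 1)))"
  proof (intro sum.cong refl)
    fix i :: int
    have "-1 - i = - (i + 1)" by simp
    thus "fls_nth A i * fls_nth G (-1 - i) = fls_nth A i * fls_nth G (- (i + 1))" by (simp only:)
  qed
  also have "\<dots> = (\<Sum>l = 1..m. fls_nth A (int l - 1) * fls_nth G (- int l))"
    by (rule sum.reindex_bij_witness[of _ "\<lambda>l. int l - 1" "\<lambda>i. nat (i + 1)"]) auto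
  also have "\<dots> = (\<Sum>l = 1..m. fls_nth G (- int l) / fact (l - 1) * (deriv ^^ (l - 1)) f \<rho>)"
  proof (intro sum.cong refl)
    fix l assume "l \<in> {1..m}"
    hence "nat (int l - 1) = l - 1" "int l - 1 \<ge> 0" by auto
    thus "fls_nth A (int l - 1) * fls_nth G (- int l) = fls_nth G (- int l) / fact (l - 1) * (deriv ^^ (l - 1)) f \<rho>"
      by (simp add: An)
  qed
  finally show ?thesis .
qed

lemma open_cnj_image: "open A \<Longrightarrow> open (cnj ` A)"
proof -
  assume "open A"
  moreover have "cnj ` A = cnj -` A" by (auto simp: image_iff) (metis complex_cnj_cnj)
  ultimately show ?thesis by (simp add: open_vimage continuous_on_cnj)
qed

text \<open>
  Conjugation maps a small circle around \<open>\<rho>\<close> to a reversed circle around \<open>cnj \<rho>\<close>; the reversal cancels the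
  sign in \<open>cnj (2 \<pi> i) = - 2 \<pi> i\<close>.
\<close>
lemma residue_cnj:
  assumes sym: "\<And>z. f (cnj z) = cnj (f z)"
    and hol: "open A" "\<rho> \<in> A" "f holomorphic_on A - {\<rho>}"
  shows "residue f (cnj \<rho>) = cnj (residue f \<rho>)"
proof -
  obtain r where r: "r > 0" "cball \<rho> r \<subseteq> A" using hol by (auto simp: open_contains_cball)
  have circ: "cnj \<circ> circlepath \<rho> r = reversepath (circlepath (cnj \<rho>) r)"
  proof
    fix t :: real
    have "exp (2 * of_real pi * \<i>) = (1 :: complex)" by simp
    thus "(cnj \<circ> circlepath \<rho> r) t = reversepath (circlepath (cnj \<rho>) r) t"
      by (simp add: circlepath reversepath_def exp_cnj algebra_simps exp_diff exp_minus inverse_eq_divide)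
  qed
  have 1: "contour_integral (circlepath \<rho> r) f = 2 * pi * \<i> * residue f \<rho>"
    using base_residue[OF hol(1,2) r(1) hol(3) r(2)] by (rule contour_integral_unique)
  have hol': "f holomorphic_on cnj ` A - {cnj \<rho>}"
  proof -
    have "(cnj \<circ> f \<circ> cnj) holomorphic_on cnj ` (A - {\<rho>})"
      using hol by (intro holomorphic_on_compose_cnj_cnj open_cnj_image) (auto simp: image_image intro!: open_delete)
    moreover have "cnj \<circ> f \<circ> cnj = f" by (auto simp: sym)
    moreover have "cnj ` (A - {\<rho>}) = cnj ` A - {cnj \<rho>}" by auto
    ultimately show ?thesis by simp
  qed
  have op: "open (cnj ` A)" using hol(1) by (rule open_cnj_image)
  have cb: "cball (cnj \<rho>) r \<subseteq> cnj ` A"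
  proof
    fix z assume "z \<in> cball (cnj \<rho>) r"
    hence "cnj z \<in> cball \<rho> r" by (simp add: dist_norm) (metis complex_cnj_cnj complex_cnj_diff complex_mod_cnj)
    with r(2) have "cnj z \<in> A" by blast
    thus "z \<in> cnj ` A" by (metis complex_cnj_cnj imageI)
  qed
  have 2: "contour_integral (circlepath (cnj \<rho>) r) f = 2 * pi * \<i> * residue f (cnj \<rho>)"
    using base_residue[OF op _ r(1) hol' cb] hol(2) by (intro contour_integral_unique) auto
  have "contour_integral (cnj \<circ> circlepath \<rho> r) f = cnj (contour_integral (circlepath \<rho> r) (cnj \<circ> f \<circ> cnj))"
    by (rule contour_integral_cnj) simp
  also have "cnj \<circ> f \<circ> cnj = f" by (auto simp: sym)
  finally have "- (2 * pi * \<i> * residue f (cnj \<rho>)) = cnj (2 * pi * \<i> * residue f \<rho>)"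
    by (simp add: circ contour_integral_reversepath 1 2)
  thus ?thesis by simp
qed

lemma higher_deriv_exp_mult: "(deriv ^^ k) (\<lambda>z. exp (z * c)) = (\<lambda>z. c ^ k * exp (z * c :: complex))"
proof (induction k)
  case (Suc k)
  have "deriv (\<lambda>z. c ^ k * exp (z * c)) z = c ^ Suc k * exp (z * c)" for z
    by (rule DERIV_imp_deriv) (auto intro!: derivative_eq_intros)
  with Suc show ?case by auto
qed auto

lemma holomorphic_pochhammer: "(\<lambda>z. pochhammer (c - z) k) holomorphic_on A"
  unfolding pochhammer_prod by (intro holomorphic_intros)

text \<open>
  The meromorphic continuation of \<open>B(-z, n)\<close>: a rational function with simple poles at \<open>0, ..., n - 1\<close>. In the
  left half plane, where the zeros lie, it agrees with the Beta function.
\<close>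
definition rice_kernel :: "nat \<Rightarrow> complex \<Rightarrow> complex" where
  "rice_kernel n z = fact (n - 1) / pochhammer (- z) n"

lemma Beta_eq_rice_kernel:
  assumes "Re z < 0" "n \<ge> 1"
  shows "Beta (- z) (of_nat n) = rice_kernel n z"
proof -
  have "- z \<notin> \<int>\<^sub>\<le>\<^sub>0" using assms by (intro Re_pos_not_nonpos_Int) auto
  moreover have "Gamma (of_nat n) = (fact (n - 1) :: complex)"
    using Gamma_fact[of "n - 1", where ?'a = complex] assms by (simp add: of_nat_diff)
  ultimately show ?thesis
    by (simp add: rice_kernel_def Beta_def pochhammer_Gamma Gamma_eq_zero_iff)
qed

lemma pochhammer_neg_eq_prod: "pochhammer (- z) n = (\<Prod>i<n. (of_nat i - z :: complex))"
  by (simp add: pochhammer_prod atLeast0LessThan)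

text \<open>
  The logarithmic derivative of the Pochhammer symbol produces the harmonic number in the main term.
\<close>
lemma DERIV_pochhammer_at_1:
  "((\<lambda>z. pochhammer (1 - z) k) has_field_derivative (- (fact k * harm k) :: complex)) (at 0)"
proof (induction k)
  case (Suc k)
  have "((\<lambda>z. pochhammer (1 - z) k * (1 - z + of_nat k)) has_field_derivative
          (- (fact k * harm k) * (1 - 0 + of_nat k) + (0 - 1 + 0) * pochhammer (1 - 0) k :: complex)) (at 0)"
    by (rule DERIV_mult[OF Suc.IH]) (auto intro!: derivative_eq_intros)
  moreover have "(- (fact k * harm k) * (1 - 0 + of_nat k) + (0 - 1 + 0) * pochhammer (1 - 0) k :: complex)
        = - (fact (Suc k) * harm (Suc k))"
  proof -
    have "of_nat (Suc k) * inverse (of_nat (Suc k)) = (1::complex)" by (simp del: of_nat_Suc)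
    thus ?thesis by (simp add: harm_Suc pochhammer_fact[symmetric] algebra_simps del: of_nat_Suc)
         (simp add: algebra_simps)
  qed
  ultimately show ?case by (simp add: pochhammer_Suc)
qed (simp add: harm_def)

context
  fixes \<beta> :: real
  assumes beta_pos: "\<beta> > 0"
begin

lemma phi_reciprocal_laurent:
  "(\<lambda>x. 1 / phi \<beta> (\<rho> + x)) has_laurent_expansion laurent_expansion (\<lambda>z. 1 / phi \<beta> z) \<rho>"
  using nicely_meromorphic_inverse_phi[of \<beta> "{\<rho>}"]
  by (intro not_essential_has_laurent_expansion) (auto simp: nicely_meromorphic_on_def meromorphic_at_iff)

lemma phi_reciprocal_pole_order:
  assumes "isolated_zero (phi \<beta>) \<rho>" "n < - int (zero_mult \<beta> \<rho>)"
  shows "fls_nth (laurent_expansion (\<lambda>z. 1 / phi \<beta> z) \<rho>) n = 0"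
proof -
  let ?L = "laurent_expansion (\<lambda>z. 1 / phi \<beta> z) \<rho>"
  have mero: "phi \<beta> meromorphic_on {\<rho>}"
    using nicely_meromorphic_phi[of \<beta> "{\<rho>}"] by (simp add: nicely_meromorphic_on_def)
  then obtain P where P: "(\<lambda>x. phi \<beta> (\<rho> + x)) has_laurent_expansion P"
    by (auto simp: meromorphic_on_def)
  have "zorder (phi \<beta>) \<rho> > 0"
    using zorder_isolated_zero_pos'[OF assms(1)] mero by (simp add: meromorphic_at_iff)
  moreover have "P \<noteq> 0"
    using phi_eventually_nonzero[OF beta_pos, of \<rho>] has_laurent_expansion_eventually_nonzero_iff[OF P] by simp
  ultimately have sub: "fls_subdegree P = int (zero_mult \<beta> \<rho>)"
    using has_laurent_expansion_zorder[OF P] by (simp add: zero_mult_def)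
  have "(\<lambda>x. 1 / phi \<beta> (\<rho> + x)) has_laurent_expansion inverse P"
    using has_laurent_expansion_inverse[OF P] by (simp add: inverse_eq_divide)
  hence "?L = inverse P" using phi_reciprocal_laurent has_laurent_expansion_unique by blast
  hence "fls_subdegree ?L = - int (zero_mult \<beta> \<rho>)" using sub by (simp add: fls_inverse_subdegree)
  thus ?thesis using assms(2) by simp
qed

text \<open>
  Subtracting the constant \<open>\<eta>\<close> from \<open>1 / \<phi>\<close> leaves the principal part unchanged.
\<close>
lemma u_term_eq_residue:
  assumes "isolated_zero (phi \<beta>) \<rho>"
  shows "u_term \<beta> \<rho> x = residue (\<lambda>z. exp (z * of_real x) * F \<beta> z) \<rho>"
proof -
  let ?L = "laurent_expansion (\<lambda>z. 1 / phi \<beta> z) \<rho>"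
  let ?G = "?L - fls_const (of_real (eta \<beta>))"
  have L: "(\<lambda>x. F \<beta> (\<rho> + x)) has_laurent_expansion ?G"
    unfolding F_def by (intro has_laurent_expansion_diff phi_reciprocal_laurent has_laurent_expansion_const)
  have "residue (\<lambda>z. exp (z * of_real x) * F \<beta> z) \<rho> =
     (\<Sum>l = 1..zero_mult \<beta> \<rho>. fls_nth ?G (- int l) / fact (l - 1) *
        (deriv ^^ (l - 1)) (\<lambda>z. exp (z * of_real x)) \<rho>)"
    using phi_reciprocal_pole_order[OF assms]
    by (intro residue_analytic_mult_laurent L analytic_intros) auto
  also have "\<dots> = u_term \<beta> \<rho> x"
    unfolding u_term_def sum_distrib_left pp_coeff_def higher_deriv_exp_mult
    by (intro sum.cong refl) auto
  finally show ?thesis ..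
qed

lemma B_term_eq_residue:
  assumes "isolated_zero (phi \<beta>) \<rho>" "Re \<rho> < 0" "n \<ge> 1"
  shows "B_term \<beta> \<rho> n = residue (\<lambda>z. Beta (- z) (of_nat n) * (1 / phi \<beta> z)) \<rho>"
proof -
  have "(\<lambda>z. Beta (- z) (of_nat n)) analytic_on {\<rho>}"
    using assms by (intro analytic_intros Re_pos_not_nonpos_Int) auto
  from residue_analytic_mult_laurent[OF this phi_reciprocal_laurent phi_reciprocal_pole_order[OF assms(1)]]
  show ?thesis by (simp add: B_term_def pp_coeff_def)
qed

text \<open>
  For \<open>\<rho>\<close> in the left half plane the neighbourhood is kept there, so that \<open>B(-z, n)\<close> is holomorphic on it.
\<close>
lemma phi_reciprocal_punctured:
  obtains A where "open A" "\<rho> \<in> A" "(\<lambda>z. 1 / phi \<beta> z) holomorphic_on A - {\<rho>}" "Re \<rho> < 0 \<longrightarrow> A \<subseteq> {z. Re z < 0}"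
proof -
  have "isolated_singularity_at (\<lambda>z. 1 / phi \<beta> z) \<rho>"
    using nicely_meromorphic_inverse_phi[of \<beta> "{\<rho>}"] by (auto simp: nicely_meromorphic_on_def meromorphic_at_iff)
  then obtain r where r: "r > 0" "(\<lambda>z. 1 / phi \<beta> z) analytic_on ball \<rho> r - {\<rho>}"
    by (auto simp: isolated_singularity_at_def)
  define H where "H = (if Re \<rho> < 0 then {z. Re z < 0} else UNIV)"
  show ?thesis
  proof (rule that[of "ball \<rho> r \<inter> H"])
    show "open (ball \<rho> r \<inter> H)" by (auto simp: H_def open_halfspace_Re_lt)
    show "(\<lambda>z. 1 / phi \<beta> z) holomorphic_on ball \<rho> r \<inter> H - {\<rho>}"
      by (rule holomorphic_on_subset[OF analytic_imp_holomorphic[OF r(2)]]) auto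
  qed (use r(1) in \<open>auto simp: H_def\<close>)
qed

lemma u_term_cnj:
  assumes "isolated_zero (phi \<beta>) \<rho>"
  shows "u_term \<beta> (cnj \<rho>) x = cnj (u_term \<beta> \<rho> x)"
proof -
  obtain A where A: "open A" "\<rho> \<in> A" "(\<lambda>z. 1 / phi \<beta> z) holomorphic_on A - {\<rho>}"
    by (rule phi_reciprocal_punctured[of \<rho>])
  have "residue (\<lambda>z. exp (z * of_real x) * F \<beta> z) (cnj \<rho>) = cnj (residue (\<lambda>z. exp (z * of_real x) * F \<beta> z) \<rho>)"
  proof (rule residue_cnj[OF _ A(1,2)])
    show "(\<lambda>z. exp (z * of_real x) * F \<beta> z) holomorphic_on A - {\<rho>}"
      unfolding F_def by (intro holomorphic_intros A(3))
  qed (simp add: F_def phi_cnj exp_cnj)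
  thus ?thesis using assms by (simp add: u_term_eq_residue isolated_zero_phi_cnj)
qed

lemma B_term_cnj:
  assumes "isolated_zero (phi \<beta>) \<rho>" "Re \<rho> < 0" "n \<ge> 1"
  shows "B_term \<beta> (cnj \<rho>) n = cnj (B_term \<beta> \<rho> n)"
proof -
  obtain A where A: "open A" "\<rho> \<in> A" "(\<lambda>z. 1 / phi \<beta> z) holomorphic_on A - {\<rho>}" "Re \<rho> < 0 \<longrightarrow> A \<subseteq> {z. Re z < 0}"
    by (rule phi_reciprocal_punctured[of \<rho>])
  have "residue (\<lambda>z. Beta (- z) (of_nat n) * (1 / phi \<beta> z)) (cnj \<rho>)
      = cnj (residue (\<lambda>z. Beta (- z) (of_nat n) * (1 / phi \<beta> z)) \<rho>)"
  proof (rule residue_cnj[OF _ A(1,2)])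
    show "(\<lambda>z. Beta (- z) (of_nat n) * (1 / phi \<beta> z)) holomorphic_on A - {\<rho>}"
      using assms A(4) by (intro holomorphic_intros A(3) Re_pos_not_nonpos_Int) auto
    show "Beta (- cnj z) (of_nat n) * (1 / phi \<beta> (cnj z)) = cnj (Beta (- z) (of_nat n) * (1 / phi \<beta> z))" for z
      using cnj_Gamma[of "- z"] cnj_Gamma[of "of_nat n"] cnj_Gamma[of "- z + of_nat n"]
      by (simp add: Beta_def phi_cnj)
  qed
  thus ?thesis using assms by (simp add: B_term_eq_residue isolated_zero_phi_cnj)
qed

text \<open>
  The simple zero at the origin is split off. Knowing \<open>\<psi> 0 = \<phi>' 0\<close> and \<open>\<psi>' 0 = \<phi>'' 0 / 2\<close>, both residues
  at the origin become first-order computations with \<open>\<psi>\<close>.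
\<close>
lemma phi_factor_at_0:
  "\<exists>A \<psi>. open A \<and> 0 \<in> A \<and> \<psi> holomorphic_on A \<and> (\<forall>z\<in>A. \<psi> z \<noteq> 0) \<and>
     (\<forall>z\<in>A. phi \<beta> z = z * \<psi> z) \<and> \<psi> 0 = mu \<beta> \<and> deriv \<psi> 0 = (deriv ^^ 2) (phi \<beta>) 0 / 2"
proof -
  let ?S = "{z. Re z > - 2 - \<beta>}"
  have S: "open ?S" "0 \<in> ?S" using beta_pos by (auto simp: open_halfspace_Re_gt)
  have "phi \<beta> analytic_on ?S"
    using phi_analytic_Re[OF beta_pos] by (subst analytic_on_analytic_at) auto
  hence hol: "phi \<beta> holomorphic_on ?S" by (rule analytic_imp_holomorphic)
  \<comment> \<open>the difference quotient, with its removable singularity filled in\<close>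
  define \<psi> where "\<psi> = (\<lambda>z. if z = 0 then deriv (phi \<beta>) 0 else (phi \<beta> z - phi \<beta> 0) / (z - 0))"
  have psi_hol: "\<psi> holomorphic_on ?S" unfolding \<psi>_def by (rule pole_lemma_open[OF hol S(1)])
  have psi_0: "\<psi> 0 = mu \<beta>" by (simp add: \<psi>_def mu_def)
  have eq: "phi \<beta> z = z * \<psi> z" for z using phi_0[OF beta_pos] by (simp add: \<psi>_def)
  obtain m where "m > 0" "mu \<beta> = of_real m" using mu_eq[OF beta_pos] by blast
  hence "\<psi> 0 \<noteq> 0" using psi_0 by simp
  have "continuous_on ?S \<psi>" using psi_hol by (rule holomorphic_on_imp_continuous_on)
  then obtain A where A: "open A" "0 \<in> A" "A \<subseteq> ?S" "\<And>z. z \<in> A \<Longrightarrow> \<psi> z \<noteq> 0"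
  proof -
    assume c: "continuous_on ?S \<psi>"
    have "open (?S \<inter> \<psi> -` (-{0}))" using S by (intro continuous_open_preimage c) auto
    thus ?thesis using that[of "?S \<inter> \<psi> -` (-{0})"] \<open>\<psi> 0 \<noteq> 0\<close> S by auto
  qed
  have "deriv \<psi> 0 = (deriv ^^ 2) (phi \<beta>) 0 / 2"
  proof -
    have psi': "(\<psi> has_field_derivative deriv \<psi> z) (at z)" if "z \<in> ?S" for z
      using psi_hol S(1) that by (rule holomorphic_derivI)
    have d1: "deriv (phi \<beta>) z = \<psi> z + z * deriv \<psi> z" if "z \<in> ?S" for z
    proof (rule DERIV_imp_deriv)
      have "((\<lambda>z. z * \<psi> z) has_field_derivative (1 * \<psi> z + deriv \<psi> z * z)) (at z)"
        by (intro DERIV_mult DERIV_ident psi' that)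
      moreover have "phi \<beta> = (\<lambda>z. z * \<psi> z)" using eq by auto
      ultimately show "(phi \<beta> has_field_derivative \<psi> z + z * deriv \<psi> z) (at z)" by (simp add: mult.commute)
    qed
    have "deriv \<psi> holomorphic_on ?S" using psi_hol S(1) by (rule holomorphic_deriv)
    hence psi'': "(deriv \<psi> has_field_derivative deriv (deriv \<psi>) 0) (at 0)"
      using S by (rule holomorphic_derivI)
    have "((\<lambda>z. \<psi> z + z * deriv \<psi> z) has_field_derivative
             (deriv \<psi> 0 + (1 * deriv \<psi> 0 + deriv (deriv \<psi>) 0 * 0))) (at 0)"
      by (intro DERIV_add DERIV_mult DERIV_ident psi'' psi' S)
    moreover have "eventually (\<lambda>z. deriv (phi \<beta>) z = \<psi> z + z * deriv \<psi> z) (nhds 0)"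
      using eventually_nhds_in_open[OF S] by eventually_elim (use d1 in auto)
    ultimately have "(deriv (phi \<beta>) has_field_derivative (deriv \<psi> 0 + (1 * deriv \<psi> 0 + deriv (deriv \<psi>) 0 * 0))) (at 0)"
      by (subst DERIV_cong_ev[OF refl _ refl])
    hence "deriv (deriv (phi \<beta>)) 0 = 2 * deriv \<psi> 0" by (auto dest: DERIV_imp_deriv)
    thus ?thesis by (simp add: numeral_2_eq_2)
  qed
  thus ?thesis using A psi_0 eq holomorphic_on_subset[OF psi_hol A(3)]
    by (intro exI[of _ A] exI[of _ \<psi>]) simp
qed

lemma residue_F_at_0: "residue (\<lambda>z. exp (z * of_real x) * F \<beta> z) 0 = 1 / mu \<beta>"
proof -
  obtain A \<psi> where A: "open A" "0 \<in> A" "\<psi> holomorphic_on A" "\<And>z. z \<in> A \<Longrightarrow> \<psi> z \<noteq> 0"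
    "\<And>z. z \<in> A \<Longrightarrow> phi \<beta> z = z * \<psi> z" "\<psi> 0 = mu \<beta>" "deriv \<psi> 0 = (deriv ^^ 2) (phi \<beta>) 0 / 2"
    using phi_factor_at_0 by blast
  let ?g = "\<lambda>z. exp (z * of_real x) * (1 / \<psi> z - z * of_real (eta \<beta>))"
  have "eventually (\<lambda>z. z \<in> A - {0}) (at 0)" using A by (intro eventually_at_in_open) auto
  hence "eventually (\<lambda>z. exp (z * of_real x) * F \<beta> z = ?g z / (z - 0)) (at 0)"
    by eventually_elim (use A in \<open>auto simp: F_def field_simps\<close>)
  hence "residue (\<lambda>z. exp (z * of_real x) * F \<beta> z) 0 = residue (\<lambda>z. ?g z / (z - 0)) 0"
    by (rule residue_cong) auto
  also have "\<dots> = ?g 0"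
    using A by (intro residue_simple[of A] holomorphic_intros) auto
  finally show ?thesis using A(6) by simp
qed

text \<open>
  The kernel and \<open>1 / \<phi>\<close> both have a simple pole at the origin, so the residue is the derivative at \<open>0\<close> of the
  regular part \<open>- (n-1)! / (pochhammer (1 - z) (n-1) * \<psi> z)\<close>; the Pochhammer symbol contributes the harmonic number and
  \<open>\<psi>\<close> the second derivative of \<open>\<phi>\<close>.
\<close>
lemma rice_residue_at_0:
  assumes "n \<ge> 1"
  shows "residue (\<lambda>z. rice_kernel n z * (1 / phi \<beta> z)) 0 =
           - (harm (n - 1) / mu \<beta> - (deriv ^^ 2) (phi \<beta>) 0 / (2 * (mu \<beta>)\<^sup>2))"
proof -
  obtain A \<psi> where A: "open A" "0 \<in> A" "\<psi> holomorphic_on A" "\<And>z. z \<in> A \<Longrightarrow> \<psi> z \<noteq> 0"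
    "\<And>z. z \<in> A \<Longrightarrow> phi \<beta> z = z * \<psi> z" "\<psi> 0 = mu \<beta>" "deriv \<psi> 0 = (deriv ^^ 2) (phi \<beta>) 0 / 2"
    using phi_factor_at_0 by blast
  define A' where "A' = A \<inter> ball 0 1"
  have A': "open A'" "0 \<in> A'" using A by (auto simp: A'_def)
  have poch: "pochhammer (1 - z) (n - 1) \<noteq> 0" if "z \<in> A'" for z
  proof
    assume "pochhammer (1 - z) (n - 1) = 0"
    then obtain k where "1 - z = - of_nat k" by (auto simp: pochhammer_eq_0_iff)
    hence "z = of_nat (k + 1)" by (simp add: algebra_simps)
    hence "cmod z = real (k + 1)" by (metis norm_of_nat)
    thus False using that by (auto simp: A'_def)
  qed
  let ?q = "\<lambda>z. - (fact (n - 1) / (pochhammer (1 - z) (n - 1) * \<psi> z))"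
  have "eventually (\<lambda>z. z \<in> A' - {0}) (at 0)" using A' by (intro eventually_at_in_open) auto
  hence *: "eventually (\<lambda>z. rice_kernel n z * (1 / phi \<beta> z) = ?q z / z ^ Suc 1) (at 0)"
  proof eventually_elim
    case (elim z)
    obtain k where k: "n = Suc k" using assms by (cases n) auto
    show ?case using elim A(5)[of z]
      by (simp add: rice_kernel_def k pochhammer_rec A'_def power2_eq_square)
  qed
  have first_deriv: "(deriv ^^ 1) h 0 / fact 1 = deriv h 0" for h :: "complex \<Rightarrow> complex" by simp
  from * have "residue (\<lambda>z. rice_kernel n z * (1 / phi \<beta> z)) 0 = residue (\<lambda>z. ?q z / z ^ Suc 1) 0"
    by (rule residue_cong) auto
  also have "\<dots> = (deriv ^^ 1) ?q 0 / fact 1"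
  proof (rule residue_holomorphic_over_power'[OF A'])
    have "\<psi> holomorphic_on A'" using A(3) by (rule holomorphic_on_subset) (simp add: A'_def)
    moreover have "pochhammer (1 - z) (n - 1) * \<psi> z \<noteq> 0" if "z \<in> A'" for z
      using poch[OF that] A(4)[of z] that by (simp add: A'_def)
    ultimately show "?q holomorphic_on A'"
      by (intro holomorphic_intros holomorphic_pochhammer)
  qed
  also have "\<dots> = deriv ?q 0" by (rule first_deriv)
  also have "\<dots> = - (harm (n - 1) / mu \<beta> - (deriv ^^ 2) (phi \<beta>) 0 / (2 * (mu \<beta>)\<^sup>2))"
  proof (rule DERIV_imp_deriv)
    obtain m where m: "m > 0" "mu \<beta> = of_real m" using mu_eq[OF beta_pos] by blast
    have d: "(\<psi> has_field_derivative deriv \<psi> 0) (at 0)" using A(3,1,2) by (rule holomorphic_derivI)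
    let ?f = "fact (n - 1) :: complex"
    have "(?q has_field_derivative - ((0 * (pochhammer (1 - 0) (n - 1) * \<psi> 0) - ?f * 
        (- (?f * harm (n - 1)) * \<psi> 0 + deriv \<psi> 0 * pochhammer (1 - 0) (n - 1))) / 
         ((pochhammer (1 - 0) (n - 1) * \<psi> 0) * (pochhammer (1 - 0) (n - 1) * \<psi> 0)))) (at 0)"
      using poch[OF A'(2)] A(4)[OF A(2)]
      by (intro DERIV_minus DERIV_divide DERIV_mult DERIV_pochhammer_at_1 d DERIV_const) auto
    moreover have "pochhammer (1 - 0) (n - 1) = ?f" by (simp add: pochhammer_fact)
    moreover have "- ((0 * (?f * \<psi> 0) - ?f * (- (?f * harm (n - 1)) * \<psi> 0 + deriv \<psi> 0 * ?f)) / 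
         ((?f * \<psi> 0) * (?f * \<psi> 0))) = - (harm (n - 1) / mu \<beta> - (deriv ^^ 2) (phi \<beta>) 0 / (2 * (mu \<beta>)\<^sup>2))"
      using m A(6,7) by (simp add: field_simps power2_eq_square)
    ultimately show "(?q has_field_derivative - (harm (n - 1) / mu \<beta> - (deriv ^^ 2) (phi \<beta>) 0 / (2 * (mu \<beta>)\<^sup>2))) (at 0)"
      by simp
  qed
  finally show ?thesis .
qed

lemma rice_residue_at_nat:
  assumes "1 \<le> j" "j \<le> k"
  shows "residue (\<lambda>z. rice_kernel (Suc k) z * (1 / phi \<beta> z)) (of_nat j) = (-1) ^ (j + 1) * of_nat (k choose j) / phi \<beta> (of_nat j)"
proof -
  let ?c = "of_nat j :: complex"
  let ?g = "\<lambda>z. - (fact k / (\<Prod>i\<in>{..<Suc k}-{j}. (of_nat i - z))) * (1 / phi \<beta> z)"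
  have pos: "Re z > 0" if "z \<in> ball ?c 1" for z
  proof -
    have "\<bar>Re (?c - z)\<bar> < 1" using that abs_Re_le_cmod[of "?c - z"] by (simp add: dist_norm)
    thus ?thesis using assms by auto
  qed
  have nz: "of_nat i - z \<noteq> 0" if "z \<in> ball ?c 1" "i \<noteq> j" for i z
  proof
    assume "of_nat i - z = 0"
    hence "cmod (of_nat j - of_nat i) < 1" using that by (simp add: dist_norm)
    moreover have "cmod (of_nat j - of_nat i) = \<bar>real j - real i\<bar>"
      by (metis norm_of_real of_real_diff of_real_of_nat_eq)
    ultimately show False using that by linarith
  qed
  have nphi: "phi \<beta> z \<noteq> 0" if "z \<in> ball ?c 1" for z
    using Re_phi_pos[OF beta_pos, of z] pos[OF that] by force
  have aphi: "phi \<beta> holomorphic_on ball ?c 1"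
    using phi_analytic_Re[OF beta_pos] pos beta_pos
    by (intro analytic_imp_holomorphic, subst analytic_on_analytic_at) force
  have "eventually (\<lambda>z. rice_kernel (Suc k) z * (1 / phi \<beta> z) = ?g z / (z - ?c)) (at ?c)"
  proof -
    have "eventually (\<lambda>z. z \<in> ball ?c 1 - {?c}) (at ?c)" by (intro eventually_at_in_open) auto
    thus ?thesis
    proof eventually_elim
      case (elim z)
      have "pochhammer (- z) (Suc k) = (of_nat j - z) * (\<Prod>i\<in>{..<Suc k}-{j}. (of_nat i - z))"
        unfolding pochhammer_neg_eq_prod by (rule prod.remove) (use assms in auto)
      hence "pochhammer (- z) (Suc k) = - ((z - ?c) * (\<Prod>i\<in>{..<Suc k}-{j}. (of_nat i - z)))"
        by (simp only: minus_mult_left minus_diff_eq)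
      thus ?case by (simp only: rice_kernel_def divide_inverse inverse_minus_eq inverse_mult_distrib diff_Suc_1)
         (simp add: mult_ac)
    qed
  qed
  hence "residue (\<lambda>z. rice_kernel (Suc k) z * (1 / phi \<beta> z)) ?c = residue (\<lambda>z. ?g z / (z - ?c)) ?c"
    by (rule residue_cong) auto
  also have "\<dots> = ?g ?c"
  proof (rule residue_simple)
    have "(\<Prod>i\<in>{..<Suc k}-{j}. (of_nat i - z)) \<noteq> 0" if "z \<in> ball ?c 1" for z
      using nz[OF that] by (simp add: prod_zero_iff)
    thus "?g holomorphic_on ball ?c 1"
      by (intro holomorphic_intros aphi nphi)
  qed auto
  also have "(\<Prod>i\<in>{..<Suc k}-{j}. (of_nat i - ?c)) = (-1) ^ j * fact j * fact (k - j)"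
  proof -
    have split: "{..<Suc k}-{j} = {..<j} \<union> {j<..k}" using assms by auto
    have "(\<Prod>i\<in>{..<Suc k}-{j}. (of_nat i - ?c)) = (\<Prod>i<j. (of_nat i - ?c)) * (\<Prod>i\<in>{j<..k}. (of_nat i - ?c))"
      unfolding split by (rule prod.union_disjoint) auto
    also have "(\<Prod>i<j. (of_nat i - ?c)) = (\<Prod>i<j. - of_nat (j - i))"
      by (intro prod.cong) (auto simp: of_nat_diff)
    also have "\<dots> = (-1) ^ j * (\<Prod>i<j. of_nat (j - i))" by (simp only: prod_uminus card_lessThan)
    also have "(\<Prod>i<j. of_nat (j - i)) = (\<Prod>i\<in>{1..j}. (of_nat i :: complex))"
      by (rule prod.reindex_bij_witness[of _ "\<lambda>i. j - i" "\<lambda>i. j - i"]) auto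
    also have "\<dots> = fact j" by (simp add: fact_prod)
    also have "(\<Prod>i\<in>{j<..k}. (of_nat i - ?c)) = (\<Prod>i\<in>{1..k-j}. (of_nat i :: complex))"
      by (rule prod.reindex_bij_witness[of _ "\<lambda>i. i + j" "\<lambda>i. i - j"]) (auto simp: of_nat_diff)
    also have "\<dots> = fact (k - j)" by (simp add: fact_prod)
    finally show ?thesis .
  qed
  also have "- (fact k / ((-1) ^ j * fact j * fact (k - j))) * (1 / phi \<beta> ?c)
      = (-1) ^ (j + 1) * of_nat (k choose j) / phi \<beta> ?c"
  proof -
    have "(-1) ^ j * (-1) ^ j = (1 :: complex)" by (simp flip: power_add mult_2)
    hence "inverse ((-1) ^ j) = ((-1) ^ j :: complex)" by (rule inverse_unique)
    moreover have "of_nat (k choose j) = (fact k / (fact j * fact (k - j)) :: complex)"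
      using assms by (intro binomial_fact)
    ultimately show ?thesis by (simp only: divide_inverse inverse_mult_distrib) (simp add: mult_ac)
  qed
  finally show ?thesis .
qed

end

section \<open>The alternating sum for the mean height and its asymptotics\<close>

lemma cmod_diff_of_nat_ge_Im: "cmod (of_nat i - z) \<ge> \<bar>Im z\<bar>"
  using abs_Im_le_cmod[of "of_nat i - z"] by simp

lemma holomorphic_rice_kernel:
  assumes "\<And>i. i < n \<Longrightarrow> of_nat i \<notin> A"
  shows "rice_kernel n holomorphic_on A"
proof -
  have "pochhammer (0 - z) n \<noteq> 0" if "z \<in> A" for z
    using assms that by (auto simp: pochhammer_eq_0_iff)
  hence "(\<lambda>z. fact (n - 1) / pochhammer (0 - z) n) holomorphic_on A"
    by (intro holomorphic_intros holomorphic_pochhammer)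
  thus ?thesis by (simp add: rice_kernel_def [abs_def])
qed

lemma cmod_rice_kernel_eq: "cmod (rice_kernel n z) = fact (n - 1) / (\<Prod>i<n. cmod (of_nat i - z))"
  by (simp add: rice_kernel_def norm_divide pochhammer_neg_eq_prod prod_norm [symmetric])

lemma cmod_rice_kernel_le_Im:
  assumes "n \<ge> 2" "\<bar>Im z\<bar> \<ge> 1"
  shows "cmod (rice_kernel n z) \<le> fact (n - 1) * \<bar>Im z\<bar> powr (-1-1)"
proof -
  have "\<bar>Im z\<bar> ^ 2 \<le> \<bar>Im z\<bar> ^ n" using assms by (intro power_increasing)
  also have "\<dots> = (\<Prod>i<n. \<bar>Im z\<bar>)" by simp
  also have "\<dots> \<le> (\<Prod>i<n. cmod (of_nat i - z))"
    by (intro prod_mono conjI cmod_diff_of_nat_ge_Im) auto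
  finally have "fact (n - 1) / (\<Prod>i<n. cmod (of_nat i - z)) \<le> fact (n - 1) / \<bar>Im z\<bar> ^ 2"
    using assms by (intro divide_left_mono mult_pos_pos prod_pos) (auto intro!: less_le_trans[OF _ cmod_diff_of_nat_ge_Im])
  also have "\<dots> = fact (n - 1) * \<bar>Im z\<bar> powr (-1-1)"
    using assms by (simp add: powr_minus_divide powr_numeral)
  finally show ?thesis by (simp add: cmod_rice_kernel_eq)
qed

text \<open>
  The first bound is an integrable majorant common to all lines \<open>Re z = b\<close> with \<open>b \<ge> k + 1\<close>; the second makes
  the integrand vanish pointwise as \<open>b\<close> grows.
\<close>
lemma cmod_rice_kernel_le_right:
  assumes "k \<ge> 1" "Re z \<ge> real k + 1"
  shows "cmod (rice_kernel (Suc k) z) \<le> fact k / (1 + (Im z)\<^sup>2)" "cmod (rice_kernel (Suc k) z) \<le> fact k / Re z"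
proof -
  have f: "cmod (of_nat i - z) \<ge> sqrt (1 + (Im z)\<^sup>2)" if "i \<le> k" for i
  proof -
    have "1 \<le> (real i - Re z)\<^sup>2"
    proof -
      have "1 ^ 2 \<le> (Re z - real i) ^ 2" using assms that by (intro power_mono) auto
      thus ?thesis by (simp add: power2_commute)
    qed
    thus ?thesis by (simp add: cmod_def)
  qed
  hence f1: "cmod (of_nat i - z) \<ge> 1" if "i \<le> k" for i
    using that by (meson order_trans real_sqrt_ge_one le_add_same_cancel1 zero_le_power2)
  have "1 + (Im z)\<^sup>2 = sqrt (1 + (Im z)\<^sup>2) ^ 2" by simp
  also have "\<dots> \<le> sqrt (1 + (Im z)\<^sup>2) ^ Suc k" using assms by (intro power_increasing) auto
  also have "\<dots> = (\<Prod>i<Suc k. sqrt (1 + (Im z)\<^sup>2))" by simp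
  also have "\<dots> \<le> (\<Prod>i<Suc k. cmod (of_nat i - z))"
    by (intro prod_mono conjI f) auto
  finally have 1: "1 + (Im z)\<^sup>2 \<le> (\<Prod>i<Suc k. cmod (of_nat i - z))" .
  have "Re z * 1 \<le> cmod (of_nat 0 - z) * (\<Prod>i\<in>{..<Suc k}-{0}. cmod (of_nat i - z))"
    using complex_Re_le_cmod[of z] by (intro mult_mono prod_ge_1 f1) auto
  also have "\<dots> = (\<Prod>i<Suc k. cmod (of_nat i - z))" by (rule prod.remove[symmetric]) auto
  finally have 2: "Re z \<le> (\<Prod>i<Suc k. cmod (of_nat i - z))" by simp
  have 0: "(\<Prod>i<Suc k. cmod (of_nat i - z)) > 0"
    by (intro prod_pos less_le_trans[OF zero_less_one f1]) auto
  show "cmod (rice_kernel (Suc k) z) \<le> fact k / (1 + (Im z)\<^sup>2)" unfolding cmod_rice_kernel_eq diff_Suc_1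
    using 1 0 by (intro divide_left_mono mult_pos_pos) (auto intro: add_pos_nonneg)
  show "cmod (rice_kernel (Suc k) z) \<le> fact k / Re z" unfolding cmod_rice_kernel_eq diff_Suc_1
    using 2 0 assms by (intro divide_left_mono mult_pos_pos) auto
qed

text \<open>
  On \<open>Re z = -\<sigma>\<close> the factors \<open>i - z\<close> of the denominator with \<open>i \<ge> 2\<close> are replaced by \<open>i + \<sigma>\<close>, which nearly builds
  up \<open>pochhammer \<sigma> n\<close> and hence the order in \<open>n\<close>; the first two factors are kept to have integrability in \<open>t\<close>.
\<close>
lemma cmod_rice_kernel_le_left:
  assumes "n \<ge> 2" "\<sigma> > 0"
  shows "cmod (rice_kernel n (Complex (-\<sigma>) t)) \<le> fact (n - 1) / pochhammer \<sigma> n * (\<sigma> * (\<sigma> + 1) / (\<sigma>\<^sup>2 + t\<^sup>2))"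
proof -
  let ?z = "Complex (-\<sigma>) t"
  have f: "cmod (of_nat i - ?z) \<ge> sqrt (\<sigma>\<^sup>2 + t\<^sup>2)" "cmod (of_nat i - ?z) \<ge> real i + \<sigma>" for i
  proof -
    have "\<sigma>\<^sup>2 \<le> (real i + \<sigma>)\<^sup>2" using assms by (intro power_mono) auto
    thus "cmod (of_nat i - ?z) \<ge> sqrt (\<sigma>\<^sup>2 + t\<^sup>2)" by (simp add: cmod_def)
    show "cmod (of_nat i - ?z) \<ge> real i + \<sigma>" using complex_Re_le_cmod[of "of_nat i - ?z"] by simp
  qed
  have s: "\<sigma>\<^sup>2 + t\<^sup>2 > 0" using assms by (intro add_pos_nonneg) auto
  have split: "{..<n} = {..<2} \<union> {2..<n}" using assms by auto
  have prods: "(\<Prod>i<n. g i) = (\<Prod>i<2. g i) * (\<Prod>i\<in>{2..<n}. g i)" for g :: "nat \<Rightarrow> real"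
    unfolding split by (rule prod.union_disjoint) auto
  have "(\<sigma>\<^sup>2 + t\<^sup>2) * (\<Prod>i\<in>{2..<n}. \<sigma> + real i) = (\<Prod>i<(2::nat). sqrt (\<sigma>\<^sup>2 + t\<^sup>2)) * (\<Prod>i\<in>{2..<n}. \<sigma> + real i)"
    using s by (simp add: real_sqrt_mult_self)
  also have "\<dots> \<le> (\<Prod>i<2. cmod (of_nat i - ?z)) * (\<Prod>i\<in>{2..<n}. cmod (of_nat i - ?z))"
    using f assms s by (intro mult_mono prod_mono prod_nonneg conjI) (auto simp: add.commute)
  also have "\<dots> = (\<Prod>i<n. cmod (of_nat i - ?z))" by (rule prods[symmetric])
  finally have le: "(\<sigma>\<^sup>2 + t\<^sup>2) * (\<Prod>i\<in>{2..<n}. \<sigma> + real i) \<le> (\<Prod>i<n. cmod (of_nat i - ?z))" .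
  have p0: "(\<Prod>i\<in>{2..<n}. \<sigma> + real i) > 0" using assms by (intro prod_pos) auto
  have poch: "pochhammer \<sigma> n = \<sigma> * (\<sigma> + 1) * (\<Prod>i\<in>{2..<n}. \<sigma> + real i)"
    using prods[of "\<lambda>i. \<sigma> + real i"] by (simp add: pochhammer_prod atLeast0LessThan numeral_2_eq_2)
  have "cmod (rice_kernel n ?z) \<le> fact (n - 1) / ((\<sigma>\<^sup>2 + t\<^sup>2) * (\<Prod>i\<in>{2..<n}. \<sigma> + real i))"
    unfolding cmod_rice_kernel_eq
    using le s p0 by (intro divide_left_mono mult_pos_pos less_le_trans[OF _ le]) auto
  also have "\<dots> = fact (n - 1) / pochhammer \<sigma> n * (\<sigma> * (\<sigma> + 1) / (\<sigma>\<^sup>2 + t\<^sup>2))"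
    using assms s p0 unfolding poch by simp
  finally show ?thesis .
qed

context
  fixes \<beta> :: real
  assumes beta_pos: "\<beta> > 0"
begin

text \<open>
  The mean height of a uniform leaf of a tree with \<open>k + 1\<close> leaves (see \<open>leaf_height_integral\<close>), in the form of an
  alternating sum of Noerlund-Rice type.
\<close>
definition mean_height :: "nat \<Rightarrow> real" where
  "mean_height k = (\<Sum>j = 1..k. (-1) ^ (j + 1) * real (k choose j) / Re (phi \<beta> (of_nat j)))"

lemma phi_of_nat: "phi \<beta> (of_nat j) = of_real (Re (phi \<beta> (of_nat j)))"
proof -
  have "cnj (phi \<beta> (of_nat j)) = phi \<beta> (of_nat j)" by (simp flip: phi_cnj)
  thus ?thesis by (simp add: complex_eq_iff)
qed

lemma inverse_phi_bound_strip:
  "\<exists>C>0. \<exists>T\<ge>1. \<forall>z. \<bar>Re z\<bar> \<le> K \<longrightarrow> \<bar>Im z\<bar> \<ge> T \<longrightarrow> cmod (1 / phi \<beta> z) \<le> C"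
proof -
  obtain C T where T: "C > 0" "T \<ge> 1" "\<forall>z. \<bar>Re z\<bar> \<le> K \<longrightarrow> \<bar>Im z\<bar> \<ge> T \<longrightarrow>
      phi \<beta> z \<noteq> 0 \<and> cmod (F \<beta> z) \<le> C * \<bar>Im z\<bar> powr (-1-min \<beta> 1)"
    using F_decay_strip[OF beta_pos, of K] by blast
  have "cmod (1 / phi \<beta> z) \<le> C + \<bar>eta \<beta>\<bar>" if "\<bar>Re z\<bar> \<le> K" "\<bar>Im z\<bar> \<ge> T" for z
  proof -
    have "1 / phi \<beta> z = F \<beta> z + of_real (eta \<beta>)" by (simp add: F_def)
    hence "cmod (1 / phi \<beta> z) \<le> cmod (F \<beta> z) + \<bar>eta \<beta>\<bar>" by (metis norm_triangle_ineq norm_of_real)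
    also have "cmod (F \<beta> z) \<le> C * \<bar>Im z\<bar> powr (-1-min \<beta> 1)" using T that by auto
    also have "\<dots> \<le> C * \<bar>Im z\<bar> powr 0" using T that beta_pos by (intro mult_left_mono powr_mono) auto
    also have "\<dots> = C" using T that by auto
    finally show ?thesis by simp
  qed
  thus ?thesis using T by (intro exI[of _ "C + \<bar>eta \<beta>\<bar>"]) (auto intro!: exI[of _ T] add_pos_nonneg)
qed

lemma inverse_phi_holomorphic:
  assumes "\<And>z. z \<in> A \<Longrightarrow> \<not> isolated_zero (phi \<beta>) z"
  shows "(\<lambda>z. 1 / phi \<beta> z) holomorphic_on A"
  using assms inverse_phi_analytic_iff[OF beta_pos]
  by (intro analytic_imp_holomorphic, subst analytic_on_analytic_at) auto

lemma zeros_strip_eq: "zeros_strip \<beta> \<sigma> = {z. isolated_zero (phi \<beta>) z \<and> z \<noteq> 0 \<and> - \<sigma> < Re z}"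
  using zeros_Re_neg[OF beta_pos] by (auto simp: zeros_strip_def zeros_def)

text \<open>
  All residues of \<open>rice_kernel (k + 1) z / \<phi>(z)\<close> to the right of \<open>Re z = -\<sigma>\<close> are collected by moving the line to
  \<open>Re z = b\<close> and letting \<open>b\<close> tend to infinity. Those at \<open>1, ..., k\<close> add up to \<open>mean_height k\<close>, the one at \<open>0\<close> gives
  the main term with negative sign, and the others are \<open>B_term\<close>.
\<close>
lemma rice_integral:
  assumes \<sigma>: "\<sigma> > 0" and nz: "\<And>z. Re z = - \<sigma> \<Longrightarrow> \<not> isolated_zero (phi \<beta>) z" and k: "k \<ge> 1"
  shows "of_real (mean_height k) - (harm k / mu \<beta> - (deriv ^^ 2) (phi \<beta>) 0 / (2 * (mu \<beta>)\<^sup>2)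
           - (\<Sum>\<rho>\<in>zeros_strip \<beta> \<sigma>. B_term \<beta> \<rho> (Suc k))) =
         - (1 / (2 * of_real pi)) *
            (LINT t|lborel. rice_kernel (Suc k) (Complex (-\<sigma>) t) * (1 / phi \<beta> (Complex (-\<sigma>) t)))"
    (is "?E = _")
proof -
  define f where "f = (\<lambda>z. rice_kernel (Suc k) z * (1 / phi \<beta> z))"
  define P where "P = {z. isolated_zero (phi \<beta>) z \<and> \<bar>Re z\<bar> \<le> \<sigma> + 1} \<union> of_nat ` {0..k}"
  have finP: "finite P" unfolding P_def using finite_zeros_Re[OF beta_pos] by auto
  have hol: "f holomorphic_on {z. -\<sigma> - 1 < Re z \<and> Re z < b + 1} - P" for b
    unfolding f_def
  proof (intro holomorphic_on_mult holomorphic_rice_kernel inverse_phi_holomorphic)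
    fix z assume z: "z \<in> {z. -\<sigma> - 1 < Re z \<and> Re z < b + 1} - P"
    show "\<not> isolated_zero (phi \<beta>) z"
    proof
      assume iz: "isolated_zero (phi \<beta>) z"
      hence "z = 0 \<or> Re z < 0" using zeros_Re_neg[OF beta_pos] by blast
      hence "z \<in> P" using z iz \<sigma> by (auto simp: P_def)
      thus False using z by simp
    qed
  qed (auto simp: P_def)
  have sumP: "(\<Sum>p\<in>{p\<in>P. -\<sigma> < Re p \<and> Re p < b}. residue f p) = ?E" if b: "b > real k" for b
  proof -
    have set: "{p\<in>P. -\<sigma> < Re p \<and> Re p < b} = of_nat ` {1..k} \<union> ({0} \<union> zeros_strip \<beta> \<sigma>)"
    proof (intro equalityI subsetI)
      fix p assume p: "p \<in> {p\<in>P. -\<sigma> < Re p \<and> Re p < b}"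
      show "p \<in> of_nat ` {1..k} \<union> ({0} \<union> zeros_strip \<beta> \<sigma>)"
      proof (cases "isolated_zero (phi \<beta>) p")
        case True thus ?thesis using p by (auto simp: zeros_strip_eq)
      next
        case False
        then obtain j where "p = of_nat j" "j \<le> k" using p by (auto simp: P_def)
        thus ?thesis by (cases "j = 0") auto
      qed
    next
      fix p assume p: "p \<in> of_nat ` {1..k} \<union> ({0} \<union> zeros_strip \<beta> \<sigma>)"
      have "p = 0 \<Longrightarrow> p \<in> P" by (auto simp: P_def intro!: image_eqI[of _ _ 0])
      moreover have "p \<in> zeros_strip \<beta> \<sigma> \<Longrightarrow> p \<in> P \<and> Re p < 0" by (auto simp: zeros_strip_def zeros_def P_def)
      ultimately show "p \<in> {p\<in>P. -\<sigma> < Re p \<and> Re p < b}"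
        using p b \<sigma> by (auto simp: P_def zeros_strip_def)
    qed
    have "(\<Sum>p\<in>{p\<in>P. -\<sigma> < Re p \<and> Re p < b}. residue f p) =
            (\<Sum>p\<in>of_nat ` {1..k}. residue f p) + (residue f 0 + (\<Sum>p\<in>zeros_strip \<beta> \<sigma>. residue f p))"
    proof -
      have "(\<Sum>p\<in>of_nat ` {1..k} \<union> ({0} \<union> zeros_strip \<beta> \<sigma>). residue f p) =
        (\<Sum>p\<in>of_nat ` {1..k}. residue f p) + (\<Sum>p\<in>{0} \<union> zeros_strip \<beta> \<sigma>. residue f p)"
        using finite_zeros_strip[OF beta_pos] by (intro sum.union_disjoint) (auto simp: zeros_strip_def)
      moreover have "(\<Sum>p\<in>{0} \<union> zeros_strip \<beta> \<sigma>. residue f p) = residue f 0 + (\<Sum>p\<in>zeros_strip \<beta> \<sigma>. residue f p)"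
        using finite_zeros_strip[OF beta_pos] by (subst sum.union_disjoint) (auto simp: zeros_strip_def)
      ultimately show ?thesis unfolding set by simp
    qed
    also have "(\<Sum>p\<in>of_nat ` {1..k}. residue f p) = (\<Sum>j=1..k. residue f (of_nat j))"
      by (subst sum.reindex) (auto simp: inj_on_def)
    also have "\<dots> = of_real (mean_height k)"
      unfolding mean_height_def of_real_sum
    proof (intro sum.cong refl)
      fix j assume "j \<in> {1..k}"
      hence "residue f (of_nat j) = (-1) ^ (j + 1) * of_nat (k choose j) / phi \<beta> (of_nat j)"
        unfolding f_def by (intro rice_residue_at_nat[OF beta_pos]) auto
      also have "\<dots> = (-1) ^ (j + 1) * of_nat (k choose j) / of_real (Re (phi \<beta> (of_nat j)))"
        by (simp flip: phi_of_nat)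
      finally show "residue f (of_nat j) = of_real ((-1) ^ (j + 1) * real (k choose j) / Re (phi \<beta> (of_nat j)))"
        by simp
    qed
    also have "residue f 0 = - (harm k / mu \<beta> - (deriv ^^ 2) (phi \<beta>) 0 / (2 * (mu \<beta>)\<^sup>2))"
      unfolding f_def using rice_residue_at_0[OF beta_pos, of "Suc k"] by simp
    also have "(\<Sum>p\<in>zeros_strip \<beta> \<sigma>. residue f p) = (\<Sum>\<rho>\<in>zeros_strip \<beta> \<sigma>. B_term \<beta> \<rho> (Suc k))"
    proof (intro sum.cong refl)
      fix \<rho> assume \<rho>: "\<rho> \<in> zeros_strip \<beta> \<sigma>"
      hence neg: "Re \<rho> < 0" and iz: "isolated_zero (phi \<beta>) \<rho>" by (auto simp: zeros_strip_def zeros_def)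
      have "eventually (\<lambda>z. z \<in> {z. Re z < 0} - {\<rho>}) (at \<rho>)"
        using neg by (intro eventually_at_in_open open_halfspace_Re_lt) auto
      hence "eventually (\<lambda>z. f z = Beta (- z) (of_nat (Suc k)) * (1 / phi \<beta> z)) (at \<rho>)"
        by eventually_elim (subst Beta_eq_rice_kernel, auto simp: f_def)
      hence "residue f \<rho> = residue (\<lambda>z. Beta (- z) (of_nat (Suc k)) * (1 / phi \<beta> z)) \<rho>"
        by (rule residue_cong) auto
      thus "residue f \<rho> = B_term \<beta> \<rho> (Suc k)"
        using B_term_eq_residue[OF beta_pos iz neg, of "Suc k"] by simp
    qed
    finally show ?thesis by simp
  qed
  have shift: "integrable lborel (\<lambda>t. f (Complex b t))"
    "(LINT t|lborel. f (Complex b t)) - (LINT t|lborel. f (Complex (-\<sigma>) t)) = 2 * of_real pi * ?E"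
    if b: "b > real k" for b
  proof -
    obtain C T where CT: "C > 0" "T \<ge> 1" "\<forall>z. \<bar>Re z\<bar> \<le> max \<sigma> b \<longrightarrow> \<bar>Im z\<bar> \<ge> T \<longrightarrow> cmod (1 / phi \<beta> z) \<le> C"
      using inverse_phi_bound_strip[of "max \<sigma> b"] by blast
    have bound: "cmod (f z) \<le> (fact k * C) * \<bar>Im z\<bar> powr (-1-1)" if "-\<sigma> \<le> Re z" "Re z \<le> b" "\<bar>Im z\<bar> \<ge> T" for z
    proof -
      have "cmod (f z) = cmod (rice_kernel (Suc k) z) * cmod (1 / phi \<beta> z)" by (simp only: f_def norm_mult)
      also have "\<dots> \<le> (fact (Suc k - 1) * \<bar>Im z\<bar> powr (-1-1)) * C"
        using that CT k b by (intro mult_mono cmod_rice_kernel_le_Im) auto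
      finally show ?thesis by (simp add: mult_ac)
    qed
    have avoid: "Re p \<noteq> -\<sigma> \<and> Re p \<noteq> b" if "p \<in> P" for p
    proof
      show "Re p \<noteq> -\<sigma>" using that nz[of p] \<sigma> by (auto simp: P_def)
      show "Re p \<noteq> b" using that zeros_Re_neg[OF beta_pos, of p] b by (cases "p = 0") (auto simp: P_def)
    qed
    have ab: "-\<sigma> < b" using \<sigma> b by linarith
    note S = vertical_contour_shift[OF ab zero_less_one zero_less_one CT(2) finP hol avoid bound]
    show "integrable lborel (\<lambda>t. f (Complex b t))" by (rule S(2))
    show "(LINT t|lborel. f (Complex b t)) - (LINT t|lborel. f (Complex (-\<sigma>) t)) = 2 * of_real pi * ?E"
      using S(3) sumP[OF b] by (simp only:)
  qed
  \<comment> \<open>lines to the right of all poles, at distance at least one from them\<close>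
  define b where "b = (\<lambda>m::nat. real k + 1 + real m)"
  have "(\<lambda>m. LINT t|lborel. f (Complex (b m) t)) \<longlonglongrightarrow> (LINT (t::real)|lborel. (0::complex))"
  proof (rule integral_dominated_convergence[where w = "\<lambda>t. fact k / Re (phi \<beta> 1) * (1 / (1 + t\<^sup>2))"])
    have bnd: "cmod (f (Complex (b m) t)) \<le> B / Re (phi \<beta> 1)"
      if "cmod (rice_kernel (Suc k) (Complex (b m) t)) \<le> B" for m t B
    proof -
      have "cmod (1 / phi \<beta> (Complex (b m) t)) \<le> 1 / Re (phi \<beta> 1)"
        using cmod_phi_ge[OF beta_pos, of "Complex (b m) t"] by (simp add: norm_divide b_def frac_le)
      moreover have "0 \<le> B" using that norm_ge_zero order_trans by blast
      ultimately have "cmod (f (Complex (b m) t)) \<le> B * (1 / Re (phi \<beta> 1))"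
        using that unfolding f_def norm_mult by (intro mult_mono) auto
      thus ?thesis by simp
    qed
    have bm: "Re (Complex (b m) t) \<ge> real k + 1" for m t by (simp add: b_def)
    show "AE t in lborel. cmod (f (Complex (b m) t)) \<le> fact k / Re (phi \<beta> 1) * (1 / (1 + t\<^sup>2))" for m
    proof (intro AE_I2)
      fix t :: real
      have "cmod (f (Complex (b m) t)) \<le> fact k / (1 + (Im (Complex (b m) t))\<^sup>2) / Re (phi \<beta> 1)"
        by (rule bnd[OF cmod_rice_kernel_le_right(1)[OF k bm]])
      also have "\<dots> = fact k / Re (phi \<beta> 1) * (1 / (1 + t\<^sup>2))"
        by (simp only: divide_inverse mult_ac mult_1_left complex.sel)
      finally show "cmod (f (Complex (b m) t)) \<le> fact k / Re (phi \<beta> 1) * (1 / (1 + t\<^sup>2))" .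
    qed
    show "AE t in lborel. (\<lambda>m. f (Complex (b m) t)) \<longlonglongrightarrow> 0"
    proof (rule AE_I2, rule Lim_null_comparison)
      fix t :: real
      show "eventually (\<lambda>m. cmod (f (Complex (b m) t)) \<le> fact k / b m / Re (phi \<beta> 1)) sequentially"
      proof (intro always_eventually allI)
        fix m
        have "cmod (f (Complex (b m) t)) \<le> fact k / Re (Complex (b m) t) / Re (phi \<beta> 1)"
          by (rule bnd[OF cmod_rice_kernel_le_right(2)[OF k bm]])
        thus "cmod (f (Complex (b m) t)) \<le> fact k / b m / Re (phi \<beta> 1)" by (simp only: complex.sel)
      qed
      have "filterlim b at_top sequentially" unfolding b_def
        by (intro filterlim_tendsto_add_at_top[OF tendsto_const] filterlim_real_sequentially)
      hence "(\<lambda>m. fact k / b m) \<longlonglongrightarrow> 0" by (intro tendsto_divide_0[OF tendsto_const] filterlim_at_top_imp_at_infinity)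
      from tendsto_divide[OF this tendsto_const, of "Re (phi \<beta> 1)"]
      show "(\<lambda>m. fact k / b m / Re (phi \<beta> 1)) \<longlonglongrightarrow> 0"
        using cmod_phi_ge(2)[OF beta_pos, of 1] by simp
    qed
    show "integrable lborel (\<lambda>t. fact k / Re (phi \<beta> 1) * (1 / (1 + t\<^sup>2)))"
    proof (intro integrable_mult_right)
      have pos: "1 + t\<^sup>2 > 0" for t :: real by (intro add_pos_nonneg) auto
      have "integrable lborel (\<lambda>t::real. complex_of_real (1 / (1 + t\<^sup>2)))"
      proof (rule integrable_of_powr_decay[where T = 1 and C = 1 and d = 1])
        show "continuous_on UNIV (\<lambda>t::real. complex_of_real (1 / (1 + t\<^sup>2)))"
          using pos by (intro continuous_intros) (auto simp: less_imp_neq[OF pos, symmetric])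
        show "cmod (complex_of_real (1 / (1 + t\<^sup>2))) \<le> 1 * \<bar>t\<bar> powr (-1-1)" if "\<bar>t\<bar> \<ge> 1" for t :: real
        proof -
          have "t \<noteq> 0" using that by auto
          hence "1 / (1 + t\<^sup>2) \<le> 1 / t\<^sup>2" using pos[of t] by (intro divide_left_mono) auto
          also have "\<dots> = \<bar>t\<bar> powr (-1-1)" using \<open>t \<noteq> 0\<close> by (simp add: powr_minus_divide powr_numeral)
          finally show ?thesis using pos[of t] by (simp only: norm_of_real) simp
        qed
      qed auto
      thus "integrable lborel (\<lambda>t::real. 1 / (1 + t\<^sup>2))" by (simp only: complex_of_real_integrable_eq)
    qed
    show "(\<lambda>t. f (Complex (b m) t)) \<in> borel_measurable lborel" for m
      using shift(1)[of "b m"] by (simp add: b_def borel_measurable_integrable)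
  qed auto
  moreover have "(LINT t|lborel. f (Complex (b m) t)) = (LINT t|lborel. f (Complex (-\<sigma>) t)) + 2 * of_real pi * ?E" for m
    using shift(2)[of "b m"] by (simp add: b_def algebra_simps)
  ultimately have "(\<lambda>m::nat. (LINT t|lborel. f (Complex (-\<sigma>) t)) + 2 * of_real pi * ?E) \<longlonglongrightarrow> 0"
    by simp
  hence "(LINT t|lborel. f (Complex (-\<sigma>) t)) + 2 * of_real pi * ?E = 0"
    by (simp only: tendsto_const_iff[OF sequentially_bot])
  hence "?E = - (1 / (2 * of_real pi)) * (LINT t|lborel. f (Complex (-\<sigma>) t))"
    by (simp add: field_simps add_eq_0_iff)
  thus ?thesis by (simp add: f_def)
qed

text \<open>
  The integral in \<open>rice_integral\<close> is at most a constant times \<open>(n-1)! / pochhammer \<sigma> n\<close>, and this is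
  \<open>Gamma_series' \<sigma> n * n powr -\<sigma>\<close>, where the first factor converges to \<open>\<Gamma>(\<sigma>)\<close>.
\<close>
theorem mean_height_asymptotics:
  assumes \<sigma>: "\<sigma> > 0" and nz: "\<And>z. Re z = - \<sigma> \<Longrightarrow> \<not> isolated_zero (phi \<beta>) z"
  shows "(\<lambda>n. of_real (mean_height (n - 1)) - (harm (n - 1) / mu \<beta> - (deriv ^^ 2) (phi \<beta>) 0 / (2 * (mu \<beta>)\<^sup>2)
           - (\<Sum>\<rho>\<in>zeros_strip \<beta> \<sigma>. B_term \<beta> \<rho> n))) \<in> O(\<lambda>n. of_real (real n powr - \<sigma>) :: complex)"
proof -
  define E where "E = (\<lambda>n. of_real (mean_height (n - 1)) - (harm (n - 1) / mu \<beta> - (deriv ^^ 2) (phi \<beta>) 0 / (2 * (mu \<beta>)\<^sup>2)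
           - (\<Sum>\<rho>\<in>zeros_strip \<beta> \<sigma>. B_term \<beta> \<rho> n)))"
  define g where "g = (\<lambda>t. (1 / phi \<beta> (Complex (-\<sigma>) t)) * of_real (\<sigma> * (\<sigma> + 1) / (\<sigma>\<^sup>2 + t\<^sup>2)))"
  have pos: "\<sigma>\<^sup>2 + t\<^sup>2 > 0" for t using \<sigma> by (intro add_pos_nonneg) auto
  have g_int: "integrable lborel g"
  proof -
    obtain C T where CT: "C > 0" "T \<ge> 1" "\<forall>z. \<bar>Re z\<bar> \<le> \<sigma> \<longrightarrow> \<bar>Im z\<bar> \<ge> T \<longrightarrow> cmod (1 / phi \<beta> z) \<le> C"
      using inverse_phi_bound_strip[of \<sigma>] by blast
    show ?thesis
    proof (rule integrable_of_powr_decay[where T = T and C = "C * (\<sigma> * (\<sigma> + 1))" and d = 1])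
      have "continuous_on {z. Re z = - \<sigma>} (\<lambda>z. 1 / phi \<beta> z)"
        using nz by (intro holomorphic_on_imp_continuous_on inverse_phi_holomorphic) auto
      hence c: "continuous_on UNIV (\<lambda>t. 1 / phi \<beta> (Complex (-\<sigma>) t))"
        by (rule continuous_on_compose2) (auto intro!: continuous_intros)
      show "continuous_on UNIV g" unfolding g_def
        by (intro continuous_on_mult[OF c] continuous_intros) (use pos in \<open>auto simp: less_imp_neq[OF pos, symmetric]\<close>)
      fix t :: real assume t: "\<bar>t\<bar> \<ge> T"
      hence "t \<noteq> 0" using CT by auto
      have "cmod (g t) = cmod (1 / phi \<beta> (Complex (-\<sigma>) t)) * (\<sigma> * (\<sigma> + 1) / (\<sigma>\<^sup>2 + t\<^sup>2))"
        unfolding g_def norm_mult norm_of_real using \<sigma> pos[of t] by simp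
      also have "\<dots> \<le> C * (\<sigma> * (\<sigma> + 1) / t\<^sup>2)"
        using CT t \<sigma> \<open>t \<noteq> 0\<close> pos[of t] by (intro mult_mono divide_left_mono) auto
      also have "\<dots> = C * (\<sigma> * (\<sigma> + 1)) * \<bar>t\<bar> powr (-1-1)" using \<open>t \<noteq> 0\<close> by (simp add: powr_minus_divide powr_numeral)
      finally show "cmod (g t) \<le> C * (\<sigma> * (\<sigma> + 1)) * \<bar>t\<bar> powr (-1-1)" .
    qed (use CT in auto)
  qed
  define M where "M = 1 / (2 * pi) * (LINT t|lborel. cmod (g t))"
  have bound: "cmod (E n) \<le> M * (Gamma_series' \<sigma> n * real n powr - \<sigma>)" if n: "n \<ge> 2" for n
  proof -
    obtain k where nk: "n = Suc k" "k \<ge> 1" using n by (cases n) auto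
    let ?f = "\<lambda>t. rice_kernel n (Complex (-\<sigma>) t) * (1 / phi \<beta> (Complex (-\<sigma>) t))"
    let ?c = "fact (n - 1) / pochhammer \<sigma> n"
    have c: "?c \<ge> 0" using \<sigma> by (simp add: pochhammer_nonneg)
    have norm_E: "cmod (E n) = 1 / (2 * pi) * cmod (LINT t|lborel. ?f t)"
    proof -
      have "E n = - (1 / (2 * of_real pi)) * (LINT t|lborel. ?f t)"
        unfolding E_def using rice_integral[OF \<sigma> nz nk(2)] unfolding nk diff_Suc_1 .
      hence "cmod (E n) = cmod (- (1 / (2 * of_real pi))) * cmod (LINT t|lborel. ?f t)"
        by (simp only: norm_mult)
      moreover have "cmod (- (1 / (2 * of_real pi))) = 1 / (2 * pi)" by (simp add: norm_divide)
      ultimately show ?thesis by (simp only:)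
    qed
    have "cmod (LINT t|lborel. ?f t) \<le> (LINT t|lborel. cmod (?f t))" by (rule integral_norm_bound)
    also have "\<dots> \<le> (LINT t|lborel. ?c * cmod (g t))"
    proof (rule integral_mono')
      show "integrable lborel (\<lambda>t. ?c * cmod (g t))" using g_int by (intro integrable_mult_right integrable_norm)
      fix t :: real
      have gt: "cmod (g t) = cmod (1 / phi \<beta> (Complex (-\<sigma>) t)) * (\<sigma> * (\<sigma> + 1) / (\<sigma>\<^sup>2 + t\<^sup>2))"
        unfolding g_def norm_mult norm_of_real using \<sigma> pos[of t] by simp
      have "cmod (?f t) \<le> (?c * (\<sigma> * (\<sigma> + 1) / (\<sigma>\<^sup>2 + t\<^sup>2))) * cmod (1 / phi \<beta> (Complex (-\<sigma>) t))"
        unfolding norm_mult by (intro mult_right_mono cmod_rice_kernel_le_left n \<sigma>) auto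
      thus "cmod (?f t) \<le> ?c * cmod (g t)" unfolding gt by (simp only: mult_ac)
      show "0 \<le> ?c * cmod (g t)" by (intro mult_nonneg_nonneg c norm_ge_zero)
    qed
    also have "\<dots> = ?c * (LINT t|lborel. cmod (g t))" by (rule integral_mult_right_zero)
    finally have bound_I: "cmod (LINT t|lborel. ?f t) \<le> ?c * (LINT t|lborel. cmod (g t))" .
    have c_eq: "?c = Gamma_series' \<sigma> n * real n powr - \<sigma>"
    proof -
      have "exp (\<sigma> * ln (real n)) * real n powr - \<sigma> = 1"
        using n by (simp add: powr_def flip: exp_add)
      thus ?thesis using n by (simp add: Gamma_series'_def)
    qed
    have "M * (Gamma_series' \<sigma> n * real n powr - \<sigma>) = 1 / (2 * pi) * (?c * (LINT t|lborel. cmod (g t)))"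
      unfolding M_def c_eq by (simp only: mult_ac)
    moreover have "1 / (2 * pi) * cmod (LINT t|lborel. ?f t) \<le> 1 / (2 * pi) * (?c * (LINT t|lborel. cmod (g t)))"
      by (intro mult_left_mono bound_I) simp
    ultimately show ?thesis unfolding norm_E by (simp only:)
  qed
  have "convergent (\<lambda>n. Gamma_series' \<sigma> n)"
    using Gamma_series'_LIMSEQ[of \<sigma>] by (auto simp: convergent_def)
  then obtain K where K: "K > 0" "\<And>n. norm (Gamma_series' \<sigma> n) \<le> K"
    using convergent_imp_Bseq BseqE by metis
  show ?thesis unfolding E_def[symmetric]
  proof (rule bigoI[of _ "\<bar>M\<bar> * K"], rule eventually_sequentiallyI[of 2])
    fix n :: nat assume n: "n \<ge> 2"
    have "M * (Gamma_series' \<sigma> n * real n powr - \<sigma>) \<le> \<bar>M\<bar> * \<bar>Gamma_series' \<sigma> n\<bar> * real n powr - \<sigma>"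
      unfolding mult.assoc[symmetric] abs_mult[symmetric] by (intro mult_right_mono abs_ge_self) simp
    also have "\<dots> \<le> \<bar>M\<bar> * K * real n powr - \<sigma>"
      using K(2)[of n] by (intro mult_right_mono mult_left_mono) auto
    finally have M_le: "M * (Gamma_series' \<sigma> n * real n powr - \<sigma>) \<le> \<bar>M\<bar> * K * real n powr - \<sigma>" .
    have "cmod (of_real (real n powr - \<sigma>)) = real n powr - \<sigma>" by simp
    thus "cmod (E n) \<le> \<bar>M\<bar> * K * cmod (of_real (real n powr - \<sigma>))"
      by (simp only:) (rule order_trans[OF bound[OF n] M_le])
  qed
qed

end

section \<open>The mean height is the solution of the first-step recursion\<close>

lemma binomial_sum_Suc:
  fixes f :: "nat \<Rightarrow> real"
  shows "(\<Sum>j\<le>Suc N. real (Suc N choose j) * f j) = (\<Sum>j\<le>N. real (N choose j) * (f j + f (Suc j)))"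
proof -
  have "(\<Sum>j\<le>Suc N. real (Suc N choose j) * f j) = f 0 + (\<Sum>j\<le>N. real (Suc N choose Suc j) * f (Suc j))"
    by (subst sum.atMost_Suc_shift) simp
  also have "\<dots> = (f 0 + (\<Sum>j\<le>N. real (N choose Suc j) * f (Suc j))) + (\<Sum>j\<le>N. real (N choose j) * f (Suc j))"
    by (simp add: algebra_simps sum.distrib)
  also have "f 0 + (\<Sum>j\<le>N. real (N choose Suc j) * f (Suc j)) = (\<Sum>j\<le>Suc N. real (N choose j) * f j)"
    by (subst sum.atMost_Suc_shift) simp
  also have "\<dots> = (\<Sum>j\<le>N. real (N choose j) * f j)" by simp
  finally show ?thesis by (simp add: algebra_simps sum.distrib)
qed

text \<open>
  Under the Beta integral this is \<open>(s + (1 - s))^N = 1\<close>; algebraically it iterates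
  \<open>B(a + 1, b) + B(a, b + 1) = B(a, b)\<close>.
\<close>
lemma Beta_binomial_sum:
  assumes "a > 0" "b > (0::real)"
  shows "(\<Sum>j\<le>N. real (N choose j) * Beta (a + real j) (b + real (N - j))) = Beta a b"
  using assms
proof (induction N arbitrary: a b)
  case (Suc N)
  have ni: "a \<notin> \<int>\<^sub>\<le>\<^sub>0" "b \<notin> \<int>\<^sub>\<le>\<^sub>0" using Suc.prems by (auto elim!: nonpos_Ints_cases)
  have "(\<Sum>j\<le>Suc N. real (Suc N choose j) * Beta (a + real j) (b + real (Suc N - j))) =
        (\<Sum>j\<le>N. real (N choose j) * (Beta (a + real j) (b + real (Suc N - j)) + Beta (a + real (Suc j)) (b + real (Suc N - Suc j))))"
    by (rule binomial_sum_Suc)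
  also have "\<dots> = (\<Sum>j\<le>N. real (N choose j) * Beta (a + real j) ((b + 1) + real (N - j))) +
                  (\<Sum>j\<le>N. real (N choose j) * Beta ((a + 1) + real j) (b + real (N - j)))"
    unfolding sum.distrib[symmetric] by (intro sum.cong refl) (auto simp: algebra_simps Suc_diff_le)
  also have "\<dots> = Beta a (b + 1) + Beta (a + 1) b"
    using Suc.IH[of a "b + 1"] Suc.IH[of "a + 1" b] Suc.prems by simp
  also have "\<dots> = Beta a b" using Beta_plus1_plus1[OF ni] by simp
  finally show ?case .
qed simp

text \<open>
  The binomial moments of the Beta-binomial weights, by
  \<open>(k choose j) (j choose i) = (k choose i) (k - i choose j - i)\<close>. With \<open>a = \<beta> + 2\<close> and \<open>b = \<beta> + 1\<close> the right-hand
  side contains \<open>B0 - \<phi>(i)\<close>, so binomial coefficients are eigenvectors of the splitting operator.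
\<close>
lemma Beta_binomial_moment:
  assumes "a > 0" "b > (0::real)" "i \<le> k"
  shows "(\<Sum>j\<le>k. real (k choose j) * Beta (a + real j) (b + real (k - j)) * real (j choose i)) =
           real (k choose i) * Beta (a + real i) b"
proof -
  have "(\<Sum>j\<le>k. real (k choose j) * Beta (a + real j) (b + real (k - j)) * real (j choose i)) =
        (\<Sum>j\<in>{i..k}. real (k choose j) * Beta (a + real j) (b + real (k - j)) * real (j choose i))"
    by (rule sum.mono_neutral_right) auto
  also have "\<dots> = (\<Sum>l\<le>k - i. real (k choose i) * (real ((k - i) choose l) * Beta ((a + real i) + real l) (b + real ((k - i) - l))))"
  proof (rule sum.reindex_bij_witness[of _ "\<lambda>l. i + l" "\<lambda>j. j - i"])
    fix j assume j: "j \<in> {i..k}"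
    have "(k choose j) * (j choose i) = (k choose i) * ((k - i) choose (j - i))"
      using j assms(3) by (intro choose_mult) auto
    hence "real (k choose j) * real (j choose i) = real (k choose i) * real ((k - i) choose (j - i))"
      by (metis of_nat_mult)
    moreover have "(a + real i) + real (j - i) = a + real j" using j by (simp add: of_nat_diff)
    moreover have "k - i - (j - i) = k - j" using j by simp
    ultimately show "real (k choose i) * (real ((k - i) choose (j - i)) * Beta ((a + real i) + real (j - i)) (b + real ((k - i) - (j - i))))
       = real (k choose j) * Beta (a + real j) (b + real (k - j)) * real (j choose i)"
      by (simp add: mult_ac)
  qed (use assms in auto)
  also have "\<dots> = real (k choose i) * Beta (a + real i) b"
    using assms unfolding sum_distrib_left[symmetric] by (subst Beta_binomial_sum) auto
  finally show ?thesis .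
qed

context
  fixes \<beta> :: real
  assumes beta_pos: "\<beta> > 0"
begin

text \<open>
  The rate at which a block of \<open>k + 1\<close> labels is split such that the part with a distinguished label consists of
  that label and \<open>j\<close> prescribed others. The distinguished label accounts for the parameter \<open>\<beta> + 2\<close>.
\<close>
definition split_weight :: "nat \<Rightarrow> nat \<Rightarrow> real" where
  "split_weight k j = Beta (\<beta> + 2 + real j) (\<beta> + 1 + real (k - j))"

lemma split_weight_pos: "split_weight k j > 0"
  unfolding split_weight_def using beta_pos by (intro Beta_real_pos) auto

lemma Re_phi_of_nat: "Re (phi \<beta> (of_nat j)) = B0 \<beta> - Beta (\<beta> + 2 + real j) (\<beta> + 1)"
proof -
  have "of_nat j + of_real \<beta> + 2 = complex_of_real (\<beta> + 2 + real j)" by simp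
  thus ?thesis using beta_pos by (subst phi_eq_Re[OF beta_pos]) (simp_all only: Beta_complex_of_real, simp_all)
qed

lemma Re_phi_of_nat_pos: "j \<ge> 1 \<Longrightarrow> Re (phi \<beta> (of_nat j)) > 0"
  by (intro Re_phi_pos[OF beta_pos]) auto

lemma mean_height_0: "mean_height \<beta> 0 = 0"
  by (simp add: mean_height_def[OF beta_pos])

text \<open>
  The operator \<open>f \<mapsto> (\<Sum>j<k. (k choose j) * split_weight k j * (f j - f k))\<close> multiplies \<open>f j = (j choose i)\<close> by
  \<open>-\<phi>(i)\<close>. The coefficients \<open>c i\<close> of \<open>mean_height\<close> in this basis cancel the eigenvalues, and what remains is an
  alternating sum of binomial coefficients.
\<close>
lemma mean_height_recursion:
  assumes "k \<ge> 1"
  shows "(\<Sum>j<k. real (k choose j) * split_weight k j * (mean_height \<beta> j - mean_height \<beta> k)) = -1"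
proof -
  define c where "c = (\<lambda>i. (-1) ^ (i + 1) / Re (phi \<beta> (of_nat i)))"
  have H: "mean_height \<beta> j = (\<Sum>i=1..k. c i * real (j choose i))" if "j \<le> k" for j
  proof -
    have "mean_height \<beta> j = (\<Sum>i=1..j. c i * real (j choose i))"
      unfolding mean_height_def[OF beta_pos] c_def by (intro sum.cong) auto
    also have "\<dots> = (\<Sum>i=1..k. c i * real (j choose i))"
      using that by (intro sum.mono_neutral_left) auto
    finally show ?thesis .
  qed
  have "(\<Sum>j<k. real (k choose j) * split_weight k j * (mean_height \<beta> j - mean_height \<beta> k)) =
        (\<Sum>j\<le>k. real (k choose j) * split_weight k j * (mean_height \<beta> j - mean_height \<beta> k))"
    by (rule sum.mono_neutral_left) auto
  also have "\<dots> = (\<Sum>j\<le>k. (\<Sum>i=1..k. c i * (real (k choose j) * split_weight k j * real (j choose i))) -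
       (\<Sum>i=1..k. c i * (real (k choose j) * split_weight k j * real (k choose i))))"
    by (intro sum.cong refl) (simp add: H sum_distrib_left right_diff_distrib mult_ac)
  also have "\<dots> = (\<Sum>i=1..k. c i * ((\<Sum>j\<le>k. real (k choose j) * split_weight k j * real (j choose i))
       - (\<Sum>j\<le>k. real (k choose j) * split_weight k j) * real (k choose i)))"
    unfolding sum_subtractf
    by (subst (1 2) sum.swap) (simp add: sum_distrib_left sum_distrib_right sum_subtractf right_diff_distrib)
  also have "\<dots> = (\<Sum>i=1..k. - ((-1) ^ (i + 1) * real (k choose i)))"
  proof (intro sum.cong refl)
    fix i assume i: "i \<in> {1..k}"
    have "(\<Sum>j\<le>k. real (k choose j) * split_weight k j * real (j choose i)) = real (k choose i) * Beta (\<beta> + 2 + real i) (\<beta> + 1)"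
      unfolding split_weight_def using i beta_pos by (intro Beta_binomial_moment) auto
    moreover have "(\<Sum>j\<le>k. real (k choose j) * split_weight k j) = B0 \<beta>"
      unfolding split_weight_def B0_def[OF beta_pos] using beta_pos by (intro Beta_binomial_sum) auto
    moreover have "Re (phi \<beta> (of_nat i)) > 0" using i by (intro Re_phi_of_nat_pos) auto
    moreover have "real (k choose i) * Beta (\<beta> + 2 + real i) (\<beta> + 1) - B0 \<beta> * real (k choose i) =
        - real (k choose i) * Re (phi \<beta> (of_nat i))" by (simp add: Re_phi_of_nat algebra_simps)
    ultimately show "c i * ((\<Sum>j\<le>k. real (k choose j) * split_weight k j * real (j choose i))
       - (\<Sum>j\<le>k. real (k choose j) * split_weight k j) * real (k choose i)) = - ((-1) ^ (i + 1) * real (k choose i))"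
      by (simp add: c_def)
  qed
  also have "\<dots> = (\<Sum>i=1..k. (-1) ^ i * real (k choose i))" by simp
  also have "\<dots> = (\<Sum>i\<le>k. (-1) ^ i * real (k choose i)) - 1"
    by (simp add: sum.atLeast1_atMost_eq sum.atMost_shift atMost_atLeast0 sum.atLeast0_atMost_Suc_shift
          sum.atLeast_Suc_atMost)
  also have "\<dots> = -1" using choose_alternating_sum[of k, where ?'a = real] assms by simp
  finally show ?thesis .
qed

lemma mean_height_nonneg: "mean_height \<beta> k \<ge> 0"
proof (induction k rule: less_induct)
  case (less k)
  show ?case
  proof (cases "k = 0")
    case False
    let ?w = "\<lambda>j. real (k choose j) * split_weight k j"
    have "(\<Sum>j<k. ?w j * (mean_height \<beta> j - mean_height \<beta> k)) = -1"
      using mean_height_recursion[of k] False by simp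
    hence "(\<Sum>j<k. ?w j) * mean_height \<beta> k = 1 + (\<Sum>j<k. ?w j * mean_height \<beta> j)"
      by (simp add: right_diff_distrib sum_subtractf sum_distrib_right)
    also have "\<dots> \<ge> 0"
      using less.IH split_weight_pos by (intro add_nonneg_nonneg sum_nonneg mult_nonneg_nonneg) (auto intro: less_imp_le)
    finally have "(\<Sum>j<k. ?w j) * mean_height \<beta> k \<ge> 0" .
    moreover have "(\<Sum>j<k. ?w j) > 0"
      using False split_weight_pos by (intro sum_pos mult_pos_pos) (auto simp: zero_less_binomial)
    ultimately show ?thesis by (simp add: zero_le_mult_iff)
  qed (simp add: mean_height_0)
qed

section \<open>The block containing a given label\<close>

lemma sum_Pow_card:
  fixes h :: "nat \<Rightarrow> real"
  assumes "finite A"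
  shows "(\<Sum>c\<in>Pow A. h (card c)) = (\<Sum>i\<le>card A. real (card A choose i) * h i)"
proof -
  have "(\<Sum>c\<in>Pow A. h (card c)) = (\<Sum>i\<in>{..card A}. \<Sum>c\<in>{c\<in>Pow A. card c = i}. h (card c))"
    using assms by (intro sum.group[symmetric]) (auto intro: card_mono)
  also have "\<dots> = (\<Sum>i\<le>card A. real (card A choose i) * h i)"
  proof (intro sum.cong refl)
    fix i
    have "(\<Sum>c\<in>{c\<in>Pow A. card c = i}. h (card c)) = real (card {c\<in>Pow A. card c = i}) * h i" by simp
    also have "{c\<in>Pow A. card c = i} = {c. c \<subseteq> A \<and> card c = i}" by auto
    finally show "(\<Sum>c\<in>{c\<in>Pow A. card c = i}. h (card c)) = real (card A choose i) * h i"
      using n_subsets[OF assms, of i] by simp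
  qed
  finally show ?thesis .
qed

text \<open>
  The mean time that a label \<open>j\<close> lying in the block \<open>b\<close> still needs to become a singleton.
\<close>
definition label_height :: "nat \<Rightarrow> nat set \<Rightarrow> real" where
  "label_height j b = (if j \<in> b then mean_height \<beta> (card b - 1) else 0)"

definition split_rate :: "nat set \<Rightarrow> nat set \<Rightarrow> real" where
  "split_rate b c = block_rate \<beta> (card b) * (q_split \<beta> (card b) (card c) / real (card b choose card c))"

lemma split_rate_eq:
  assumes "finite b" "c \<subset> b" "c \<noteq> {}"
  shows "split_rate b c = Beta (real (card c) + \<beta> + 1) (real (card b - card c) + \<beta> + 1) / 2"
proof -
  have "card c < card b" "card c > 0"
    using assms psubset_card_mono[of b c] finite_subset[of c b] by (auto simp: card_gt_0_iff)
  hence "block_rate \<beta> (card b) > 0" "card b choose card c > 0"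
    unfolding block_rate_def by (auto intro!: Re_phi_of_nat_pos simp del: of_nat_diff)
  thus ?thesis by (simp add: split_rate_def q_split_def)
qed

text \<open>
  Splits with \<open>j\<close> in the first part and splits with \<open>j\<close> in the second part contribute equally. The parts
  that contain \<open>j\<close> correspond to subsets of \<open>b - {j}\<close>; grouping them by size leads to the recursion.
\<close>
lemma drift_of_block:
  assumes b: "finite b" "2 \<le> card b" and j: "j \<in> b"
  shows "(\<Sum>c\<in>{c. c \<noteq> {} \<and> c \<subset> b}. split_rate b c * (label_height j c + label_height j (b - c) - label_height j b)) = -1"
proof -
  let ?C = "{c. c \<noteq> {} \<and> c \<subset> b}" and ?r = "\<lambda>c. split_rate b c * (label_height j c + label_height j (b - c) - label_height j b)"
  define k where "k = card b - 1"
  have k: "card b = Suc k" "k \<ge> 1" "card (b - {j}) = k" using assms by (auto simp: k_def)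
  have fin: "finite ?C" using b by (auto intro: finite_subset[of _ "Pow b"])
  have C: "?C = {c\<in>?C. j \<in> c} \<union> {c\<in>?C. j \<notin> c}" by auto
  \<comment> \<open>exchanging the two parts of a split preserves its rate\<close>
  have sym: "split_rate b (b - c) = split_rate b c" if "c \<in> ?C" for c
  proof -
    have c: "c \<subset> b" "c \<noteq> {}" "b - c \<subset> b" "b - c \<noteq> {}" using that by auto
    have "finite c" using finite_subset[OF _ b(1)] c(1) by blast
    hence "card (b - c) = card b - card c" using c(1) by (intro card_Diff_subset) auto
    moreover have "card c \<le> card b" using c b by (simp add: card_mono)
    ultimately show ?thesis
      using split_rate_eq[OF b(1) c(1,2)] split_rate_eq[OF b(1) c(3,4)] by (simp add: Beta_commute)
  qed
  have "sum ?r ?C = sum ?r {c\<in>?C. j \<in> c} + sum ?r {c\<in>?C. j \<notin> c}"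
  proof -
    have "finite {c\<in>?C. j \<in> c}" "finite {c\<in>?C. j \<notin> c}" using fin by (auto intro: finite_subset[OF _ fin])
    hence "sum ?r ({c\<in>?C. j \<in> c} \<union> {c\<in>?C. j \<notin> c}) = sum ?r {c\<in>?C. j \<in> c} + sum ?r {c\<in>?C. j \<notin> c}"
      by (rule sum.union_disjoint) auto
    thus ?thesis by (subst C)
  qed
  also have "sum ?r {c\<in>?C. j \<notin> c} = sum ?r {c\<in>?C. j \<in> c}"
  proof (rule sum.reindex_bij_witness[of _ "\<lambda>c. b - c" "\<lambda>c. b - c"])
    fix c assume c: "c \<in> {c\<in>?C. j \<notin> c}"
    hence "b - (b - c) = c" by auto
    thus "?r (b - c) = ?r c" using c sym[of c] by (simp add: add_ac)
  qed (use j in auto)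
  also have "sum ?r {c\<in>?C. j \<in> c} + sum ?r {c\<in>?C. j \<in> c} =
      (\<Sum>c\<in>{c\<in>?C. j \<in> c}. 2 * split_rate b c * (mean_height \<beta> (card c - 1) - mean_height \<beta> k))"
    unfolding sum.distrib[symmetric]
    using j by (intro sum.cong refl) (auto simp: label_height_def k_def algebra_simps)
  also have "\<dots> = (\<Sum>a\<in>Pow (b - {j}) - {b - {j}}. split_weight k (card a) * (mean_height \<beta> (card a) - mean_height \<beta> k))"
  proof (rule sum.reindex_bij_witness[of _ "insert j" "\<lambda>c. c - {j}"])
    fix c assume c: "c \<in> {c\<in>?C. j \<in> c}"
    hence fc: "finite c" using b finite_subset by blast
    have cc: "card (c - {j}) = card c - 1" "card c \<ge> 1" using c fc by (auto simp: Suc_le_eq card_gt_0_iff)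
    have "2 * split_rate b c = split_weight k (card c - 1)"
      using split_rate_eq[OF b(1), of c] c cc(2) k(1)
      by (simp add: split_weight_def of_nat_diff algebra_simps Suc_diff_le)
    thus "split_weight k (card (c - {j})) * (mean_height \<beta> (card (c - {j})) - mean_height \<beta> k)
        = 2 * split_rate b c * (mean_height \<beta> (card c - 1) - mean_height \<beta> k)"
      unfolding cc(1) by simp
  qed (use j in auto)
  also have "\<dots> = (\<Sum>a\<in>Pow (b - {j}). split_weight k (card a) * (mean_height \<beta> (card a) - mean_height \<beta> k))"
    using b k by (intro sum.mono_neutral_left) auto
  also have "\<dots> = (\<Sum>i\<le>k. real (k choose i) * (split_weight k i * (mean_height \<beta> i - mean_height \<beta> k)))"
    using sum_Pow_card[of "b - {j}" "\<lambda>i. split_weight k i * (mean_height \<beta> i - mean_height \<beta> k)"] b k by simp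
  also have "\<dots> = (\<Sum>i<k. real (k choose i) * split_weight k i * (mean_height \<beta> i - mean_height \<beta> k))"
    by (rule sum.mono_neutral_cong_right) auto
  also have "\<dots> = -1" using mean_height_recursion[OF k(2)] .
  finally show ?thesis .
qed

definition splits :: "nat set set \<Rightarrow> (nat set \<times> nat set) set" where
  "splits \<pi> = {(b, c). b \<in> \<pi> \<and> 2 \<le> card b \<and> c \<noteq> {} \<and> c \<subset> b}"

definition split_at :: "nat set set \<Rightarrow> nat set \<times> nat set \<Rightarrow> nat set set" where
  "split_at \<pi> = (\<lambda>(b, c). (\<pi> - {b}) \<union> {c, b - c})"

lemma finite_partitions: "finite (partitions n)"
proof -
  have "partitions n \<subseteq> Pow (Pow {1..n})" by (auto simp: partitions_def partition_on_def)
  thus ?thesis by (rule finite_subset) simp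
qed

lemma partitions_block:
  assumes "\<pi> \<in> partitions n" "b \<in> \<pi>"
  shows "finite b \<and> b \<subseteq> {1..n} \<and> b \<noteq> {}"
proof -
  have "b \<subseteq> {1..n}" "b \<noteq> {}" using assms by (auto simp: partitions_def partition_on_def)
  thus ?thesis using finite_subset[of b "{1..n}"] by blast
qed

lemma partitions_finite:
  assumes "\<pi> \<in> partitions n"
  shows "finite \<pi>"
proof -
  have "\<pi> \<subseteq> Pow {1..n}" using partitions_block[OF assms] by blast
  thus ?thesis by (rule finite_subset) simp
qed

lemma split_at_partition:
  assumes "\<pi> \<in> partitions n" "s \<in> splits \<pi>"
  shows "split_at \<pi> s \<in> partitions n"
proof -
  obtain b c where s: "s = (b, c)" "b \<in> \<pi>" "c \<noteq> {}" "c \<subset> b" using assms(2) by (auto simp: splits_def)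
  have P: "\<Union>\<pi> = {1..n}" "disjoint \<pi>" "{} \<notin> \<pi>" using assms(1) by (auto simp: partitions_def partition_on_def)
  have "\<Union>(split_at \<pi> s) = {1..n}" using P(1) s by (auto simp: split_at_def)
  moreover have "disjoint (split_at \<pi> s)"
  proof (rule disjointI)
    fix x y assume xy: "x \<in> split_at \<pi> s" "y \<in> split_at \<pi> s" "x \<noteq> y"
    have d: "x \<inter> b = {}" if "x \<in> \<pi>" "x \<noteq> b" for x using P(2) that s(2) by (auto dest: disjointD)
    have d': "x \<inter> y = {}" if "x \<in> \<pi>" "y \<in> \<pi>" using P(2) that xy(3) by (auto dest: disjointD)
    have "x \<in> \<pi> \<and> x \<noteq> b \<or> x = c \<or> x = b - c" "y \<in> \<pi> \<and> y \<noteq> b \<or> y = c \<or> y = b - c"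
      using xy by (auto simp: split_at_def s(1))
    thus "x \<inter> y = {}" using d[of x] d[of y] d' xy(3) s(4) by (elim disjE conjE) blast+
  qed
  moreover have "{} \<notin> split_at \<pi> s" using P(3) s by (auto simp: split_at_def)
  ultimately show ?thesis by (simp add: partitions_def partition_on_def)
qed

lemma finite_splits: "\<pi> \<in> partitions n \<Longrightarrow> finite (splits \<pi>)"
proof -
  assume "\<pi> \<in> partitions n"
  hence "splits \<pi> \<subseteq> Pow {1..n} \<times> Pow {1..n}" using partitions_block by (force simp: splits_def)
  thus ?thesis by (rule finite_subset) simp
qed

lemma jump_rate_eq:
  "jump_rate \<beta> \<pi> \<pi>' = (\<Sum>s\<in>{s\<in>splits \<pi>. split_at \<pi> s = \<pi>'}. case_prod split_rate s)"
  unfolding jump_rate_def splits_def split_at_def split_rate_def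
  by (intro sum.cong) auto

text \<open>
  Only the block of \<open>j\<close> contributes. The sum over all blocks makes the effect of a split visible without a case
  distinction on which block contains \<open>j\<close>.
\<close>
definition total_height :: "nat \<Rightarrow> nat set set \<Rightarrow> real" where
  "total_height j \<pi> = (\<Sum>b\<in>\<pi>. label_height j b)"

lemma total_height_split:
  assumes "\<pi> \<in> partitions n" "(b, c) \<in> splits \<pi>"
  shows "total_height j (split_at \<pi> (b, c)) - total_height j \<pi> = label_height j c + label_height j (b - c) - label_height j b"
proof -
  have b: "b \<in> \<pi>" "c \<noteq> {}" "c \<subset> b" using assms by (auto simp: splits_def)
  have P: "disjoint \<pi>" "{} \<notin> \<pi>" "finite \<pi>" using assms(1) partitions_finite by (auto simp: partitions_def partition_on_def)
  have nin: "c \<notin> \<pi>" "b - c \<notin> \<pi>" "c \<noteq> b - c"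
  proof -
    show "c \<notin> \<pi>" using disjointD[OF P(1) _ b(1), of c] b by auto
    show "b - c \<notin> \<pi>" using disjointD[OF P(1) _ b(1), of "b - c"] b by auto
    show "c \<noteq> b - c" using b by auto
  qed
  have "total_height j (split_at \<pi> (b, c)) = sum (label_height j) (insert c (insert (b - c) (\<pi> - {b})))"
    unfolding total_height_def split_at_def by (intro sum.cong) auto
  also have "\<dots> = label_height j c + (label_height j (b - c) + sum (label_height j) (\<pi> - {b}))"
    using P nin by simp
  also have "sum (label_height j) (\<pi> - {b}) = total_height j \<pi> - label_height j b"
    unfolding total_height_def using P b by (simp add: sum_diff1)
  finally show ?thesis by simp
qed

text \<open>
  The mean remaining time decreases at unit speed in expectation until \<open>j\<close> is a singleton.
\<close>
lemma generator_total_height: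
  assumes \<pi>: "\<pi> \<in> partitions n" and j: "j \<in> {1..n}"
  shows "(\<Sum>\<pi>'\<in>partitions n. generator (partitions n) (jump_rate \<beta>) \<pi> \<pi>' * total_height j \<pi>')
           = - of_bool ({j} \<notin> \<pi>)"
proof -
  let ?S = "partitions n" and ?f = "total_height j"
  have "(\<Sum>\<pi>'\<in>?S. generator ?S (jump_rate \<beta>) \<pi> \<pi>' * ?f \<pi>') =
     generator ?S (jump_rate \<beta>) \<pi> \<pi> * ?f \<pi> + (\<Sum>\<pi>'\<in>?S - {\<pi>}. generator ?S (jump_rate \<beta>) \<pi> \<pi>' * ?f \<pi>')"
    using \<pi> finite_partitions by (intro sum.remove) auto
  also have "(\<Sum>\<pi>'\<in>?S - {\<pi>}. generator ?S (jump_rate \<beta>) \<pi> \<pi>' * ?f \<pi>') = (\<Sum>\<pi>'\<in>?S - {\<pi>}. jump_rate \<beta> \<pi> \<pi>' * ?f \<pi>')"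
    by (intro sum.cong refl) (auto simp: generator_def)
  also have "generator ?S (jump_rate \<beta>) \<pi> \<pi> * ?f \<pi> = - (\<Sum>\<pi>'\<in>?S - {\<pi>}. jump_rate \<beta> \<pi> \<pi>' * ?f \<pi>)"
    by (simp add: generator_def sum_distrib_right)
  also have "- (\<Sum>\<pi>'\<in>?S - {\<pi>}. jump_rate \<beta> \<pi> \<pi>' * ?f \<pi>) + (\<Sum>\<pi>'\<in>?S - {\<pi>}. jump_rate \<beta> \<pi> \<pi>' * ?f \<pi>')
     = (\<Sum>\<pi>'\<in>?S - {\<pi>}. jump_rate \<beta> \<pi> \<pi>' * (?f \<pi>' - ?f \<pi>))"
    by (simp add: right_diff_distrib sum_subtractf)
  also have "\<dots> = (\<Sum>\<pi>'\<in>?S. jump_rate \<beta> \<pi> \<pi>' * (?f \<pi>' - ?f \<pi>))"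
    using finite_partitions by (intro sum.mono_neutral_left) auto
  also have "\<dots> = (\<Sum>\<pi>'\<in>?S. \<Sum>s\<in>{s\<in>splits \<pi>. split_at \<pi> s = \<pi>'}. case_prod split_rate s * (?f (split_at \<pi> s) - ?f \<pi>))"
    unfolding jump_rate_eq sum_distrib_right by (intro sum.cong refl) auto
  also have "\<dots> = (\<Sum>s\<in>splits \<pi>. case_prod split_rate s * (?f (split_at \<pi> s) - ?f \<pi>))"
    using split_at_partition[OF \<pi>] by (intro sum.group finite_splits[OF \<pi>] finite_partitions) auto
  also have "\<dots> = (\<Sum>(b, c)\<in>(SIGMA b:{b\<in>\<pi>. 2 \<le> card b}. {c. c \<noteq> {} \<and> c \<subset> b}).
       split_rate b c * (label_height j c + label_height j (b - c) - label_height j b))"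
  proof (rule sum.cong)
    show "splits \<pi> = (SIGMA b:{b\<in>\<pi>. 2 \<le> card b}. {c. c \<noteq> {} \<and> c \<subset> b})" by (auto simp: splits_def)
    fix s assume "s \<in> (SIGMA b:{b\<in>\<pi>. 2 \<le> card b}. {c. c \<noteq> {} \<and> c \<subset> b})"
    then obtain b c where s: "s = (b, c)" "(b, c) \<in> splits \<pi>" by (auto simp: splits_def)
    show "case_prod split_rate s * (?f (split_at \<pi> s) - ?f \<pi>) =
       (case s of (b, c) \<Rightarrow> split_rate b c * (label_height j c + label_height j (b - c) - label_height j b))"
      using total_height_split[OF \<pi> s(2), of j] by (simp add: s(1))
  qed
  also have "\<dots> = (\<Sum>b\<in>{b\<in>\<pi>. 2 \<le> card b}. \<Sum>c\<in>{c. c \<noteq> {} \<and> c \<subset> b}.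
       split_rate b c * (label_height j c + label_height j (b - c) - label_height j b))"
    using partitions_finite[OF \<pi>] partitions_block[OF \<pi>]
    by (intro sum.Sigma[symmetric]) (auto intro: finite_subset[of _ "Pow _"])
  also have "\<dots> = (\<Sum>b\<in>{b\<in>\<pi>. 2 \<le> card b}. - of_bool (j \<in> b))"
  proof (intro sum.cong refl)
    fix b assume b: "b \<in> {b\<in>\<pi>. 2 \<le> card b}"
    show "(\<Sum>c\<in>{c. c \<noteq> {} \<and> c \<subset> b}. split_rate b c * (label_height j c + label_height j (b - c) - label_height j b))
         = - of_bool (j \<in> b)"
    proof (cases "j \<in> b")
      case True
      thus ?thesis using drift_of_block[of b j] b partitions_block[OF \<pi>] by simp
    next
      case False
      hence "split_rate b c * (label_height j c + label_height j (b - c) - label_height j b) = 0" if "c \<subset> b" for c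
        using that by (auto simp: label_height_def)
      hence "(\<Sum>c\<in>{c. c \<noteq> {} \<and> c \<subset> b}. split_rate b c * (label_height j c + label_height j (b - c) - label_height j b)) = 0"
        by (intro sum.neutral) blast
      thus ?thesis using False by simp
    qed
  qed
  also have "\<dots> = - of_bool ({j} \<notin> \<pi>)"
  proof -
    have P: "\<Union>\<pi> = {1..n}" "disjoint \<pi>" using \<pi> by (auto simp: partitions_def partition_on_def)
    have "j \<in> \<Union>\<pi>" using P(1) j by (simp only:)
    then obtain b0 where b0: "b0 \<in> \<pi>" "j \<in> b0" by blast
    have uniq: "b = b0" if "b \<in> \<pi>" "j \<in> b" for b using disjointD[OF P(2) that(1) b0(1)] that b0 by auto
    have fb: "finite b0" using partitions_block[OF \<pi> b0(1)] by auto
    have fin: "finite {b\<in>\<pi>. 2 \<le> card b}" using partitions_finite[OF \<pi>] by simp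
    have sum_eq: "(\<Sum>b\<in>{b\<in>\<pi>. 2 \<le> card b}. - of_bool (j \<in> b)) = (\<Sum>b\<in>{b\<in>{b\<in>\<pi>. 2 \<le> card b}. j \<in> b}. (-1::real))"
      unfolding sum.inter_filter[OF fin] by (intro sum.cong) auto
    have "(\<Sum>b\<in>{b\<in>\<pi>. 2 \<le> card b}. - of_bool (j \<in> b)) = (- of_bool (2 \<le> card b0) :: real)"
    proof (cases "2 \<le> card b0")
      case True
      hence "{b\<in>{b\<in>\<pi>. 2 \<le> card b}. j \<in> b} = {b0}" using b0 uniq by blast
      from sum_eq[unfolded this] show ?thesis using True by simp
    next
      case False
      hence "{b\<in>{b\<in>\<pi>. 2 \<le> card b}. j \<in> b} = {}" using uniq by blast
      from sum_eq[unfolded this] show ?thesis using False by simp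
    qed
    moreover have "{j} \<in> \<pi> \<longleftrightarrow> \<not> 2 \<le> card b0"
    proof
      assume "{j} \<in> \<pi>" hence "b0 = {j}" using uniq by auto
      thus "\<not> 2 \<le> card b0" by simp
    next
      assume "\<not> 2 \<le> card b0"
      moreover have "card b0 > 0" using b0 fb by (auto simp: card_gt_0_iff)
      ultimately have "card b0 = 1" by linarith
      then obtain x where "b0 = {x}" by (auto simp: card_1_singleton_iff)
      thus "{j} \<in> \<pi>" using b0 by auto
    qed
    ultimately show ?thesis by simp
  qed
  finally show ?thesis .
qed

lemma total_height_nonneg: "total_height j \<pi> \<ge> 0"
  unfolding total_height_def label_height_def by (intro sum_nonneg) (auto simp: mean_height_nonneg)

lemma total_height_singleton:
  assumes "\<pi> \<in> partitions n" "{j} \<in> \<pi>"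
  shows "total_height j \<pi> = 0"
proof -
  have "disjoint \<pi>" using assms by (auto simp: partitions_def partition_on_def)
  hence "b = {j}" if "b \<in> \<pi>" "j \<in> b" for b using disjointD[of \<pi> b "{j}"] that assms by auto
  hence "label_height j b = 0" if "b \<in> \<pi>" for b
  proof (cases "j \<in> b")
    case True
    hence "b = {j}" using that \<open>\<And>b. b \<in> \<pi> \<Longrightarrow> j \<in> b \<Longrightarrow> b = {j}\<close> by blast
    thus ?thesis by (simp add: label_height_def mean_height_0)
  qed (simp add: label_height_def)
  thus ?thesis unfolding total_height_def by simp
qed

end

section \<open>Transition functions of finite Markov chains\<close>

definition gen_act :: "'s set \<Rightarrow> ('s \<Rightarrow> 's \<Rightarrow> real) \<Rightarrow> nat \<Rightarrow> ('s \<Rightarrow> real) \<Rightarrow> 's \<Rightarrow> real" where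
  "gen_act S G k f x = (\<Sum>y\<in>S. gen_power S G k x y * f y)"

lemma gen_act_0: "finite S \<Longrightarrow> x \<in> S \<Longrightarrow> gen_act S G 0 f x = f x"
  by (simp add: gen_act_def of_bool_def if_distrib[of "\<lambda>u. u * _"] sum.delta cong: if_cong)

lemma gen_act_Suc: "gen_act S G (Suc k) f x = (\<Sum>z\<in>S. G x z * gen_act S G k f z)"
  unfolding gen_act_def
  by (simp add: sum_distrib_left sum_distrib_right mult.assoc) (rule sum.swap)

lemma gen_act_Suc':
  assumes "finite S" "x \<in> S"
  shows "gen_act S G (Suc k) f x = gen_act S G k (\<lambda>z. \<Sum>y\<in>S. G z y * f y) x"
  using assms(2)
proof (induction k arbitrary: x)
  case 0
  have "gen_act S G (Suc 0) f x = (\<Sum>z\<in>S. G x z * f z)"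
    unfolding gen_act_Suc by (intro sum.cong refl) (simp add: gen_act_0[OF assms(1)])
  thus ?case using gen_act_0[OF assms(1) 0] by simp
next
  case (Suc k)
  thus ?case by (subst gen_act_Suc, subst gen_act_Suc) simp
qed

lemma gen_act_bound:
  assumes "finite S" "x \<in> S" "\<And>x. x \<in> S \<Longrightarrow> (\<Sum>z\<in>S. \<bar>G x z\<bar>) \<le> K" "\<And>x. x \<in> S \<Longrightarrow> \<bar>f x\<bar> \<le> B" "K \<ge> 0" "B \<ge> 0"
  shows "\<bar>gen_act S G k f x\<bar> \<le> K ^ k * B"
  using assms(2)
proof (induction k arbitrary: x)
  case 0
  thus ?case using assms by (simp add: gen_act_0)
next
  case (Suc k)
  have "\<bar>gen_act S G (Suc k) f x\<bar> \<le> (\<Sum>z\<in>S. \<bar>G x z\<bar> * \<bar>gen_act S G k f z\<bar>)"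
    unfolding gen_act_Suc abs_mult[symmetric] by (rule sum_abs)
  also have "\<dots> \<le> (\<Sum>z\<in>S. \<bar>G x z\<bar> * (K ^ k * B))"
    using Suc.IH by (intro sum_mono mult_left_mono) auto
  also have "\<dots> = (\<Sum>z\<in>S. \<bar>G x z\<bar>) * (K ^ k * B)" by (simp add: sum_distrib_right)
  also have "\<dots> \<le> K * (K ^ k * B)" using Suc.prems assms by (intro mult_right_mono) auto
  finally show ?case by simp
qed

text \<open>
  The function \<open>exp (t G) f\<close> as a power series in \<open>t\<close>, which makes its differentiation in \<open>t\<close> termwise.
\<close>
definition semigroup_act :: "'s set \<Rightarrow> ('s \<Rightarrow> 's \<Rightarrow> real) \<Rightarrow> ('s \<Rightarrow> real) \<Rightarrow> 's \<Rightarrow> real \<Rightarrow> real" where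
  "semigroup_act S G f x t = (\<Sum>k. gen_act S G k f x / fact k * t ^ k)"

lemma summable_gen_act:
  assumes "finite S" "x \<in> S"
  shows "summable (\<lambda>k. gen_act S G k f x / fact k * t ^ k)"
proof -
  define K where "K = (\<Sum>x\<in>S. \<Sum>z\<in>S. \<bar>G x z\<bar>)"
  define B where "B = (\<Sum>x\<in>S. \<bar>f x\<bar>)"
  have K: "(\<Sum>z\<in>S. \<bar>G x z\<bar>) \<le> K" if "x \<in> S" for x
    unfolding K_def using assms that by (intro member_le_sum) (auto intro: sum_nonneg)
  have B: "\<bar>f x\<bar> \<le> B" if "x \<in> S" for x
    unfolding B_def using assms that by (intro member_le_sum) auto
  have nn: "K \<ge> 0" "B \<ge> 0" by (auto simp: K_def B_def intro!: sum_nonneg)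
  show ?thesis
  proof (rule summable_comparison_test')
    have "summable (\<lambda>k. inverse (fact k) * (K * \<bar>t\<bar>) ^ k)" by (rule summable_exp)
    thus "summable (\<lambda>k. B * (inverse (fact k) * (K * \<bar>t\<bar>) ^ k))" by (rule summable_mult)
    fix k :: nat assume "k \<ge> 0"
    have "norm (gen_act S G k f x / fact k * t ^ k) = \<bar>gen_act S G k f x\<bar> * (inverse (fact k) * \<bar>t\<bar> ^ k)"
      by (simp add: abs_mult power_abs divide_inverse)
    also have "\<dots> \<le> (K ^ k * B) * (inverse (fact k) * \<bar>t\<bar> ^ k)"
      by (intro mult_right_mono gen_act_bound assms K B nn) auto
    also have "\<dots> = B * (inverse (fact k) * (K * \<bar>t\<bar>) ^ k)" by (simp add: power_mult_distrib mult_ac)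
    finally show "norm (gen_act S G k f x / fact k * t ^ k) \<le> B * (inverse (fact k) * (K * \<bar>t\<bar>) ^ k)" .
  qed
qed

lemma semigroup_act_0: "finite S \<Longrightarrow> x \<in> S \<Longrightarrow> semigroup_act S G f x 0 = f x"
  unfolding semigroup_act_def powser_zero by (simp add: gen_act_0)

lemma DERIV_semigroup_act:
  assumes "finite S" "x \<in> S"
  shows "(semigroup_act S G f x has_real_derivative semigroup_act S G (\<lambda>z. \<Sum>y\<in>S. G z y * f y) x t) (at t)"
proof -
  define c where "c = (\<lambda>k. gen_act S G k f x / fact k)"
  have "((\<lambda>t. \<Sum>k. c k * t ^ k) has_real_derivative (\<Sum>k. diffs c k * t ^ k)) (at t)"
    using summable_gen_act[OF assms] by (intro termdiffs_strong_converges_everywhere) (simp add: c_def)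
  moreover have "diffs c k = gen_act S G k (\<lambda>z. \<Sum>y\<in>S. G z y * f y) x / fact k" for k
  proof -
    have "diffs c k = real (Suc k) * (gen_act S G (Suc k) f x / (real (Suc k) * fact k))"
      unfolding diffs_def c_def by simp
    also have "\<dots> = gen_act S G (Suc k) f x / fact k" by (simp del: of_nat_Suc)
    finally show ?thesis by (simp only: gen_act_Suc'[OF assms])
  qed
  ultimately show ?thesis by (simp add: semigroup_act_def[abs_def] c_def)
qed

lemma semigroup_act_eq_transition:
  assumes "finite S" "x \<in> S"
  shows "semigroup_act S (generator S Q) f x t = (\<Sum>y\<in>S. transition S Q t x y * f y)"
proof -
  let ?G = "generator S Q"
  have sm: "summable (\<lambda>k. t ^ k / fact k * gen_power S ?G k x y)" if "y \<in> S" for y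
  proof -
    have "gen_act S ?G k (\<lambda>z. of_bool (z = y)) x = gen_power S ?G k x y" for k
      using assms that by (simp add: gen_act_def of_bool_def if_distrib[of "\<lambda>u. _ * u"] sum.delta cong: if_cong)
    thus ?thesis using summable_gen_act[OF assms, of ?G "\<lambda>z. of_bool (z = y)" t] by (simp add: mult_ac)
  qed
  have "(\<Sum>y\<in>S. transition S Q t x y * f y) = (\<Sum>y\<in>S. \<Sum>k. t ^ k / fact k * gen_power S ?G k x y * f y)"
    unfolding transition_def by (intro sum.cong refl suminf_mult2 sm)
  also have "\<dots> = (\<Sum>k. \<Sum>y\<in>S. t ^ k / fact k * gen_power S ?G k x y * f y)"
    by (intro suminf_sum[symmetric] summable_mult2 sm)
  also have "\<dots> = semigroup_act S ?G f x t"
    unfolding semigroup_act_def gen_act_def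
    by (intro suminf_cong) (simp add: sum_distrib_left sum_divide_distrib mult_ac sum_distrib_right)
  finally show ?thesis ..
qed

lemma transition_closed_set:
  assumes "C \<subseteq> S" "\<And>x y. x \<in> C \<Longrightarrow> y \<in> S - C \<Longrightarrow> Q x y = 0" "x \<in> C" "y \<in> S - C"
  shows "transition S Q t x y = 0"
proof -
  have "gen_power S (generator S Q) k x y = 0" for k
    using assms(3)
  proof (induction k arbitrary: x)
    case 0
    thus ?case using assms(4) by auto
  next
    case (Suc k)
    have "generator S Q x z * gen_power S (generator S Q) k z y = 0" if "z \<in> S" for z
    proof (cases "z \<in> C")
      case False
      thus ?thesis using assms(2)[of x z] Suc.prems that by (auto simp: generator_def)
    qed (simp add: Suc.IH)
    thus ?case unfolding gen_power.simps by (intro sum.neutral ballI)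
  qed
  thus ?thesis by (simp add: transition_def)
qed

section \<open>Absorption time\<close>

text \<open>
  Since \<open>e' = -p \<le> - e / C\<close>, the function \<open>e t * exp (t / C)\<close> decreases.
\<close>
lemma exponential_decay_from_drift:
  fixes e p :: "real \<Rightarrow> real"
  assumes der: "\<And>t. (e has_real_derivative - p t) (at t)"
    and nn: "\<And>t. t \<ge> 0 \<Longrightarrow> 0 \<le> e t" and le: "\<And>t. t \<ge> 0 \<Longrightarrow> e t \<le> C * p t" and "C > 0"
  shows "(e \<longlongrightarrow> 0) at_top"
proof -
  have mono: "e t * exp (t / C) \<le> e 0 * exp (0 / C)" if "t \<ge> 0" for t
  proof (rule DERIV_nonpos_imp_nonincreasing[OF that])
    fix s :: real assume s: "0 \<le> s" "s \<le> t"
    have "((\<lambda>t. e t * exp (t / C)) has_real_derivative (- p s * exp (s / C) + exp (s / C) * (1 / C) * e s)) (at s)"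
      by (rule DERIV_mult[OF der]) (auto intro!: derivative_eq_intros simp: less_imp_neq[OF \<open>C > 0\<close>, symmetric])
    moreover have "- p s * exp (s / C) + exp (s / C) * (1 / C) * e s = exp (s / C) * (e s / C - p s)"
      by (simp add: algebra_simps)
    moreover have "e s / C - p s \<le> 0" using le[OF s(1)] \<open>C > 0\<close> by (simp add: field_simps)
    ultimately show "\<exists>y. ((\<lambda>t. e t * exp (t / C)) has_real_derivative y) (at s) \<and> y \<le> 0"
      by (metis exp_ge_zero mult_nonneg_nonpos)
  qed
  have "((\<lambda>t. e 0 * exp (- (t / C))) \<longlongrightarrow> e 0 * 0) at_top"
  proof (intro tendsto_mult_left filterlim_compose[OF exp_at_bot] filterlim_compose[OF filterlim_uminus_at_bot_at_top])
    have "filterlim (\<lambda>t. 1 / C * t) at_top at_top"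
      using \<open>C > 0\<close> by (intro filterlim_tendsto_pos_mult_at_top[OF tendsto_const _ filterlim_ident]) auto
    thus "filterlim (\<lambda>t. t / C) at_top at_top" by simp
  qed
  hence lim: "((\<lambda>t. e 0 * exp (- (t / C))) \<longlongrightarrow> 0) at_top" by simp
  have "eventually (\<lambda>t. norm (e t) \<le> e 0 * exp (- (t / C))) at_top"
    using eventually_ge_at_top[of 0]
  proof eventually_elim
    case (elim t)
    have "e t = e t * exp (t / C) * exp (- (t / C))" by (simp flip: exp_add add: mult.assoc)
    also have "\<dots> \<le> e 0 * exp (0 / C) * exp (- (t / C))" by (intro mult_right_mono mono elim) auto
    finally show ?case using nn[OF elim] by simp
  qed
  thus ?thesis by (rule Lim_null_comparison) (rule lim)
qed

lemma nn_integral_from_drift: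
  fixes e p :: "real \<Rightarrow> real"
  assumes der: "\<And>t. (e has_real_derivative - p t) (at t)" and cont: "continuous_on UNIV p"
    and pn: "\<And>t. t \<ge> 0 \<Longrightarrow> 0 \<le> p t"
    and nn: "\<And>t. t \<ge> 0 \<Longrightarrow> 0 \<le> e t" and le: "\<And>t. t \<ge> 0 \<Longrightarrow> e t \<le> C * p t" and "C > 0"
  shows "(\<integral>\<^sup>+t. ennreal (p t) * indicator {0..} t \<partial>lborel) = ennreal (e 0)"
proof -
  have "((\<lambda>t. - e t) \<longlongrightarrow> - 0) at_top"
    by (intro tendsto_minus exponential_decay_from_drift[OF der nn le \<open>C > 0\<close>])
  hence lim: "((\<lambda>t. - e t) \<longlongrightarrow> 0) at_top" by simp
  have "(\<integral>\<^sup>+t. ennreal (p t) * indicator {0..} t \<partial>lborel) = ennreal (0 - (- e 0))"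
  proof (rule nn_integral_FTC_atLeast)
    show "p \<in> borel_measurable borel" using cont by (rule borel_measurable_continuous_onI)
    show "((\<lambda>t. - e t) has_real_derivative p t) (at t)" if "0 \<le> t" for t
      using DERIV_minus[OF der[of t]] by simp
  qed (use pn lim in auto)
  thus ?thesis by simp
qed

text \<open>
  Both versions are needed, because the event that a label is not yet a singleton at time \<open>t\<close> lies between
  \<open>t < D\<close> and \<open>t \<le> D\<close> for the height \<open>D\<close>.
\<close>
lemma nn_integral_eq_tail:
  assumes "prob_space M" and D[measurable]: "D \<in> borel_measurable M"
  shows "(\<integral>\<^sup>+\<omega>. ennreal (D \<omega>) \<partial>M) = (\<integral>\<^sup>+t. emeasure M {\<omega>\<in>space M. t < D \<omega>} * indicator {0..} t \<partial>lborel)"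
    "(\<integral>\<^sup>+\<omega>. ennreal (D \<omega>) \<partial>M) = (\<integral>\<^sup>+t. emeasure M {\<omega>\<in>space M. t \<le> D \<omega>} * indicator {0..} t \<partial>lborel)"
proof -
  interpret prob_space M by fact
  interpret pair_sigma_finite M lborel ..
  have "(\<integral>\<^sup>+\<omega>. ennreal (D \<omega>) \<partial>M) = (\<integral>\<^sup>+\<omega>. (\<integral>\<^sup>+t. indicator {0..<D \<omega>} t \<partial>lborel) \<partial>M)"
    by (intro nn_integral_cong) (case_tac "0 \<le> D x"; simp add: ennreal_neg)
  also have "\<dots> = (\<integral>\<^sup>+\<omega>. (\<integral>\<^sup>+t. indicator {p\<in>space (M \<Otimes>\<^sub>M lborel). 0 \<le> snd p \<and> snd p < D (fst p)} (\<omega>, t) \<partial>lborel) \<partial>M)"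
    by (intro nn_integral_cong) (auto simp: indicator_def space_pair_measure)
  also have "\<dots> = (\<integral>\<^sup>+t. (\<integral>\<^sup>+\<omega>. indicator {p\<in>space (M \<Otimes>\<^sub>M lborel). 0 \<le> snd p \<and> snd p < D (fst p)} (\<omega>, t) \<partial>M) \<partial>lborel)"
    by (rule Fubini'[symmetric]) measurable
  also have "\<dots> = (\<integral>\<^sup>+t. (\<integral>\<^sup>+\<omega>. indicator {\<omega>\<in>space M. t < D \<omega>} \<omega> * indicator {0..} t \<partial>M) \<partial>lborel)"
    by (intro nn_integral_cong) (auto simp: indicator_def space_pair_measure)
  also have "\<dots> = (\<integral>\<^sup>+t. emeasure M {\<omega>\<in>space M. t < D \<omega>} * indicator {0..} t \<partial>lborel)"
    by (intro nn_integral_cong) (simp add: nn_integral_multc)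
  finally show "(\<integral>\<^sup>+\<omega>. ennreal (D \<omega>) \<partial>M) = (\<integral>\<^sup>+t. emeasure M {\<omega>\<in>space M. t < D \<omega>} * indicator {0..} t \<partial>lborel)" .
  have "(\<integral>\<^sup>+\<omega>. ennreal (D \<omega>) \<partial>M) = (\<integral>\<^sup>+\<omega>. (\<integral>\<^sup>+t. indicator {0..D \<omega>} t \<partial>lborel) \<partial>M)"
    by (intro nn_integral_cong) (simp add: emeasure_lborel_Icc_eq ennreal_neg)
  also have "\<dots> = (\<integral>\<^sup>+\<omega>. (\<integral>\<^sup>+t. indicator {p\<in>space (M \<Otimes>\<^sub>M lborel). 0 \<le> snd p \<and> snd p \<le> D (fst p)} (\<omega>, t) \<partial>lborel) \<partial>M)"
    by (intro nn_integral_cong) (auto simp: indicator_def space_pair_measure)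
  also have "\<dots> = (\<integral>\<^sup>+t. (\<integral>\<^sup>+\<omega>. indicator {p\<in>space (M \<Otimes>\<^sub>M lborel). 0 \<le> snd p \<and> snd p \<le> D (fst p)} (\<omega>, t) \<partial>M) \<partial>lborel)"
    by (rule Fubini'[symmetric]) measurable
  also have "\<dots> = (\<integral>\<^sup>+t. (\<integral>\<^sup>+\<omega>. indicator {\<omega>\<in>space M. t \<le> D \<omega>} \<omega> * indicator {0..} t \<partial>M) \<partial>lborel)"
    by (intro nn_integral_cong) (auto simp: indicator_def space_pair_measure)
  also have "\<dots> = (\<integral>\<^sup>+t. emeasure M {\<omega>\<in>space M. t \<le> D \<omega>} * indicator {0..} t \<partial>lborel)"
    by (intro nn_integral_cong) (simp add: nn_integral_multc)
  finally show "(\<integral>\<^sup>+\<omega>. ennreal (D \<omega>) \<partial>M) = (\<integral>\<^sup>+t. emeasure M {\<omega>\<in>space M. t \<le> D \<omega>} * indicator {0..} t \<partial>lborel)" .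
qed

section \<open>Waiting time until a label is a singleton\<close>

lemma semigroup_act_cong:
  assumes "\<And>y. y \<in> S \<Longrightarrow> f y = g y"
  shows "semigroup_act S G f x = semigroup_act S G g x"
  unfolding semigroup_act_def gen_act_def using assms by (intro ext suminf_cong) (simp cong: sum.cong)

lemma semigroup_act_minus: "finite S \<Longrightarrow> x \<in> S \<Longrightarrow> semigroup_act S (generator S Q) (\<lambda>y. - f y) x t = - semigroup_act S (generator S Q) f x t"
  by (simp add: semigroup_act_eq_transition sum_negf)

lemma markov_chain_marginal:
  assumes "markov_chain M S Q x0 X" "x0 \<in> S" "y \<in> S" "t \<ge> 0"
  shows "measure M {\<omega>\<in>space M. X t \<omega> = y} = transition S Q t x0 y"
proof -
  interpret prob_space M using assms by (simp add: markov_chain_def)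
  have X0: "\<forall>\<omega>\<in>space M. X 0 \<omega> = x0" using assms by (simp add: markov_chain_def)
  have fdd: "\<forall>k (t :: nat \<Rightarrow> real) x.
        0 \<le> t 0 \<and> (\<forall>i<k. t i \<le> t (Suc i)) \<and> (\<forall>i\<le>k. x i \<in> S) \<longrightarrow>
        measure M {\<omega>\<in>space M. \<forall>i\<le>k. X (t i) \<omega> = x i} =
          measure M {\<omega>\<in>space M. X (t 0) \<omega> = x 0} *
          (\<Prod>i<k. transition S Q (t (Suc i) - t i) (x i) (x (Suc i)))"
    using assms(1) unfolding markov_chain_def by blast
  define tt where "tt = (\<lambda>i::nat. if i = 0 then 0 else t)"
  define xx where "xx = (\<lambda>i::nat. if i = 0 then x0 else y)"
  have "measure M {\<omega>\<in>space M. \<forall>i\<le>1. X (tt i) \<omega> = xx i} =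
          measure M {\<omega>\<in>space M. X (tt 0) \<omega> = xx 0} * (\<Prod>i<1. transition S Q (tt (Suc i) - tt i) (xx i) (xx (Suc i)))"
    using assms by (intro fdd[rule_format]) (auto simp: tt_def xx_def)
  moreover have "{\<omega>\<in>space M. \<forall>i\<le>1. X (tt i) \<omega> = xx i} = {\<omega>\<in>space M. X t \<omega> = y}"
    using X0 by (auto simp: tt_def xx_def le_Suc_eq)
  moreover have "{\<omega>\<in>space M. X (tt 0) \<omega> = xx 0} = space M" using X0 by (auto simp: tt_def xx_def)
  ultimately show ?thesis by (simp add: tt_def xx_def prob_space)
qed

lemma markov_chain_two_times:
  assumes "markov_chain M S Q x0 X" "x \<in> S" "y \<in> S" "0 \<le> s" "s \<le> t"
  shows "measure M {\<omega>\<in>space M. X s \<omega> = x \<and> X t \<omega> = y} = measure M {\<omega>\<in>space M. X s \<omega> = x} * transition S Q (t - s) x y"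
proof -
  have fdd: "\<forall>k (t :: nat \<Rightarrow> real) x.
        0 \<le> t 0 \<and> (\<forall>i<k. t i \<le> t (Suc i)) \<and> (\<forall>i\<le>k. x i \<in> S) \<longrightarrow>
        measure M {\<omega>\<in>space M. \<forall>i\<le>k. X (t i) \<omega> = x i} =
          measure M {\<omega>\<in>space M. X (t 0) \<omega> = x 0} *
          (\<Prod>i<k. transition S Q (t (Suc i) - t i) (x i) (x (Suc i)))"
    using assms(1) unfolding markov_chain_def by blast
  define tt where "tt = (\<lambda>i::nat. if i = 0 then s else t)"
  define xx where "xx = (\<lambda>i::nat. if i = 0 then x else y)"
  have "measure M {\<omega>\<in>space M. \<forall>i\<le>1. X (tt i) \<omega> = xx i} =
          measure M {\<omega>\<in>space M. X (tt 0) \<omega> = xx 0} * (\<Prod>i<1. transition S Q (tt (Suc i) - tt i) (xx i) (xx (Suc i)))"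
    using assms by (intro fdd[rule_format]) (auto simp: tt_def xx_def)
  moreover have "{\<omega>\<in>space M. \<forall>i\<le>1. X (tt i) \<omega> = xx i} = {\<omega>\<in>space M. X s \<omega> = x \<and> X t \<omega> = y}"
    by (auto simp: tt_def xx_def le_Suc_eq)
  ultimately show ?thesis by (simp add: tt_def xx_def)
qed

context
  fixes \<beta> :: real
  assumes beta_pos: "\<beta> > 0"
begin

abbreviation "waiting n j t \<equiv>
  semigroup_act (partitions n) (generator (partitions n) (jump_rate \<beta>)) (\<lambda>\<pi>. of_bool ({j} \<notin> \<pi>)) {{1..n}} t"

lemma trivial_partition: "n \<ge> 1 \<Longrightarrow> {{1..n}} \<in> partitions n"
  by (auto simp: partitions_def partition_on_def)

text \<open>
  The expectation \<open>e t\<close> of \<open>total_height\<close> at time \<open>t\<close> satisfies \<open>e' = - waiting\<close> by \<open>generator_total_height\<close>. On the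
  finitely many partitions the total height is bounded by a multiple of the indicator that \<open>{j}\<close> is not a block,
  hence \<open>e \<le> C * waiting\<close>, \<open>e\<close> tends to zero, and the integral of \<open>waiting\<close> is \<open>e 0\<close>.
\<close>
lemma nn_integral_waiting:
  assumes n: "n \<ge> 2" and mc: "markov_chain M (partitions n) (jump_rate \<beta>) {{1..n}} X" and j: "j \<in> {1..n}"
  shows "(\<integral>\<^sup>+t. ennreal (waiting n j t) * indicator {0..} t \<partial>lborel) = ennreal (mean_height \<beta> (n - 1))"
    "continuous_on UNIV (waiting n j)" "\<And>t. t \<ge> 0 \<Longrightarrow> waiting n j t \<ge> 0"
    "\<And>t. t \<ge> 0 \<Longrightarrow> measure M {\<omega>\<in>space M. {j} \<notin> X t \<omega>} = waiting n j t"
proof -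
  let ?S = "partitions n" and ?Q = "jump_rate \<beta>" and ?x = "{{1..n}}"
  let ?G = "generator ?S ?Q" and ?f = "total_height \<beta> j"
  interpret prob_space M using mc by (simp add: markov_chain_def)
  have S: "finite ?S" "?x \<in> ?S" using finite_partitions[OF beta_pos] trivial_partition n by auto
  have X: "X t \<in> measurable M (count_space ?S)" if "t \<ge> 0" for t using mc that by (simp add: markov_chain_def)
  have tr: "transition ?S ?Q t ?x y \<ge> 0" if "t \<ge> 0" "y \<in> ?S" for t y
    using markov_chain_marginal[OF mc S(2) that(2,1)] measure_nonneg[of M] by metis
  have p: "waiting n j t = (\<Sum>y\<in>?S. transition ?S ?Q t ?x y * of_bool ({j} \<notin> y))" for t
    by (rule semigroup_act_eq_transition[OF S])
  have e: "semigroup_act ?S ?G ?f ?x t = (\<Sum>y\<in>?S. transition ?S ?Q t ?x y * ?f y)" for t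
    by (rule semigroup_act_eq_transition[OF S])
  show pn: "waiting n j t \<ge> 0" if "t \<ge> 0" for t unfolding p using tr[OF that] by (intro sum_nonneg) auto
  show cont: "continuous_on UNIV (waiting n j)"
    using DERIV_semigroup_act[OF S] by (intro continuous_at_imp_continuous_on ballI DERIV_isCont) blast
  have drift: "semigroup_act ?S ?G (\<lambda>z. \<Sum>y\<in>?S. ?G z y * ?f y) ?x t = - waiting n j t" for t
  proof -
    have "semigroup_act ?S ?G (\<lambda>z. \<Sum>y\<in>?S. ?G z y * ?f y) ?x = semigroup_act ?S ?G (\<lambda>z. - of_bool ({j} \<notin> z)) ?x"
      by (rule semigroup_act_cong) (rule generator_total_height[OF beta_pos _ j])
    thus ?thesis using semigroup_act_minus[OF S] by simp
  qed
  \<comment> \<open>the summand \<open>1\<close> only makes \<open>C\<close> positive\<close>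
  define C where "C = 1 + (\<Sum>y\<in>?S. ?f y)"
  have fn: "?f y \<ge> 0" for y by (rule total_height_nonneg[OF beta_pos])
  have C: "?f y \<le> C * of_bool ({j} \<notin> y)" if "y \<in> ?S" for y
  proof (cases "{j} \<in> y")
    case True thus ?thesis using total_height_singleton[OF beta_pos that] by simp
  next
    case False
    have "?f y \<le> (\<Sum>y\<in>?S. ?f y)" using S that fn by (intro member_le_sum) auto
    thus ?thesis using False by (simp add: C_def)
  qed
  have C0: "C > 0" unfolding C_def using fn by (intro add_pos_nonneg sum_nonneg) auto
  have "(\<integral>\<^sup>+t. ennreal (waiting n j t) * indicator {0..} t \<partial>lborel) = ennreal (semigroup_act ?S ?G ?f ?x 0)"
  proof (rule nn_integral_from_drift[OF _ cont pn _ _ C0])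
    show "(semigroup_act ?S ?G ?f ?x has_real_derivative - waiting n j t) (at t)" for t
      using DERIV_semigroup_act[OF S, of ?G ?f t] by (simp only: drift)
    fix t :: real assume t: "t \<ge> 0"
    show "0 \<le> semigroup_act ?S ?G ?f ?x t" unfolding e using tr[OF t] fn by (intro sum_nonneg) auto
    have "semigroup_act ?S ?G ?f ?x t \<le> (\<Sum>y\<in>?S. transition ?S ?Q t ?x y * (C * of_bool ({j} \<notin> y)))"
      unfolding e using tr[OF t] C by (intro sum_mono mult_left_mono) auto
    also have "\<dots> = C * waiting n j t" unfolding p sum_distrib_left by (intro sum.cong) auto
    finally show "semigroup_act ?S ?G ?f ?x t \<le> C * waiting n j t" .
  qed
  also have "semigroup_act ?S ?G ?f ?x 0 = ?f ?x" by (rule semigroup_act_0[OF S])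
  also have "\<dots> = mean_height \<beta> (n - 1)"
    using j by (simp add: total_height_def[OF beta_pos] label_height_def[OF beta_pos])
  finally show "(\<integral>\<^sup>+t. ennreal (waiting n j t) * indicator {0..} t \<partial>lborel) = ennreal (mean_height \<beta> (n - 1))" .
  fix t :: real assume t: "t \<ge> 0"
  have XS: "X t \<omega> \<in> ?S" if "\<omega> \<in> space M" for \<omega> using measurable_space[OF X[OF t] that] by simp
  have "{\<omega>\<in>space M. {j} \<notin> X t \<omega>} = (\<Union>y\<in>{y\<in>?S. {j} \<notin> y}. {\<omega>\<in>space M. X t \<omega> = y})" using XS by auto
  hence "measure M {\<omega>\<in>space M. {j} \<notin> X t \<omega>} = (\<Sum>y\<in>{y\<in>?S. {j} \<notin> y}. measure M {\<omega>\<in>space M. X t \<omega> = y})"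
  proof (simp only:, intro finite_measure_finite_Union)
    have ev: "{\<omega>\<in>space M. X t \<omega> = y} \<in> sets M" if "y \<in> ?S" for y
    proof -
      have "X t -` {y} \<inter> space M \<in> sets M" using that by (intro measurable_sets[OF X[OF t]]) auto
      moreover have "X t -` {y} \<inter> space M = {\<omega>\<in>space M. X t \<omega> = y}" by auto
      ultimately show ?thesis by simp
    qed
    thus "(\<lambda>y. {\<omega>\<in>space M. X t \<omega> = y}) ` {y\<in>?S. {j} \<notin> y} \<subseteq> sets M" by auto
  qed (use S in \<open>auto simp: disjoint_family_on_def\<close>)
  also have "\<dots> = (\<Sum>y\<in>{y\<in>?S. {j} \<notin> y}. transition ?S ?Q t ?x y)"
    using markov_chain_marginal[OF mc S(2) _ t] by (intro sum.cong) auto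
  also have "\<dots> = waiting n j t" unfolding p
    using S by (simp add: sum.inter_filter[symmetric] of_bool_def if_distrib cong: if_cong)
  finally show "measure M {\<omega>\<in>space M. {j} \<notin> X t \<omega>} = waiting n j t" .
qed

text \<open>
  Only blocks of size at least two are split, so the partitions that have \<open>{j}\<close> as a block form a closed set of
  states.
\<close>
lemma singleton_stays:
  assumes n: "n \<ge> 2" and mc: "markov_chain M (partitions n) (jump_rate \<beta>) {{1..n}} X" and st: "0 \<le> s" "s \<le> t"
  shows "measure M {\<omega>\<in>space M. {j} \<in> X s \<omega> \<and> {j} \<notin> X t \<omega>} = 0"
proof -
  let ?S = "partitions n" and ?Q = "jump_rate \<beta>"
  interpret prob_space M using mc by (simp add: markov_chain_def)
  have fin: "finite ?S" by (rule finite_partitions[OF beta_pos])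
  have X: "X t \<in> measurable M (count_space ?S)" if "t \<ge> 0" for t using mc that by (simp add: markov_chain_def)
  have ev: "{\<omega>\<in>space M. X t \<omega> = y} \<in> sets M" if "y \<in> ?S" "t \<ge> 0" for y t
  proof -
    have "X t -` {y} \<inter> space M \<in> sets M" using that by (intro measurable_sets[OF X]) auto
    moreover have "X t -` {y} \<inter> space M = {\<omega>\<in>space M. X t \<omega> = y}" by auto
    ultimately show ?thesis by simp
  qed
  have Q0: "?Q x y = 0" if "{j} \<in> x" "{j} \<notin> y" for x y
  proof -
    have "{s \<in> splits x. split_at x s = y} = {}"
    proof (rule ccontr)
      assume "{s \<in> splits x. split_at x s = y} \<noteq> {}"
      then obtain b c where "(b, c) \<in> splits x" "split_at x (b, c) = y" by auto
      hence "2 \<le> card b" "y = (x - {b}) \<union> {c, b - c}" by (auto simp: splits_def[OF beta_pos] split_at_def[OF beta_pos])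
      moreover have "{j} \<noteq> b" using \<open>2 \<le> card b\<close> by auto
      ultimately show False using that by auto
    qed
    thus ?thesis by (simp only: jump_rate_eq[OF beta_pos] sum.empty)
  qed
  have pair0: "measure M {\<omega>\<in>space M. X s \<omega> = x \<and> X t \<omega> = y} = 0"
    if "x \<in> {x\<in>?S. {j} \<in> x}" "y \<in> ?S - {x\<in>?S. {j} \<in> x}" for x y
  proof -
    have "transition ?S ?Q (t - s) x y = 0"
      by (rule transition_closed_set[OF _ _ that]) (auto intro: Q0)
    thus ?thesis using markov_chain_two_times[OF mc _ _ st, of x y] that by simp
  qed
  have "X t \<omega> \<in> ?S" "X s \<omega> \<in> ?S" if "\<omega> \<in> space M" for \<omega>
    using measurable_space[OF X that] st by auto
  hence "{\<omega>\<in>space M. {j} \<in> X s \<omega> \<and> {j} \<notin> X t \<omega>} =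
     (\<Union>p\<in>{x\<in>?S. {j} \<in> x} \<times> (?S - {x\<in>?S. {j} \<in> x}). {\<omega>\<in>space M. X s \<omega> = fst p \<and> X t \<omega> = snd p})" by auto
  moreover have "measure M (\<Union>p\<in>{x\<in>?S. {j} \<in> x} \<times> (?S - {x\<in>?S. {j} \<in> x}). {\<omega>\<in>space M. X s \<omega> = fst p \<and> X t \<omega> = snd p})
     \<le> (\<Sum>p\<in>{x\<in>?S. {j} \<in> x} \<times> (?S - {x\<in>?S. {j} \<in> x}). measure M {\<omega>\<in>space M. X s \<omega> = fst p \<and> X t \<omega> = snd p})"
  proof (intro finite_measure_subadditive_finite)
    show "(\<lambda>p. {\<omega>\<in>space M. X s \<omega> = fst p \<and> X t \<omega> = snd p}) ` ({x\<in>?S. {j} \<in> x} \<times> (?S - {x\<in>?S. {j} \<in> x})) \<subseteq> sets M"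
    proof (rule image_subsetI)
      fix p assume "p \<in> {x\<in>?S. {j} \<in> x} \<times> (?S - {x\<in>?S. {j} \<in> x})"
      hence "{\<omega>\<in>space M. X s \<omega> = fst p} \<inter> {\<omega>\<in>space M. X t \<omega> = snd p} \<in> sets M" using st by (intro sets.Int ev) auto
      moreover have "{\<omega>\<in>space M. X s \<omega> = fst p} \<inter> {\<omega>\<in>space M. X t \<omega> = snd p} = {\<omega>\<in>space M. X s \<omega> = fst p \<and> X t \<omega> = snd p}" by auto
      ultimately show "{\<omega>\<in>space M. X s \<omega> = fst p \<and> X t \<omega> = snd p} \<in> sets M" by simp
    qed
  qed (use fin in auto)
  moreover have "\<dots> = 0" by (intro sum.neutral) (use pair0 in auto)
  ultimately show ?thesis using measure_nonneg[of M] by (simp add: order_antisym)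
qed

end

section \<open>The height of a uniformly chosen leaf\<close>

context
  fixes \<beta> :: real
  assumes beta_pos: "\<beta> > 0"
begin

text \<open>
  The height is, up to null sets, characterised by \<open>{t < D} \<subseteq> {J not a singleton at t} \<subseteq> {t \<le> D}\<close>, so its mean is the
  integral over \<open>t\<close> of the probability of the middle event. By independence of \<open>J\<close> that is the average of
  \<open>waiting n j t\<close> over the labels \<open>j\<close>, and each of these has integral \<open>mean_height (n - 1)\<close>. The first inclusion holds by
  definition of an infimum; the second needs that singletons persist, which is known almost surely along rational
  times and extends to all times by right continuity.
\<close>
lemma leaf_height_integral:
  assumes n: "n \<ge> 2" and chain: "beta_splitting_chain \<beta> n M X" and leaf: "uniform_leaf n M X J"
  shows "has_bochner_integral M (leaf_height X J) (mean_height \<beta> (n - 1))"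
proof -
  let ?S = "partitions n"
  have mc: "markov_chain M ?S (jump_rate \<beta>) {{1..n}} X" using chain by (simp add: beta_splitting_chain_def)
  interpret prob_space M using mc by (simp add: markov_chain_def)
  have X: "X t \<in> measurable M (count_space ?S)" if "t \<ge> 0" for t using mc that by (simp add: markov_chain_def)
  have rc: "\<forall>\<^sub>F s in at_right t. X s \<omega> = X t \<omega>" if "\<omega> \<in> space M" "t \<ge> 0" for t \<omega>
    using mc that by (simp add: markov_chain_def)
  have J: "J \<in> measurable M (count_space UNIV)" using leaf by (simp add: uniform_leaf_def)
  have XS: "X t \<omega> \<in> ?S" if "\<omega> \<in> space M" "t \<ge> 0" for \<omega> t using measurable_space[OF X that(1)] that by simp
  have evJ: "{\<omega>\<in>space M. J \<omega> = j} \<in> sets M" for j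
  proof -
    have "J -` {j} \<inter> space M \<in> sets M" by (intro measurable_sets[OF J]) auto
    moreover have "J -` {j} \<inter> space M = {\<omega>\<in>space M. J \<omega> = j}" by auto
    ultimately show ?thesis by simp
  qed
  have evX: "{\<omega>\<in>space M. {j} \<in> X t \<omega>} \<in> sets M" if "t \<ge> 0" for j t
  proof -
    have "X t -` {y\<in>?S. {j} \<in> y} \<inter> space M \<in> sets M" using that by (intro measurable_sets[OF X]) auto
    moreover have "X t -` {y\<in>?S. {j} \<in> y} \<inter> space M = {\<omega>\<in>space M. {j} \<in> X t \<omega>}" using XS that by auto
    ultimately show ?thesis by simp
  qed
  have evX': "{\<omega>\<in>space M. {j} \<notin> X t \<omega>} \<in> sets M" if "t \<ge> 0" for j t
  proof -
    have "space M - {\<omega>\<in>space M. {j} \<in> X t \<omega>} \<in> sets M" using evX[OF that] by (rule sets.compl_sets)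
    moreover have "space M - {\<omega>\<in>space M. {j} \<in> X t \<omega>} = {\<omega>\<in>space M. {j} \<notin> X t \<omega>}" by auto
    ultimately show ?thesis by simp
  qed
  define E where "E = (\<lambda>t. {\<omega>\<in>space M. {J \<omega>} \<in> X t \<omega>})"
  have E: "E t \<in> sets M" if "t \<ge> 0" for t
  proof -
    have "(\<Union>j. {\<omega>\<in>space M. J \<omega> = j} \<inter> {\<omega>\<in>space M. {j} \<in> X t \<omega>}) \<in> sets M"
      using evJ evX[OF that] by (intro sets.countable_UN) auto
    moreover have "(\<Union>j. {\<omega>\<in>space M. J \<omega> = j} \<inter> {\<omega>\<in>space M. {j} \<in> X t \<omega>}) = E t" by (auto simp: E_def)
    ultimately show ?thesis by simp
  qed
  define A where "A = (\<lambda>\<omega>. {t. 0 \<le> t \<and> {J \<omega>} \<in> X t \<omega>})"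
  have D: "leaf_height X J \<omega> = Inf (A \<omega>)" for \<omega> by (simp add: leaf_height_def A_def)
  have AE_iff: "t \<in> A \<omega> \<longleftrightarrow> \<omega> \<in> E t" if "\<omega> \<in> space M" "t \<ge> 0" for \<omega> t using that by (auto simp: A_def E_def)
  have A_nonneg: "t \<ge> 0" if "t \<in> A \<omega>" for t \<omega> using that by (simp add: A_def)
  have bdd: "bdd_below (A \<omega>)" for \<omega> by (rule bdd_belowI[of _ 0]) (rule A_nonneg)

  \<comment> \<open>paths are step functions, so a state is kept for a while and seen at a rational time\<close>
  have rational_near: "\<exists>q\<in>\<rat>. t < q \<and> q < u \<and> (\<omega> \<in> E q \<longleftrightarrow> \<omega> \<in> E t)"
    if w: "\<omega> \<in> space M" and t: "t \<ge> 0" "t < u" for \<omega> t u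
  proof -
    obtain b where b: "b > t" "\<forall>y>t. y < b \<longrightarrow> X y \<omega> = X t \<omega>"
      using rc[OF w t(1)] by (auto simp: eventually_at_right_field)
    have "t < min b u" using b(1) t(2) by simp
    then obtain q where q: "q \<in> \<rat>" "t < q" "q < min b u" using Rats_dense_in_real by blast
    hence "X q \<omega> = X t \<omega>" using b(2) by auto
    hence "\<omega> \<in> E q \<longleftrightarrow> \<omega> \<in> E t" using w by (simp add: E_def)
    with q show ?thesis by auto
  qed
  define R where "R = {q::real. q \<in> \<rat> \<and> q \<ge> 0}"
  have R: "countable R" unfolding R_def by (rule countable_subset[OF _ countable_rat]) auto
  have A_rational: "\<exists>q\<in>R. q < a \<and> q \<in> A \<omega>" if w: "\<omega> \<in> space M" and t: "t \<in> A \<omega>" "t < a" for \<omega> t a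
  proof -
    have t0: "t \<ge> 0" using t(1) by (rule A_nonneg)
    obtain q where q: "q \<in> \<rat>" "t < q" "q < a" "\<omega> \<in> E q \<longleftrightarrow> \<omega> \<in> E t"
      using rational_near[OF w t0 t(2)] by blast
    have "q \<in> A \<omega>" using q t AE_iff[OF w t0] AE_iff[OF w, of q] t0 by simp
    thus ?thesis using q t0 by (intro bexI[of _ q]) (auto simp: R_def)
  qed

  \<comment> \<open>where the label never becomes a singleton, the height has the default value \<open>Inf {}\<close>\<close>
  have D_meas: "leaf_height X J \<in> borel_measurable M"
  proof (subst borel_measurable_iff_less, intro allI)
    fix a :: real
    let ?U = "\<Union>q\<in>R \<inter> {..<a}. E q" and ?V = "space M - (\<Union>q\<in>R. E q)"
    have UV: "?U \<in> sets M" "?V \<in> sets M"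
      using R E by (auto intro!: sets.countable_UN'' countable_Int1 sets.compl_sets simp: R_def)
    have "{\<omega>\<in>space M. leaf_height X J \<omega> < a} = ?U \<union> (if Inf {} < a then ?V else {})"
    proof (intro equalityI subsetI)
      fix \<omega> assume w: "\<omega> \<in> {\<omega>\<in>space M. leaf_height X J \<omega> < a}"
      show "\<omega> \<in> ?U \<union> (if Inf {} < a then ?V else {})"
      proof (cases "A \<omega> = {}")
        case True
        hence "\<omega> \<notin> E q" if "q \<in> R" for q using AE_iff[of \<omega> q] w that by (auto simp: R_def)
        thus ?thesis using w True by (auto simp: D)
      next
        case False
        have "Inf (A \<omega>) < a" using w by (simp add: D)
        then obtain t where "t \<in> A \<omega>" "t < a" using cInf_less_iff[OF False bdd] by blast
        then obtain q where "q \<in> R" "q < a" "q \<in> A \<omega>" using A_rational w by blast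
        thus ?thesis using AE_iff[of \<omega> q] w by (auto simp: R_def)
      qed
    next
      fix \<omega> assume w: "\<omega> \<in> ?U \<union> (if Inf {} < a then ?V else {})"
      hence sp: "\<omega> \<in> space M" by (auto simp: E_def split: if_splits)
      show "\<omega> \<in> {\<omega>\<in>space M. leaf_height X J \<omega> < a}"
      proof (cases "\<omega> \<in> ?U")
        case True
        then obtain q where q: "q \<in> R" "q < a" "\<omega> \<in> E q" by auto
        hence "q \<in> A \<omega>" using AE_iff[OF sp] by (auto simp: R_def)
        hence "Inf (A \<omega>) \<le> q" by (intro cInf_lower bdd)
        thus ?thesis using sp q(2) by (simp add: D)
      next
        case False
        hence V: "Inf {} < a" "\<omega> \<in> ?V" using w by (auto split: if_splits)
        have "A \<omega> = {}"
        proof (rule ccontr)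
          assume "A \<omega> \<noteq> {}"
          then obtain t where "t \<in> A \<omega>" by blast
          then obtain q where "q \<in> R" "q \<in> A \<omega>" using A_rational[OF sp, of t "t + 1"] by auto
          thus False using V(2) AE_iff[OF sp, of q] by (auto simp: R_def)
        qed
        thus ?thesis using sp V(1) by (simp add: D)
      qed
    qed
    thus "{\<omega>\<in>space M. leaf_height X J \<omega> < a} \<in> sets M" using UV by simp
  qed

  have mono: "AE \<omega> in M. \<forall>q\<in>R. \<forall>r\<in>R. q \<le> r \<longrightarrow> \<omega> \<in> E q \<longrightarrow> \<omega> \<in> E r"
  proof (intro AE_ball_countable[OF R, THEN iffD2] ballI)
    fix q r assume qr: "q \<in> R" "r \<in> R"
    show "AE \<omega> in M. q \<le> r \<longrightarrow> \<omega> \<in> E q \<longrightarrow> \<omega> \<in> E r"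
    proof (cases "q \<le> r")
      case True
      have "AE \<omega> in M. \<forall>j. \<not> ({j} \<in> X q \<omega> \<and> {j} \<notin> X r \<omega>)"
      proof (intro AE_all_countable[THEN iffD2] allI)
        fix j
        have "{\<omega>\<in>space M. {j} \<in> X q \<omega>} \<inter> {\<omega>\<in>space M. {j} \<notin> X r \<omega>} \<in> sets M"
          using qr by (intro sets.Int evX evX') (auto simp: R_def)
        moreover have "{\<omega>\<in>space M. {j} \<in> X q \<omega>} \<inter> {\<omega>\<in>space M. {j} \<notin> X r \<omega>} = {\<omega>\<in>space M. {j} \<in> X q \<omega> \<and> {j} \<notin> X r \<omega>}"
          by auto
        ultimately have "{\<omega>\<in>space M. {j} \<in> X q \<omega> \<and> {j} \<notin> X r \<omega>} \<in> sets M" by simp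
        thus "AE \<omega> in M. \<not> ({j} \<in> X q \<omega> \<and> {j} \<notin> X r \<omega>)"
          using singleton_stays[OF beta_pos n mc _ True] qr by (subst prob_Collect_eq_0[symmetric]) (auto simp: R_def)
      qed
      thus ?thesis by (rule AE_mp) (auto intro!: AE_I2 simp: E_def)
    qed auto
  qed

  define N where "N = (\<lambda>t. space M - E t)"
  have N: "N t \<in> sets M" if "t \<ge> 0" for t unfolding N_def using E[OF that] by (rule sets.compl_sets)
  have Jdist: "measure M (J -` B \<inter> space M) = measure (measure_pmf (pmf_of_set {1..n})) B" for B
  proof -
    have "measure (distr M (count_space UNIV) J) B = measure M (J -` B \<inter> space M)"
      by (rule measure_distr[OF J]) auto
    thus ?thesis using leaf by (simp add: uniform_leaf_def)
  qed
  have J_range: "AE \<omega> in M. J \<omega> \<in> {1..n}"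
  proof -
    have "measure M (J -` (- {1..n}) \<inter> space M) = 0"
      using n by (simp add: Jdist measure_pmf_of_set)
    moreover have "J -` (- {1..n}) \<inter> space M = {\<omega>\<in>space M. J \<omega> \<notin> {1..n}}" by auto
    moreover have "J -` (- {1..n}) \<inter> space M \<in> sets M" by (rule measurable_sets[OF J]) auto
    ultimately have "AE \<omega> in M. \<not> (J \<omega> \<notin> {1..n})" by (subst prob_Collect_eq_0[symmetric]) auto
    thus ?thesis by simp
  qed
  have J_prob: "measure M {\<omega>\<in>space M. J \<omega> = j} = 1 / real n" if "j \<in> {1..n}" for j
  proof -
    have "J -` {j} \<inter> space M = {\<omega>\<in>space M. J \<omega> = j}" by auto
    moreover have "measure (measure_pmf (pmf_of_set {1..n})) {j} = 1 / real n"
      using that n by (simp add: measure_pmf_single)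
    ultimately show ?thesis using Jdist[of "{j}"] by simp
  qed
  have indep: "measure M ({\<omega>\<in>space M. J \<omega> = j} \<inter> {\<omega>\<in>space M. {j} \<notin> X t \<omega>})
      = measure M {\<omega>\<in>space M. J \<omega> = j} * measure M {\<omega>\<in>space M. {j} \<notin> X t \<omega>}" if t: "t \<ge> 0" for j t
  proof -
    let ?Y = "\<lambda>\<omega>. \<lambda>t\<in>{0..}. X t \<omega>" and ?P = "Pi\<^sub>M {0..} (\<lambda>_. count_space ?S)"
    have ind: "indep_set (sets (vimage_algebra (space M) J (count_space UNIV))) (sets (vimage_algebra (space M) ?Y ?P))"
      using leaf by (simp add: uniform_leaf_def)
    have a: "{\<omega>\<in>space M. J \<omega> = j} \<in> sets (vimage_algebra (space M) J (count_space UNIV))"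
    proof -
      have "J -` {j} \<inter> space M \<in> sets (vimage_algebra (space M) J (count_space UNIV))"
        by (rule in_vimage_algebra) auto
      moreover have "J -` {j} \<inter> space M = {\<omega>\<in>space M. J \<omega> = j}" by auto
      ultimately show ?thesis by simp
    qed
    have b: "{\<omega>\<in>space M. {j} \<notin> X t \<omega>} \<in> sets (vimage_algebra (space M) ?Y ?P)"
    proof -
      have "(\<lambda>g. g t) \<in> measurable ?P (count_space ?S)" using t by (intro measurable_component_singleton) auto
      hence "(\<lambda>g. g t) -` {y\<in>?S. {j} \<notin> y} \<inter> space ?P \<in> sets ?P" by (rule measurable_sets) auto
      hence "?Y -` ((\<lambda>g. g t) -` {y\<in>?S. {j} \<notin> y} \<inter> space ?P) \<inter> space M \<in> sets (vimage_algebra (space M) ?Y ?P)"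
        by (rule in_vimage_algebra)
      moreover have "?Y -` ((\<lambda>g. g t) -` {y\<in>?S. {j} \<notin> y} \<inter> space ?P) \<inter> space M = {\<omega>\<in>space M. {j} \<notin> X t \<omega>}"
        using t XS by (auto simp: space_PiM)
      ultimately show ?thesis by simp
    qed
    show ?thesis using indep_setD[OF ind a b] .
  qed
  have emN: "emeasure M (N t) = (\<Sum>j\<in>{1..n}. ennreal (1 / real n) * ennreal (waiting \<beta> n j t))" if t: "t \<ge> 0" for t
  proof -
    let ?B = "\<lambda>j. {\<omega>\<in>space M. J \<omega> = j} \<inter> {\<omega>\<in>space M. {j} \<notin> X t \<omega>}"
    have B: "?B j \<in> sets M" for j using evJ evX'[OF t] by (rule sets.Int)
    have "emeasure M (N t) = emeasure M (\<Union>j\<in>{1..n}. ?B j)"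
    proof (rule emeasure_eq_AE)
      show "AE \<omega> in M. \<omega> \<in> N t \<longleftrightarrow> \<omega> \<in> (\<Union>j\<in>{1..n}. ?B j)"
        using J_range AE_space by eventually_elim (auto simp: N_def E_def)
    qed (use B N[OF t] in auto)
    also have "\<dots> = (\<Sum>j\<in>{1..n}. emeasure M (?B j))"
      using B by (intro sum_emeasure[symmetric]) (auto simp: disjoint_family_on_def)
    also have "\<dots> = (\<Sum>j\<in>{1..n}. ennreal (1 / real n) * ennreal (waiting \<beta> n j t))"
    proof (intro sum.cong refl)
      fix j assume j: "j \<in> {1..n}"
      have "emeasure M (?B j) = ennreal (1 / real n * waiting \<beta> n j t)"
        unfolding emeasure_eq_measure indep[OF t] J_prob[OF j] nn_integral_waiting(4)[OF beta_pos n mc j t] ..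
      also have "\<dots> = ennreal (1 / real n) * ennreal (waiting \<beta> n j t)"
        using nn_integral_waiting(3)[OF beta_pos n mc j t] by (intro ennreal_mult) auto
      finally show "emeasure M (?B j) = ennreal (1 / real n) * ennreal (waiting \<beta> n j t)" .
    qed
    finally show ?thesis .
  qed
  let ?H = "mean_height \<beta> (n - 1)"
  have intN: "(\<integral>\<^sup>+t. emeasure M (N t) * indicator {0..} t \<partial>lborel) = ennreal ?H"
  proof -
    have meas: "(\<lambda>t. ennreal (waiting \<beta> n j t) * indicator {0..} t) \<in> borel_measurable lborel" if "j \<in> {1..n}" for j
    proof -
      have "waiting \<beta> n j \<in> borel_measurable borel"
        using nn_integral_waiting(2)[OF beta_pos n mc that] by (rule borel_measurable_continuous_onI)
      thus ?thesis by measurable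
    qed
    have "(\<integral>\<^sup>+t. emeasure M (N t) * indicator {0..} t \<partial>lborel) =
      (\<integral>\<^sup>+t. (\<Sum>j\<in>{1..n}. ennreal (1 / real n) * (ennreal (waiting \<beta> n j t) * indicator {0..} t)) \<partial>lborel)"
      by (intro nn_integral_cong) (auto simp: emN indicator_def)
    also have "\<dots> = (\<Sum>j\<in>{1..n}. \<integral>\<^sup>+t. ennreal (1 / real n) * (ennreal (waiting \<beta> n j t) * indicator {0..} t) \<partial>lborel)"
      by (intro nn_integral_sum borel_measurable_times_ennreal borel_measurable_const meas)
    also have "\<dots> = (\<Sum>j\<in>{1..n}. ennreal (1 / real n) * ennreal ?H)"
      using meas nn_integral_waiting(1)[OF beta_pos n mc] by (intro sum.cong refl) (simp add: nn_integral_cmult)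
    also have "\<dots> = (\<Sum>j\<in>{1..n}. ennreal (1 / real n * ?H))"
      using mean_height_nonneg[OF beta_pos] by (intro sum.cong refl ennreal_mult[symmetric]) auto
    also have "\<dots> = ennreal (\<Sum>j\<in>{1..n}. 1 / real n * ?H)"
      using mean_height_nonneg[OF beta_pos] by (intro sum_ennreal) auto
    also have "(\<Sum>j\<in>{1..n}. 1 / real n * ?H) = ?H" using n by simp
    finally show ?thesis .
  qed

  \<comment> \<open>otherwise \<open>P(N t)\<close> would be bounded below and its integral over time infinite\<close>
  have nonempty: "AE \<omega> in M. A \<omega> \<noteq> {}"
  proof -
    define Z where "Z = space M - (\<Union>q\<in>R. E q)"
    have Z: "Z \<in> sets M" unfolding Z_def using R E by (intro sets.compl_sets sets.countable_UN'') (auto simp: R_def)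
    have Z_iff: "A \<omega> = {}" if "\<omega> \<in> Z" for \<omega>
    proof (rule ccontr)
      assume "A \<omega> \<noteq> {}"
      then obtain t where "t \<in> A \<omega>" by blast
      moreover have sp: "\<omega> \<in> space M" using that by (simp add: Z_def)
      ultimately obtain q where "q \<in> R" "q \<in> A \<omega>" using A_rational[OF sp, of t "t + 1"] by auto
      thus False using that AE_iff[OF sp, of q] by (auto simp: R_def Z_def)
    qed
    have ZN: "Z \<subseteq> N t" if "t \<ge> 0" for t
      using Z_iff AE_iff[OF _ that] by (auto simp: N_def Z_def)
    have "measure M Z * real m \<le> ?H" for m
    proof -
      have "ennreal (measure M Z * real m) = ennreal (measure M Z) * emeasure lborel {0..real m}"
        by (simp add: ennreal_mult)
      also have "\<dots> = (\<integral>\<^sup>+t. ennreal (measure M Z) * indicator {0..real m} t \<partial>lborel)"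
        by (rule nn_integral_cmult_indicator[symmetric]) auto
      also have "\<dots> \<le> (\<integral>\<^sup>+t. emeasure M (N t) * indicator {0..} t \<partial>lborel)"
      proof (intro nn_integral_mono)
        fix t :: real
        show "ennreal (measure M Z) * indicator {0..real m} t \<le> emeasure M (N t) * indicator {0..} t"
          using emeasure_mono[OF ZN N, of t] by (auto simp: indicator_def emeasure_eq_measure)
      qed
      finally show ?thesis using intN mean_height_nonneg[OF beta_pos] by (simp add: ennreal_le_iff)
    qed
    hence "measure M Z \<le> 0"
    proof -
      assume le: "\<And>m. measure M Z * real m \<le> ?H"
      show ?thesis
      proof (rule ccontr)
        assume "\<not> measure M Z \<le> 0"
        then obtain m where "?H < real m * measure M Z" using reals_Archimedean3[of "measure M Z"] by auto
        thus False using le[of m] by (simp add: mult.commute)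
      qed
    qed
    hence "measure M Z = 0" using measure_nonneg[of M Z] by linarith
    hence "AE \<omega> in M. \<omega> \<notin> Z" using prob_eq_0[OF Z] by simp
    thus ?thesis using AE_space
    proof eventually_elim
      case (elim \<omega>)
      then obtain q where "q \<in> R" "\<omega> \<in> E q" by (auto simp: Z_def)
      thus ?case using AE_iff[OF elim(2), of q] by (auto simp: R_def)
    qed
  qed

  have upper: "emeasure M {\<omega>\<in>space M. t < leaf_height X J \<omega>} \<le> emeasure M (N t)" if t: "t \<ge> 0" for t
  proof (rule emeasure_mono[OF _ N[OF t]], safe)
    fix \<omega> assume w: "\<omega> \<in> space M" "t < leaf_height X J \<omega>"
    show "\<omega> \<in> N t"
    proof (rule ccontr)
      assume "\<omega> \<notin> N t"
      hence "t \<in> A \<omega>" using w(1) AE_iff[OF w(1) t] by (simp add: N_def)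
      hence "Inf (A \<omega>) \<le> t" by (intro cInf_lower bdd)
      thus False using w(2) by (simp add: D)
    qed
  qed
  have lower: "emeasure M (N t) \<le> emeasure M {\<omega>\<in>space M. t \<le> leaf_height X J \<omega>}" if t: "t \<ge> 0" for t
  proof (rule emeasure_mono_AE)
    show "AE \<omega> in M. \<omega> \<in> N t \<longrightarrow> \<omega> \<in> {\<omega>\<in>space M. t \<le> leaf_height X J \<omega>}"
      using mono nonempty AE_space
    proof eventually_elim
      case (elim \<omega>)
      show ?case
      proof
        assume wN: "\<omega> \<in> N t"
        have "t \<le> s" if s: "s \<in> A \<omega>" for s
        proof (rule ccontr)
          assume "\<not> t \<le> s"
          hence "s < t" by simp
          then obtain q where q: "q \<in> R" "q < t" "q \<in> A \<omega>" using A_rational[OF elim(3) s] by blast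
          obtain r where r: "r \<in> \<rat>" "t < r" "\<omega> \<in> E r \<longleftrightarrow> \<omega> \<in> E t"
            using rational_near[OF elim(3) t, of "t + 1"] by auto
          have "r \<in> R" "q \<le> r" using r q t by (auto simp: R_def)
          moreover have "\<omega> \<in> E q" using q AE_iff[OF elim(3), of q] by (auto simp: R_def)
          ultimately have "\<omega> \<in> E r" using elim(1) q(1) by blast
          thus False using r(3) wN by (simp add: N_def)
        qed
        hence "t \<le> Inf (A \<omega>)" using elim(2) by (intro cInf_greatest) auto
        thus "\<omega> \<in> {\<omega>\<in>space M. t \<le> leaf_height X J \<omega>}" using elim(3) by (simp add: D)
      qed
    qed
    show "{\<omega>\<in>space M. t \<le> leaf_height X J \<omega>} \<in> sets M" using D_meas by measurable
  qed
  have "(\<integral>\<^sup>+\<omega>. ennreal (leaf_height X J \<omega>) \<partial>M) = ennreal ?H"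
  proof (rule antisym)
    show "(\<integral>\<^sup>+\<omega>. ennreal (leaf_height X J \<omega>) \<partial>M) \<le> ennreal ?H"
      unfolding nn_integral_eq_tail(1)[OF prob_space_axioms D_meas] intN[symmetric]
      by (intro nn_integral_mono) (use upper in \<open>auto simp: indicator_def\<close>)
    show "ennreal ?H \<le> (\<integral>\<^sup>+\<omega>. ennreal (leaf_height X J \<omega>) \<partial>M)"
      unfolding nn_integral_eq_tail(2)[OF prob_space_axioms D_meas] intN[symmetric]
      by (intro nn_integral_mono) (use lower in \<open>auto simp: indicator_def\<close>)
  qed
  moreover have "AE \<omega> in M. 0 \<le> leaf_height X J \<omega>"
    using nonempty by eventually_elim (auto simp: D intro!: cInf_greatest dest: A_nonneg)
  ultimately show ?thesis
    using D_meas mean_height_nonneg[OF beta_pos] by (intro has_bochner_integral_nn_integral) auto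
qed

end

section \<open>The potential density as an integral over a vertical line\<close>

lemma LINT_reflect: "(LINT t|lborel. f (- t)) = (LINT t|lborel. f (t::real) :: complex)"
  using lborel_integral_real_affine[of "-1" f 0] by simp

context
  fixes \<beta> :: real
  assumes beta_pos: "\<beta> > 0"
begin

abbreviation line_integrand :: "real \<Rightarrow> real \<Rightarrow> real \<Rightarrow> complex" where
  "line_integrand c x t \<equiv> exp (Complex c t * of_real x) * F \<beta> (Complex c t)"

lemma F_cnj: "F \<beta> (cnj z) = cnj (F \<beta> z)"
  by (simp add: F_def phi_cnj)

text \<open>
  Reflection \<open>t \<mapsto> -t\<close> of the line is conjugation of the integrand.
\<close>
lemma line_integral_real: "(LINT t|lborel. line_integrand c x t) \<in> \<real>"
proof -
  have "cnj (LINT t|lborel. line_integrand c x t) = (LINT t|lborel. cnj (line_integrand c x t))"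
    by (rule Bochner_Integration.integral_cnj[symmetric])
  also have "\<dots> = (LINT t|lborel. line_integrand c x (- t))"
  proof (intro Bochner_Integration.integral_cong refl)
    fix t :: real
    have "Complex c (- t) = cnj (Complex c t)" by (simp add: complex_eq_iff)
    thus "cnj (line_integrand c x t) = line_integrand c x (- t)" by (simp add: exp_cnj F_cnj)
  qed
  also have "\<dots> = (LINT t|lborel. line_integrand c x t)" by (rule LINT_reflect)
  finally show ?thesis by (simp add: Reals_cnj_iff)
qed

lemma F_holomorphic:
  assumes "\<And>z. z \<in> A \<Longrightarrow> \<not> isolated_zero (phi \<beta>) z"
  shows "F \<beta> holomorphic_on A"
proof -
  have "(\<lambda>z. 1 / phi \<beta> z) holomorphic_on A"
    using assms inverse_phi_analytic_iff[OF beta_pos]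
    by (intro analytic_imp_holomorphic, subst analytic_on_analytic_at) auto
  thus ?thesis unfolding F_def [abs_def] by (rule holomorphic_on_diff) (rule holomorphic_on_const)
qed

lemma F_line:
  assumes "\<And>z. Re z = c \<Longrightarrow> \<not> isolated_zero (phi \<beta>) z"
  shows "continuous_on UNIV (\<lambda>t. F \<beta> (Complex c t))" "integrable lborel (\<lambda>t. F \<beta> (Complex c t))"
proof -
  have "continuous_on {z. Re z = c} (F \<beta>)"
    using assms by (intro holomorphic_on_imp_continuous_on F_holomorphic) auto
  thus cont: "continuous_on UNIV (\<lambda>t. F \<beta> (Complex c t))"
    by (rule continuous_on_compose2) (auto intro!: continuous_intros)
  obtain C T where T: "C > 0" "T \<ge> 1" "\<forall>z. \<bar>Re z\<bar> \<le> \<bar>c\<bar> \<longrightarrow> \<bar>Im z\<bar> \<ge> T \<longrightarrow>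
      phi \<beta> z \<noteq> 0 \<and> cmod (F \<beta> z) \<le> C * \<bar>Im z\<bar> powr (-1-min \<beta> 1)"
    using F_decay_strip[OF beta_pos, of "\<bar>c\<bar>"] by blast
  show "integrable lborel (\<lambda>t. F \<beta> (Complex c t))"
  proof (rule integrable_of_powr_decay[where T = T and C = C and d = "min \<beta> 1", OF cont])
    show "cmod (F \<beta> (Complex c t)) \<le> C * \<bar>t\<bar> powr (-1-min \<beta> 1)" if "\<bar>t\<bar> \<ge> T" for t
      using T(3)[rule_format, of "Complex c t"] that by simp
  qed (use T beta_pos in auto)
qed

lemma cmod_line_integrand: "cmod (line_integrand c x t) = exp (c * x) * cmod (F \<beta> (Complex c t))"
  by (simp add: norm_mult)

lemma integrable_line_integrand:
  assumes "\<And>z. Re z = c \<Longrightarrow> \<not> isolated_zero (phi \<beta>) z"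
  shows "integrable lborel (line_integrand c x)"
proof (rule Bochner_Integration.integrable_bound)
  show "integrable lborel (\<lambda>t. exp (c * x) * cmod (F \<beta> (Complex c t)))"
    using F_line(2)[OF assms] by (intro integrable_mult_right integrable_norm)
  have "continuous_on UNIV (line_integrand c x)"
    using F_line(1)[OF assms] by (intro continuous_intros)
  thus "line_integrand c x \<in> borel_measurable lborel" using borel_measurable_continuous_onI by simp
  show "AE t in lborel. cmod (line_integrand c x t) \<le> norm (exp (c * x) * cmod (F \<beta> (Complex c t)))"
    by (intro AE_I2) (simp add: cmod_line_integrand)
qed

lemma remainder_eq: "remainder \<beta> \<sigma> x = 1 / (2 * of_real pi) * (LINT t|lborel. line_integrand (-\<sigma>) x t)"
proof -
  have "(LINT t|lborel. remainder_integrand \<beta> \<sigma> x t) = (LINT t|lborel. line_integrand (-\<sigma>) x t) * \<i>"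
    unfolding remainder_integrand_def Let_def by simp
  thus ?thesis by (simp add: remainder_def)
qed

lemma remainder_integrable:
  assumes "\<And>z. Re z = - \<sigma> \<Longrightarrow> \<not> isolated_zero (phi \<beta>) z"
  shows "integrable lborel (remainder_integrand \<beta> \<sigma> x)"
proof -
  have "integrable lborel (\<lambda>t. line_integrand (-\<sigma>) x t * \<i>)"
    using integrable_line_integrand[OF assms] by (intro integrable_mult_left) auto
  thus ?thesis by (simp add: remainder_integrand_def [abs_def] Let_def)
qed

lemma remainder_real: "remainder \<beta> \<sigma> x \<in> \<real>"
  unfolding remainder_eq by (intro Reals_mult line_integral_real) simp

lemma remainder_bigo:
  assumes "\<And>z. Re z = - \<sigma> \<Longrightarrow> \<not> isolated_zero (phi \<beta>) z"
  shows "remainder \<beta> \<sigma> \<in> O[at_top](\<lambda>x. of_real (exp (- \<sigma> * x)))"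
proof (rule bigoI[of _ "1 / (2 * pi) * (LINT t|lborel. cmod (F \<beta> (Complex (-\<sigma>) t)))"], rule always_eventually, rule allI)
  fix x :: real
  have "cmod (LINT t|lborel. line_integrand (-\<sigma>) x t) \<le> (LINT t|lborel. cmod (line_integrand (-\<sigma>) x t))"
    by (rule integral_norm_bound)
  also have "\<dots> = exp (-\<sigma> * x) * (LINT t|lborel. cmod (F \<beta> (Complex (-\<sigma>) t)))"
    unfolding cmod_line_integrand by simp
  finally have le: "cmod (LINT t|lborel. line_integrand (-\<sigma>) x t) \<le> exp (-\<sigma> * x) * (LINT t|lborel. cmod (F \<beta> (Complex (-\<sigma>) t)))" .
  have "cmod (remainder \<beta> \<sigma> x) = 1 / (2 * pi) * cmod (LINT t|lborel. line_integrand (-\<sigma>) x t)"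
    unfolding remainder_eq by (simp add: norm_mult norm_divide)
  also have "\<dots> \<le> 1 / (2 * pi) * (exp (-\<sigma> * x) * (LINT t|lborel. cmod (F \<beta> (Complex (-\<sigma>) t))))"
    by (intro mult_left_mono le) auto
  finally show "norm (remainder \<beta> \<sigma> x) \<le> 1 / (2 * pi) * (LINT t|lborel. cmod (F \<beta> (Complex (-\<sigma>) t))) * norm (complex_of_real (exp (- \<sigma> * x)))"
    by (simp add: mult_ac)
qed

lemma right_line_no_zero: "Re z = 1 \<Longrightarrow> \<not> isolated_zero (phi \<beta>) z"
  using zeros_Re_neg[OF beta_pos, of z] by (cases "z = 0") auto

text \<open>
  Between \<open>Re z = -\<sigma>\<close> and \<open>Re z = 1\<close> the poles of \<open>exp (z x) F z\<close> are the origin and the zeros in the strip.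
\<close>
theorem potential_density_eq_line_integral:
  assumes \<sigma>: "\<sigma> > 0" and nz: "\<And>z. Re z = - \<sigma> \<Longrightarrow> \<not> isolated_zero (phi \<beta>) z"
  shows "potential_density \<beta> \<sigma> x = 1 / (2 * of_real pi) * (LINT t|lborel. line_integrand 1 x t)"
proof -
  define f where "f = (\<lambda>z. exp (z * of_real x) * F \<beta> z)"
  define P where "P = {z. isolated_zero (phi \<beta>) z \<and> \<bar>Re z\<bar> \<le> \<sigma> + 1}"
  have finP: "finite P" unfolding P_def by (rule finite_zeros_Re[OF beta_pos])
  have hol: "f holomorphic_on {z. -\<sigma> - 1 < Re z \<and> Re z < 1 + 1} - P"
    unfolding f_def
  proof (intro holomorphic_intros F_holomorphic)
    fix z assume z: "z \<in> {z. -\<sigma> - 1 < Re z \<and> Re z < 1 + 1} - P"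
    show "\<not> isolated_zero (phi \<beta>) z"
    proof
      assume iz: "isolated_zero (phi \<beta>) z"
      hence "z = 0 \<or> Re z < 0" using zeros_Re_neg[OF beta_pos] by blast
      hence "z \<in> P" using z iz \<sigma> by (auto simp: P_def)
      thus False using z by simp
    qed
  qed
  obtain C T where T: "C > 0" "T \<ge> 1" "\<forall>z. \<bar>Re z\<bar> \<le> max \<sigma> 1 \<longrightarrow> \<bar>Im z\<bar> \<ge> T \<longrightarrow>
      phi \<beta> z \<noteq> 0 \<and> cmod (F \<beta> z) \<le> C * \<bar>Im z\<bar> powr (-1-min \<beta> 1)"
    using F_decay_strip[OF beta_pos, of "max \<sigma> 1"] by blast
  have bound: "cmod (f z) \<le> (exp (max \<sigma> 1 * \<bar>x\<bar>) * C) * \<bar>Im z\<bar> powr (-1-min \<beta> 1)"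
    if z: "-\<sigma> \<le> Re z" "Re z \<le> 1" "\<bar>Im z\<bar> \<ge> T" for z
  proof -
    have R: "\<bar>Re z\<bar> \<le> max \<sigma> 1" using z by auto
    have "Re z * x \<le> \<bar>Re z\<bar> * \<bar>x\<bar>" by (metis abs_ge_self abs_mult)
    also have "\<dots> \<le> max \<sigma> 1 * \<bar>x\<bar>" using R by (intro mult_right_mono) auto
    finally have "cmod (exp (z * of_real x)) \<le> exp (max \<sigma> 1 * \<bar>x\<bar>)" by simp
    moreover have "cmod (F \<beta> z) \<le> C * \<bar>Im z\<bar> powr (-1-min \<beta> 1)" using T R z by auto
    ultimately have "cmod (f z) \<le> exp (max \<sigma> 1 * \<bar>x\<bar>) * (C * \<bar>Im z\<bar> powr (-1-min \<beta> 1))"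
      unfolding f_def norm_mult by (intro mult_mono) auto
    thus ?thesis by (simp add: mult.assoc)
  qed
  have avoid: "Re p \<noteq> -\<sigma> \<and> Re p \<noteq> 1" if "p \<in> P" for p
    using that nz[of p] right_line_no_zero[of p] by (auto simp: P_def)
  have ab: "-\<sigma> < 1" and d: "min \<beta> 1 > 0" using \<sigma> beta_pos by auto
  have shift: "(LINT t|lborel. f (Complex 1 t)) - (LINT t|lborel. f (Complex (-\<sigma>) t)) =
        2 * of_real pi * (\<Sum>p \<in> {p\<in>P. -\<sigma> < Re p \<and> Re p < 1}. residue f p)"
    by (rule vertical_contour_shift(3)[OF ab zero_less_one d T(2) finP hol avoid bound])
  have set: "{p\<in>P. -\<sigma> < Re p \<and> Re p < 1} = insert 0 (zeros_strip \<beta> \<sigma>)"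
    using zeros_Re_neg[OF beta_pos] isolated_zero_phi_0[OF beta_pos] \<sigma>
    by (force simp: P_def zeros_strip_def zeros_def)
  have "0 \<notin> zeros_strip \<beta> \<sigma>" by (simp add: zeros_strip_def)
  hence "(\<Sum>p \<in> {p\<in>P. -\<sigma> < Re p \<and> Re p < 1}. residue f p) = residue f 0 + (\<Sum>\<rho>\<in>zeros_strip \<beta> \<sigma>. residue f \<rho>)"
    unfolding set using finite_zeros_strip[OF beta_pos] by simp
  also have "residue f 0 = 1 / mu \<beta>" unfolding f_def by (rule residue_F_at_0[OF beta_pos])
  also have "(\<Sum>\<rho>\<in>zeros_strip \<beta> \<sigma>. residue f \<rho>) = (\<Sum>\<rho>\<in>zeros_strip \<beta> \<sigma>. u_term \<beta> \<rho> x)"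
    unfolding f_def by (intro sum.cong refl u_term_eq_residue[OF beta_pos, symmetric])
      (auto simp: zeros_strip_def zeros_def)
  finally have sum_eq: "(\<Sum>p \<in> {p\<in>P. -\<sigma> < Re p \<and> Re p < 1}. residue f p) = 1 / mu \<beta> + (\<Sum>\<rho>\<in>zeros_strip \<beta> \<sigma>. u_term \<beta> \<rho> x)" .
  have "(LINT t|lborel. f (Complex 1 t)) = (LINT t|lborel. f (Complex (-\<sigma>) t)) +
       2 * of_real pi * (1 / mu \<beta> + (\<Sum>\<rho>\<in>zeros_strip \<beta> \<sigma>. u_term \<beta> \<rho> x))"
    using shift unfolding sum_eq by (simp only: diff_eq_eq add.commute)
  hence "1 / (2 * of_real pi) * (LINT t|lborel. f (Complex 1 t)) =
      1 / (2 * of_real pi) * (LINT t|lborel. f (Complex (-\<sigma>) t)) + (1 / mu \<beta> + (\<Sum>\<rho>\<in>zeros_strip \<beta> \<sigma>. u_term \<beta> \<rho> x))"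
    by (simp only: distrib_left) simp
  thus ?thesis unfolding potential_density_def remainder_eq f_def by (simp only: add.commute)
qed

text \<open>
  The factor \<open>exp (-x)\<close> turns the integral over \<open>Re z = 1\<close> into an inverse Fourier transform. That integral is real
  (\<open>inverse_fourier_real\<close>).
\<close>
definition tilted_density :: "real \<Rightarrow> real" where
  "tilted_density x = Re (1 / (2 * of_real pi) * (LINT t|lborel. iexp (t * x) * F \<beta> (Complex 1 t)))"

lemma F_right:
  shows "continuous_on UNIV (\<lambda>t. F \<beta> (Complex 1 t))" "integrable lborel (\<lambda>t. F \<beta> (Complex 1 t))"
  using F_line[of 1] right_line_no_zero by auto

lemma potential_density_eq_tilted:
  assumes \<sigma>: "\<sigma> > 0" and nz: "\<And>z. Re z = - \<sigma> \<Longrightarrow> \<not> isolated_zero (phi \<beta>) z"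
  shows "potential_density \<beta> \<sigma> x = of_real (exp x * tilted_density x)"
proof -
  have "line_integrand 1 x t = of_real (exp x) * (iexp (t * x) * F \<beta> (Complex 1 t))" for t
  proof -
    have "Complex 1 t * of_real x = of_real x + \<i> * of_real (t * x)" by (simp add: complex_eq_iff)
    thus ?thesis by (simp add: exp_add exp_of_real)
  qed
  hence eq: "(LINT t|lborel. line_integrand 1 x t) = of_real (exp x) * (LINT t|lborel. iexp (t * x) * F \<beta> (Complex 1 t))"
    by (simp only: integral_mult_right_zero)
  have pdl: "potential_density \<beta> \<sigma> x = 1 / (2 * of_real pi) * (LINT t|lborel. line_integrand 1 x t)"
    by (rule potential_density_eq_line_integral[OF \<sigma>]) (rule nz)
  define I where "I = 1 / (2 * of_real pi) * (LINT t|lborel. iexp (t * x) * F \<beta> (Complex 1 t))"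
  have pd: "potential_density \<beta> \<sigma> x = of_real (exp x) * I"
    unfolding pdl eq I_def by (rule mult.left_commute)
  have "of_real (exp x) * I \<in> \<real>"
    unfolding pd[symmetric] pdl by (intro Reals_mult line_integral_real) simp
  hence "Im (of_real (exp x) * I) = 0" by (simp add: complex_is_Real_iff)
  hence "Im I = 0" by simp
  moreover have "tilted_density x = Re I" by (simp only: tilted_density_def I_def)
  ultimately have "I = of_real (tilted_density x)" by (simp add: complex_eq_iff)
  thus ?thesis unfolding pd by simp
qed

lemma tilted_density_bounded: "\<exists>K>0. \<forall>x. \<bar>tilted_density x\<bar> \<le> K"
proof -
  let ?L = "LINT t|lborel. cmod (F \<beta> (Complex 1 t))"
  have bnd: "\<bar>tilted_density x\<bar> \<le> 1 / (2 * pi) * ?L" for x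
  proof -
    have "cmod (LINT t|lborel. iexp (t * x) * F \<beta> (Complex 1 t)) \<le> (LINT t|lborel. cmod (iexp (t * x) * F \<beta> (Complex 1 t)))"
      by (rule integral_norm_bound)
    also have "\<dots> = ?L" by (simp only: norm_mult norm_exp_i_times mult_1_left)
    finally have le: "cmod (LINT t|lborel. iexp (t * x) * F \<beta> (Complex 1 t)) \<le> ?L" .
    have "\<bar>tilted_density x\<bar> \<le> cmod (1 / (2 * of_real pi) * (LINT t|lborel. iexp (t * x) * F \<beta> (Complex 1 t)))"
      unfolding tilted_density_def by (rule abs_Re_le_cmod)
    also have "\<dots> = 1 / (2 * pi) * cmod (LINT t|lborel. iexp (t * x) * F \<beta> (Complex 1 t))"
      by (simp add: norm_mult norm_divide)
    also have "\<dots> \<le> 1 / (2 * pi) * ?L" by (intro mult_left_mono le) auto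
    finally show ?thesis .
  qed
  have "?L \<ge> 0" by simp
  hence K: "1 / (2 * pi) * ?L \<ge> 0" by simp
  show ?thesis
  proof (intro exI[of _ "1 / (2 * pi) * ?L + 1"] conjI allI)
    show "1 / (2 * pi) * ?L + 1 > 0" using K by linarith
    show "\<bar>tilted_density x\<bar> \<le> 1 / (2 * pi) * ?L + 1" for x using bnd[of x] by linarith
  qed
qed

lemma tilted_density_continuous: "continuous_on UNIV tilted_density"
proof -
  have "continuous_on UNIV (\<lambda>x. LINT t|lborel. iexp (t * x) * F \<beta> (Complex 1 t))"
  proof (subst continuous_on_sequentially, intro allI ballI impI, elim conjE)
    fix u :: "nat \<Rightarrow> real" and a :: real
    assume u: "u \<longlonglongrightarrow> a"
    have "(\<lambda>n. LINT t|lborel. iexp (t * u n) * F \<beta> (Complex 1 t)) \<longlonglongrightarrow> (LINT t|lborel. iexp (t * a) * F \<beta> (Complex 1 t))"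
    proof (rule integral_dominated_convergence[where w = "\<lambda>t. cmod (F \<beta> (Complex 1 t))"])
      have m: "(\<lambda>t. iexp (t * x) * F \<beta> (Complex 1 t)) \<in> borel_measurable lborel" for x
      proof -
        have "continuous_on UNIV (\<lambda>t. iexp (t * x) * F \<beta> (Complex 1 t))"
          by (intro continuous_intros F_right(1))
        from borel_measurable_continuous_onI[OF this] show ?thesis by simp
      qed
      show "(\<lambda>t. iexp (t * a) * F \<beta> (Complex 1 t)) \<in> borel_measurable lborel"
        "(\<lambda>t. iexp (t * u n) * F \<beta> (Complex 1 t)) \<in> borel_measurable lborel" for n by (rule m)+
      show "integrable lborel (\<lambda>t. cmod (F \<beta> (Complex 1 t)))" using F_right(2) by (rule integrable_norm)
      show "AE t in lborel. (\<lambda>n. iexp (t * u n) * F \<beta> (Complex 1 t)) \<longlonglongrightarrow> iexp (t * a) * F \<beta> (Complex 1 t)"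
        by (intro AE_I2 tendsto_intros u)
      show "AE t in lborel. cmod (iexp (t * u n) * F \<beta> (Complex 1 t)) \<le> cmod (F \<beta> (Complex 1 t))" for n
        by (intro AE_I2) (simp only: norm_mult norm_exp_i_times mult_1_left order_refl)
    qed
    thus "((\<lambda>x. LINT t|lborel. iexp (t * x) * F \<beta> (Complex 1 t)) \<circ> u) \<longlonglongrightarrow> (LINT t|lborel. iexp (t * a) * F \<beta> (Complex 1 t))"
      by (simp add: o_def)
  qed
  thus ?thesis unfolding tilted_density_def [abs_def] by (intro continuous_intros)
qed

end

section \<open>Transforms determining a characteristic function\<close>

text \<open>
  The time integral needed for the transform of a potential measure, with \<open>a = \<Phi>(1)\<close> and \<open>w = \<Phi>(1 - i s)\<close>. The integrand is
  kept nonnegative, since the potential measure is only available through integrals of nonnegative functions.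
\<close>
lemma nn_integral_exp_oscillation:
  fixes a :: real and u w :: complex
  assumes "a > 0" "Re w > 0" and nn: "\<And>t. t \<ge> 0 \<Longrightarrow> 0 \<le> exp (- t * a) + Re (u * exp (- of_real t * w))"
  shows "(\<integral>\<^sup>+t. ennreal (exp (- t * a) + Re (u * exp (- of_real t * w))) * indicator {0..} t \<partial>lborel)
           = ennreal (1 / a + Re (u / w))"
proof -
  let ?F = "\<lambda>t. - (exp (- t * a) / a) - Re (u * exp (- of_real t * w) / w)"
  have "(\<integral>\<^sup>+t. ennreal (exp (- t * a) + Re (u * exp (- of_real t * w))) * indicator {0..} t \<partial>lborel)
           = ennreal (0 - ?F 0)"
  proof (rule nn_integral_FTC_atLeast)
    have "continuous_on UNIV (\<lambda>t. exp (- t * a) + Re (u * exp (- of_real t * w)))" by (intro continuous_intros)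
    thus "(\<lambda>t. exp (- t * a) + Re (u * exp (- of_real t * w))) \<in> borel_measurable borel"
      by (rule borel_measurable_continuous_onI)
    fix t :: real assume t: "0 \<le> t"
    show "0 \<le> exp (- t * a) + Re (u * exp (- of_real t * w))" by (rule nn[OF t])
    have w0: "w \<noteq> 0" using assms(1,2) by auto
    have "((\<lambda>z. u * exp (- z * w) / w) has_field_derivative (u * (exp (- of_real t * w) * (- w)) / w)) (at (of_real t))"
      by (auto intro!: derivative_eq_intros)
    hence "((\<lambda>z. u * exp (- z * w) / w) has_field_derivative (- (u * exp (- of_real t * w)))) (at (of_real t))"
      using w0 by simp
    hence "((\<lambda>t. u * exp (- of_real t * w) / w) has_vector_derivative (- (u * exp (- of_real t * w)))) (at t)"
      by (rule has_vector_derivative_real_field)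
    hence "((\<lambda>t. Re (u * exp (- of_real t * w) / w)) has_vector_derivative Re (- (u * exp (- of_real t * w)))) (at t)"
      by (rule bounded_linear.has_vector_derivative[OF bounded_linear_Re])
    hence 1: "((\<lambda>t. Re (u * exp (- of_real t * w) / w)) has_real_derivative Re (- (u * exp (- of_real t * w)))) (at t)"
      by (simp add: has_real_derivative_iff_has_vector_derivative)
    have 2: "((\<lambda>t. - (exp (- t * a) / a)) has_real_derivative exp (- t * a)) (at t)"
      using assms(1,2) by (auto intro!: derivative_eq_intros)
    show "(?F has_real_derivative exp (- t * a) + Re (u * exp (- of_real t * w))) (at t)"
      using DERIV_diff[OF 2 1] by (simp only: uminus_complex.sel diff_minus_eq_add)
  next
    have e0: "((\<lambda>t. exp (- t * c)) \<longlongrightarrow> 0) at_top" if "c > 0" for c :: real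
    proof (rule filterlim_compose[OF exp_at_bot])
      have "filterlim (\<lambda>t. c * t) at_top at_top"
        using that by (intro filterlim_tendsto_pos_mult_at_top[OF tendsto_const _ filterlim_ident]) auto
      hence "filterlim (\<lambda>t. - (c * t)) at_bot at_top" by (simp add: filterlim_uminus_at_bot)
      thus "filterlim (\<lambda>t. - t * c) at_bot at_top" by (simp add: mult.commute)
    qed
    have "((\<lambda>t. u * exp (- of_real t * w) / w) \<longlongrightarrow> 0) at_top"
    proof (rule Lim_null_comparison)
      show "\<forall>\<^sub>F t in at_top. cmod (u * exp (- complex_of_real t * w) / w) \<le> cmod u * exp (- t * Re w) / cmod w"
        by (intro always_eventually allI) (simp add: norm_mult norm_divide)
      have "((\<lambda>t. cmod u * exp (- t * Re w) / cmod w) \<longlongrightarrow> cmod u * 0 / cmod w) at_top"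
        using assms(1,2) by (intro tendsto_intros e0) auto
      thus "((\<lambda>t. cmod u * exp (- t * Re w) / cmod w) \<longlongrightarrow> 0) at_top" by simp
    qed
    hence "((\<lambda>t. Re (u * exp (- of_real t * w) / w)) \<longlongrightarrow> Re 0) at_top" by (rule tendsto_Re)
    moreover have "((\<lambda>t. - (exp (- t * a) / a)) \<longlongrightarrow> - (0 / a)) at_top" 
      using assms(1,2) by (intro tendsto_intros e0) auto
    ultimately have "(?F \<longlongrightarrow> - (0 / a) - Re 0) at_top" by (intro tendsto_diff)
    thus "(?F \<longlongrightarrow> 0) at_top" by (simp only: zero_complex.sel div_0 minus_zero diff_self)
  qed
  moreover have "?F 0 = - (1 / a) - Re (u / w)"
    by (simp only: minus_zero mult_zero_left exp_zero of_real_0 mult_1_right)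
  ultimately show ?thesis by (simp only: diff_0 minus_diff_eq diff_minus_eq_add) (simp only: add.commute)
qed

lemma Re_of_real_mult: "Re (of_real r * z) = r * Re z"
  by simp

lemma Im_of_real_mult: "Im (of_real r * z) = r * Im z"
  by simp

text \<open>
  Both sides of the hypothesis determine \<open>Re (u * char N s)\<close>; \<open>u\<close> proportional to \<open>1\<close> and to \<open>-i\<close> gives real and imaginary
  part. The multiple \<open>e\<close> is small enough for both arguments of \<open>ennreal\<close> to be nonnegative.
\<close>
lemma char_eq_of_transform:
  assumes "real_distribution N" and a: "a > 0" and w_nz: "w \<noteq> 0"
    and tr: "\<And>u. cmod u \<le> 1 \<Longrightarrow> (\<integral>\<^sup>+x. ennreal (1 + Re (u * iexp (s * x))) \<partial>N) = ennreal (1 + a * Re (u / w))"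
  shows "char N s = of_real a / w"
proof -
  interpret T: real_distribution N by fact
  have w: "cmod w > 0" using w_nz by simp
  have int: "integrable N (\<lambda>x. iexp (s * x))"
    by (rule T.integrable_const_bound[of _ 1]) (auto simp: norm_exp_i_times)
  have key: "Re (u * char N s) = a * Re (u / w)" if u: "cmod u \<le> 1" "a * cmod u \<le> cmod w" for u
  proof -
    have iu: "integrable N (\<lambda>x. Re (u * iexp (s * x)))" using int by (intro integrable_Re integrable_mult_right)
    have hn: "1 + Re (u * iexp (s * y)) \<ge> 0" for y :: real
    proof -
      have "\<bar>Re (u * iexp (s * y))\<bar> \<le> cmod (u * iexp (s * y))" by (rule abs_Re_le_cmod)
      also have "\<dots> \<le> 1" using u by (simp only: norm_mult norm_exp_i_times mult_1_right)
      finally show ?thesis by linarith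
    qed
    have "ennreal (LINT x|N. 1 + Re (u * iexp (s * x))) = ennreal (1 + a * Re (u / w))"
      unfolding tr[OF u(1), symmetric]
      using iu hn by (intro nn_integral_eq_integral[symmetric]) auto
    moreover have "(LINT x|N. 1 + Re (u * iexp (s * x))) \<ge> 0" using hn by (intro integral_nonneg_AE) auto
    moreover have "(LINT x|N. 1 + Re (u * iexp (s * x))) = 1 + Re (u * char N s)"
    proof -
      have "(LINT x|N. 1 + Re (u * iexp (s * x))) = 1 + (LINT x|N. Re (u * iexp (s * x)))"
        using iu T.prob_space by (subst Bochner_Integration.integral_add) (auto simp: T.prob_space)
      also have "(LINT x|N. Re (u * iexp (s * x))) = Re (LINT x|N. u * iexp (s * x))"
        using int by (intro integral_Re integrable_mult_right)
      also have "(LINT x|N. u * iexp (s * x)) = u * (LINT x|N. iexp (s * x))" by (rule integral_mult_right_zero)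
      finally show ?thesis by (simp only: char_def)
    qed
    ultimately have "ennreal (1 + Re (u * char N s)) = ennreal (1 + a * Re (u / w))" "0 \<le> 1 + Re (u * char N s)" by simp_all
    moreover have "0 \<le> 1 + a * Re (u / w)"
    proof -
      have "\<bar>a * Re (u / w)\<bar> = a * \<bar>Re (u / w)\<bar>" using a by (simp add: abs_mult)
      also have "\<dots> \<le> a * cmod (u / w)" using a by (intro mult_left_mono abs_Re_le_cmod) auto
      also have "\<dots> \<le> 1" using u(2) w by (simp add: norm_divide divide_le_eq)
      finally show ?thesis by linarith
    qed
    ultimately show ?thesis by simp
  qed
  define e where "e = min 1 (cmod w / a)"
  have e: "e > 0" "e \<le> 1" "a * e \<le> cmod w" using a w by (auto simp: e_def min_def field_simps)
  have key_e: "e * Re (v * char N s) = e * (a * Re (v / w))" if "cmod v = 1" for v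
  proof -
    have "Re ((of_real e * v) * char N s) = a * Re ((of_real e * v) / w)"
      using e that by (intro key) (auto simp: norm_mult)
    thus ?thesis by (simp only: mult.assoc times_divide_eq_right[symmetric] Re_of_real_mult mult.left_commute[of a])
  qed
  have e_nz: "e \<noteq> 0" using e(1) by simp
  have key_1: "Re (v * char N s) = a * Re (v / w)" if "cmod v = 1" for v
    by (rule iffD1[OF mult_left_cancel[OF e_nz] key_e[OF that]])
  have "Re (1 * char N s) = a * Re (1 / w)" by (rule key_1) simp
  hence "Re (char N s) = Re (of_real a * (1 / w))" by (simp only: mult_1_left Re_of_real_mult)
  moreover have "Im (char N s) = Im (of_real a * (1 / w))"
  proof -
    have "Re (- \<i> * char N s) = a * Re (- \<i> / w)"
      by (rule key_1) simp
    moreover have "Re (- \<i> * z) = Im z" for z by simp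
    moreover have "- \<i> / w = - \<i> * (1 / w)" by simp
    ultimately show ?thesis by (simp only: Im_of_real_mult)
  qed
  moreover have "of_real a / w = of_real a * (1 / w)" by simp
  ultimately show ?thesis by (simp only: complex_eq_iff)
qed


section \<open>The potential measure of a subordinator\<close>

locale subordinator_exponent =
  fixes M :: "'a measure" and \<xi> :: "real \<Rightarrow> 'a \<Rightarrow> real" and \<Phi> :: "complex \<Rightarrow> complex"
  assumes sub: "subordinator M \<xi>" and laplace: "has_laplace_exponent M \<xi> \<Phi>"
    and Phi_pos: "\<And>z. Re z \<ge> 0 \<Longrightarrow> z \<noteq> 0 \<Longrightarrow> Re (\<Phi> z) > 0"
begin

sublocale prob_space M using sub by (simp add: subordinator_def)

lemma xi_meas [measurable]: "t \<ge> 0 \<Longrightarrow> \<xi> t \<in> borel_measurable M"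
  using sub by (simp add: subordinator_def)

lemma xi_mono: "0 \<le> s \<Longrightarrow> s \<le> t \<Longrightarrow> AE \<omega> in M. \<xi> s \<omega> \<le> \<xi> t \<omega>"
proof -
  assume st: "0 \<le> s" "s \<le> t"
  have "AE \<omega> in M. mono_on {0..} (\<lambda>t. \<xi> t \<omega>)" using sub unfolding subordinator_def by auto
  thus ?thesis by eventually_elim (use st in \<open>auto simp: mono_on_def\<close>)
qed

lemma xi_nonneg: "0 \<le> t \<Longrightarrow> AE \<omega> in M. 0 \<le> \<xi> t \<omega>"
proof -
  assume t: "0 \<le> t"
  have "AE \<omega> in M. \<xi> 0 \<omega> = 0" using sub unfolding subordinator_def by auto
  with xi_mono[OF order_refl t] show ?thesis by eventually_elim simp
qed

text \<open>
  Only nonnegative times are meaningful; \<open>max 0\<close> makes the family of laws total.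
\<close>
definition law :: "real \<Rightarrow> real measure" where
  "law t = distr M borel (\<xi> (max 0 t))"

lemma law_prob: "prob_space (law t)"
  unfolding law_def by (intro prob_space_distr) simp

text \<open>
  The paths increase, so \<open>P(\<xi>\<^sub>t \<le> a)\<close> is monotone in \<open>t\<close> and therefore measurable; half-lines generate the
  Borel sets.
\<close>
lemma law_measurable: "law \<in> measurable lborel (subprob_algebra borel)"
proof (rule measurable_subprob_algebra_generated[where G = "range (\<lambda>a. {..a})" and \<Omega> = UNIV])
  show "sets borel = sigma_sets UNIV (range (\<lambda>a::real. {..a}))" by (simp add: borel_eq_atMost)
  show "Int_stable (range (\<lambda>a::real. {..a}))"
    by (auto simp: Int_stable_def image_iff Int_atMost)
  show "subprob_space (law t)" for t using law_prob by (intro prob_space_imp_subprob_space)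
  show "(\<lambda>t. emeasure (law t) UNIV) \<in> borel_measurable lborel"
  proof -
    have "emeasure (law t) UNIV = 1" for t
      using prob_space.emeasure_space_1[OF law_prob[of t]] by (simp add: law_def)
    thus ?thesis by simp
  qed
  fix A :: "real set" assume "A \<in> range (\<lambda>a. {..a})"
  then obtain a where A: "A = {..a}" by blast
  define g where "g = (\<lambda>t. measure M {\<omega>\<in>space M. \<xi> (max 0 t) \<omega> \<le> a})"
  have "mono (\<lambda>t. - g t)"
  proof (rule monoI)
    fix s t :: real assume st: "s \<le> t"
    have "g t \<le> g s" unfolding g_def
    proof (rule finite_measure_mono_AE)
      show "AE \<omega> in M. \<omega> \<in> {\<omega>\<in>space M. \<xi> (max 0 t) \<omega> \<le> a} \<longrightarrow> \<omega> \<in> {\<omega>\<in>space M. \<xi> (max 0 s) \<omega> \<le> a}"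
      proof -
        have "AE \<omega> in M. \<xi> (max 0 s) \<omega> \<le> \<xi> (max 0 t) \<omega>" using st by (intro xi_mono) auto
        thus ?thesis by eventually_elim auto
      qed
      show "{\<omega>\<in>space M. \<xi> (max 0 s) \<omega> \<le> a} \<in> events" by measurable
    qed
    thus "- g s \<le> - g t" by simp
  qed
  hence "(\<lambda>t. - g t) \<in> borel_measurable borel" by (rule borel_measurable_mono)
  hence "(\<lambda>t. - (- g t)) \<in> borel_measurable borel" by (rule borel_measurable_uminus)
  hence "(\<lambda>t. ennreal (g t)) \<in> borel_measurable lborel" by simp
  moreover have "emeasure (law t) A = ennreal (g t)" for t
  proof -
    have "emeasure (law t) A = emeasure M (\<xi> (max 0 t) -` {..a} \<inter> space M)"
      unfolding law_def A by (rule emeasure_distr) auto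
    also have "\<xi> (max 0 t) -` {..a} \<inter> space M = {\<omega>\<in>space M. \<xi> (max 0 t) \<omega> \<le> a}" by auto
    finally show ?thesis by (simp add: emeasure_eq_measure g_def)
  qed
  ultimately show "(\<lambda>t. emeasure (law t) A) \<in> borel_measurable lborel" by simp
qed (auto simp: law_def)

definition time_measure :: "real measure" where
  "time_measure = density lborel (indicator {0..})"

lemma law_measurable': "law \<in> measurable time_measure (subprob_algebra borel)"
  using law_measurable by (simp add: time_measure_def)

lemma nn_integral_time: "f \<in> borel_measurable lborel \<Longrightarrow> (\<integral>\<^sup>+t. f t \<partial>time_measure) = (\<integral>\<^sup>+t. f t * indicator {0..} t \<partial>lborel)"
  unfolding time_measure_def by (subst nn_integral_density) (auto simp: mult.commute)

text \<open>
  As a mixture of the laws over time, the potential measure is seen to be countably additive, and integrals against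
  it become iterated integrals.
\<close>
lemma potential_measure_bind: "potential_measure M \<xi> = time_measure \<bind> law"
proof -
  let ?U = "time_measure \<bind> law"
  have sp: "space time_measure \<noteq> {}" by (simp add: time_measure_def)
  have sets: "sets ?U = sets borel" by (rule sets_bind[OF _ sp]) (simp add: law_def)
  have space: "space ?U = UNIV" using sets_eq_imp_space_eq[OF sets] by simp
  have em: "emeasure ?U A = (\<integral>\<^sup>+ t \<in> {0..}. emeasure (distr M borel (\<xi> t)) A \<partial>lborel)" if "A \<in> sets borel" for A
  proof -
    have "emeasure ?U A = (\<integral>\<^sup>+t. emeasure (law t) A \<partial>time_measure)"
      by (rule emeasure_bind[OF sp law_measurable' that])
    also have "\<dots> = (\<integral>\<^sup>+t. emeasure (law t) A * indicator {0..} t \<partial>lborel)"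
      by (rule nn_integral_time) (rule measurable_emeasure_kernel[OF law_measurable that])
    also have "\<dots> = (\<integral>\<^sup>+ t \<in> {0..}. emeasure (distr M borel (\<xi> t)) A \<partial>lborel)"
      by (intro nn_integral_cong) (auto simp: indicator_def law_def max_def)
    finally show ?thesis .
  qed
  have "?U = measure_of (space ?U) (sets ?U) (emeasure ?U)" by (rule measure_of_of_measure[symmetric])
  also have "\<dots> = potential_measure M \<xi>" unfolding potential_measure_def space sets
  proof (rule measure_of_eq)
    show "sets borel \<subseteq> Pow UNIV" by simp
    fix A :: "real set" assume "A \<in> sigma_sets UNIV (sets borel)"
    hence "A \<in> sets borel" by (metis sets.sigma_sets_eq space_borel)
    thus "emeasure ?U A = (\<integral>\<^sup>+ t \<in> {0..}. emeasure (distr M borel (\<xi> t)) A \<partial>lborel)" by (rule em)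
  qed
  finally show ?thesis ..
qed

lemma sets_potential [simp, measurable_cong]: "sets (potential_measure M \<xi>) = sets borel"
proof -
  have "sigma_sets UNIV (sets borel) = sets (borel :: real measure)"
    using sets.sigma_sets_eq[of "borel :: real measure"] by simp
  thus ?thesis unfolding potential_measure_def by (subst sets_measure_of) simp_all
qed

lemma nn_integral_potential:
  assumes [measurable]: "f \<in> borel_measurable borel"
  shows "(\<integral>\<^sup>+x. f x \<partial>potential_measure M \<xi>) = (\<integral>\<^sup>+t. (\<integral>\<^sup>+\<omega>. f (\<xi> t \<omega>) \<partial>M) * indicator {0..} t \<partial>lborel)"
proof -
  have "(\<integral>\<^sup>+x. f x \<partial>potential_measure M \<xi>) = (\<integral>\<^sup>+t. (\<integral>\<^sup>+x. f x \<partial>law t) \<partial>time_measure)"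
    unfolding potential_measure_bind by (rule nn_integral_bind[OF assms law_measurable'])
  also have "\<dots> = (\<integral>\<^sup>+t. (\<integral>\<^sup>+x. f x \<partial>law t) * indicator {0..} t \<partial>lborel)"
    by (rule nn_integral_time) (rule measurable_compose[OF law_measurable nn_integral_measurable_subprob_algebra[OF assms]])
  also have "\<dots> = (\<integral>\<^sup>+t. (\<integral>\<^sup>+\<omega>. f (\<xi> t \<omega>) \<partial>M) * indicator {0..} t \<partial>lborel)"
    by (intro nn_integral_cong) (auto simp: indicator_def law_def nn_integral_distr)
  finally show ?thesis .
qed

lemma laplace_transform: "t \<ge> 0 \<Longrightarrow> Re z \<ge> 0 \<Longrightarrow> (LINT \<omega>|M. exp (- z * of_real (\<xi> t \<omega>))) = exp (- of_real t * \<Phi> z)"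
  using laplace by (simp add: has_laplace_exponent_def)

lemma integrable_exp_xi:
  assumes "t \<ge> 0" "Re z \<ge> 0"
  shows "integrable M (\<lambda>\<omega>. exp (- z * of_real (\<xi> t \<omega>)))"
proof (rule integrable_const_bound[of _ 1])
  show "AE \<omega> in M. norm (exp (- z * of_real (\<xi> t \<omega>))) \<le> 1"
    using xi_nonneg[OF assms(1)] by eventually_elim (use assms in simp)
  have [measurable]: "\<xi> t \<in> borel_measurable M" using assms by simp
  show "(\<lambda>\<omega>. exp (- z * of_real (\<xi> t \<omega>))) \<in> borel_measurable M" by measurable
qed

lemma Phi_1_real: "\<Phi> 1 = of_real (Re (\<Phi> 1))" if "cnj (\<Phi> 1) = \<Phi> 1"
  using that by (simp add: complex_eq_iff)

text \<open>
  Tonelli reduces the integral to the Laplace transform of \<open>\<xi>\<^sub>t\<close> at \<open>1\<close> and at \<open>1 - i s\<close>, followed by the integral over time.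
\<close>
lemma potential_transform:
  fixes u :: complex and s :: real
  assumes real: "cnj (\<Phi> 1) = \<Phi> 1" and u: "cmod u \<le> 1"
  defines "w \<equiv> \<Phi> (1 - \<i> * of_real s)"
  shows "(\<integral>\<^sup>+x. ennreal (exp (- x) * (1 + Re (u * iexp (s * x)))) \<partial>potential_measure M \<xi>)
           = ennreal (1 / Re (\<Phi> 1) + Re (u / w))"
proof -
  let ?a = "Re (\<Phi> 1)" and ?z = "1 - \<i> * of_real s"
  have a: "?a > 0" by (rule Phi_pos) auto
  have w: "Re w > 0" unfolding w_def by (rule Phi_pos) (auto simp: complex_eq_iff)
  have hn: "1 + Re (u * iexp y) \<ge> 0" for y :: real
  proof -
    have "\<bar>Re (u * iexp y)\<bar> \<le> cmod (u * iexp y)" by (rule abs_Re_le_cmod)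
    also have "\<dots> \<le> 1" using u by (simp only: norm_mult norm_exp_i_times mult_1_right)
    finally show ?thesis by linarith
  qed
  have val: "(LINT \<omega>|M. exp (- \<xi> t \<omega>) * (1 + Re (u * iexp (s * \<xi> t \<omega>)))) = exp (- t * ?a) + Re (u * exp (- of_real t * w))"
    "integrable M (\<lambda>\<omega>. exp (- \<xi> t \<omega>) * (1 + Re (u * iexp (s * \<xi> t \<omega>))))" if t: "t \<ge> 0" for t
  proof -
    let ?e1 = "\<lambda>\<omega>. exp (- 1 * of_real (\<xi> t \<omega>)) :: complex" and ?e2 = "\<lambda>\<omega>. exp (- ?z * of_real (\<xi> t \<omega>))"
    have i1: "integrable M ?e1" and i2: "integrable M ?e2" by (rule integrable_exp_xi[OF t]; simp)+
    have e: "exp (- y) * (1 + Re (u * iexp (s * y))) = Re (exp (- 1 * of_real y)) + Re (u * exp (- ?z * of_real y))" for y :: real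
    proof -
      have z: "- ?z * of_real y = complex_of_real (- y) + \<i> * of_real (s * y)" by (simp add: complex_eq_iff)
      have "exp (- ?z * of_real y) = of_real (exp (- y)) * iexp (s * y)"
        unfolding z exp_add exp_of_real ..
      hence 1: "Re (u * exp (- ?z * of_real y)) = exp (- y) * Re (u * iexp (s * y))"
        by (simp only: mult.left_commute[of u] Re_of_real_mult)
      have "- 1 * complex_of_real y = of_real (- y)" by simp
      hence 2: "exp (- 1 * of_real y) = complex_of_real (exp (- y))" by (simp only: exp_of_real)
      show ?thesis unfolding 1 2 Re_complex_of_real by (simp only: distrib_left mult_1_right)
    qed
    have fe: "(\<lambda>\<omega>. exp (- \<xi> t \<omega>) * (1 + Re (u * iexp (s * \<xi> t \<omega>)))) = (\<lambda>\<omega>. Re (?e1 \<omega>) + Re (u * ?e2 \<omega>))"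
      by (rule ext) (rule e)
    have i3: "integrable M (\<lambda>\<omega>. u * ?e2 \<omega>)" by (rule integrable_mult_right) (rule i2)
    show "integrable M (\<lambda>\<omega>. exp (- \<xi> t \<omega>) * (1 + Re (u * iexp (s * \<xi> t \<omega>))))"
      unfolding fe by (rule Bochner_Integration.integrable_add[OF integrable_Re[OF i1] integrable_Re[OF i3]])
    have "(LINT \<omega>|M. exp (- \<xi> t \<omega>) * (1 + Re (u * iexp (s * \<xi> t \<omega>)))) = (LINT \<omega>|M. Re (?e1 \<omega>)) + (LINT \<omega>|M. Re (u * ?e2 \<omega>))"
      unfolding fe by (rule Bochner_Integration.integral_add[OF integrable_Re[OF i1] integrable_Re[OF i3]])
    also have "(LINT \<omega>|M. Re (?e1 \<omega>)) = Re (LINT \<omega>|M. ?e1 \<omega>)" using i1 by (rule integral_Re)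
    also have "(LINT \<omega>|M. ?e1 \<omega>) = exp (- of_real t * \<Phi> 1)" by (rule laplace_transform[OF t]) simp
    also have "exp (- of_real t * \<Phi> 1) = of_real (exp (- t * ?a))" using Phi_1_real[OF real]
      by (metis exp_of_real of_real_minus of_real_mult)
    also have "(LINT \<omega>|M. Re (u * ?e2 \<omega>)) = Re (LINT \<omega>|M. u * ?e2 \<omega>)" by (rule integral_Re[OF i3])
    also have "(LINT \<omega>|M. u * ?e2 \<omega>) = u * (LINT \<omega>|M. ?e2 \<omega>)" by (rule integral_mult_right_zero)
    also have "(LINT \<omega>|M. ?e2 \<omega>) = exp (- of_real t * w)" unfolding w_def by (rule laplace_transform[OF t]) simp
    finally show "(LINT \<omega>|M. exp (- \<xi> t \<omega>) * (1 + Re (u * iexp (s * \<xi> t \<omega>)))) = exp (- t * ?a) + Re (u * exp (- of_real t * w))"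
      by (simp only: Re_complex_of_real)
  qed
  have nn: "0 \<le> exp (- t * ?a) + Re (u * exp (- of_real t * w))" if t: "t \<ge> 0" for t
  proof -
    have "0 \<le> (LINT \<omega>|M. exp (- \<xi> t \<omega>) * (1 + Re (u * iexp (s * \<xi> t \<omega>))))"
      by (rule integral_nonneg_AE, rule AE_I2, rule mult_nonneg_nonneg, rule exp_ge_zero, rule hn)
    thus ?thesis by (simp only: val(1)[OF t])
  qed
  have "(\<integral>\<^sup>+x. ennreal (exp (- x) * (1 + Re (u * iexp (s * x)))) \<partial>potential_measure M \<xi>) =
     (\<integral>\<^sup>+t. (\<integral>\<^sup>+\<omega>. ennreal (exp (- \<xi> t \<omega>) * (1 + Re (u * iexp (s * \<xi> t \<omega>)))) \<partial>M) * indicator {0..} t \<partial>lborel)"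
    by (rule nn_integral_potential) measurable
  also have "\<dots> = (\<integral>\<^sup>+t. ennreal (exp (- t * ?a) + Re (u * exp (- of_real t * w))) * indicator {0..} t \<partial>lborel)"
  proof (intro nn_integral_cong)
    fix t :: real
    show "(\<integral>\<^sup>+\<omega>. ennreal (exp (- \<xi> t \<omega>) * (1 + Re (u * iexp (s * \<xi> t \<omega>)))) \<partial>M) * indicator {0..} t =
        ennreal (exp (- t * ?a) + Re (u * exp (- of_real t * w))) * indicator {0..} t"
    proof (cases "t \<ge> 0")
      case True
      have "(\<integral>\<^sup>+\<omega>. ennreal (exp (- \<xi> t \<omega>) * (1 + Re (u * iexp (s * \<xi> t \<omega>)))) \<partial>M) =
          ennreal (LINT \<omega>|M. exp (- \<xi> t \<omega>) * (1 + Re (u * iexp (s * \<xi> t \<omega>))))"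
        by (rule nn_integral_eq_integral[OF val(2)[OF True]], rule AE_I2, rule mult_nonneg_nonneg, rule exp_ge_zero, rule hn)
      thus ?thesis by (simp only: val(1)[OF True])
    qed simp
  qed
  also have "\<dots> = ennreal (1 / ?a + Re (u / w))" by (rule nn_integral_exp_oscillation[OF a w nn])
  finally show ?thesis .
qed

text \<open>
  The total mass of \<open>exp (-x) U(dx)\<close> is \<open>1 / \<Phi>(1)\<close>, so this is a probability measure.
\<close>
definition tilted :: "real measure" where
  "tilted = density (potential_measure M \<xi>) (\<lambda>x. ennreal (Re (\<Phi> 1) * exp (- x)))"

lemma tilted_transform:
  fixes u :: complex and s :: real
  assumes real: "cnj (\<Phi> 1) = \<Phi> 1" and u: "cmod u \<le> 1"
  shows "(\<integral>\<^sup>+x. ennreal (1 + Re (u * iexp (s * x))) \<partial>tilted) = ennreal (1 + Re (\<Phi> 1) * Re (u / \<Phi> (1 - \<i> * of_real s)))"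
proof -
  let ?a = "Re (\<Phi> 1)" and ?h = "\<lambda>x. 1 + Re (u * iexp (s * x))"
  have a: "?a > 0" by (rule Phi_pos) auto
  have "(\<integral>\<^sup>+x. ennreal (?h x) \<partial>tilted) = (\<integral>\<^sup>+x. ennreal (?a * exp (- x)) * ennreal (?h x) \<partial>potential_measure M \<xi>)"
    unfolding tilted_def by (rule nn_integral_density) measurable
  also have "\<dots> = (\<integral>\<^sup>+x. ennreal ?a * ennreal (exp (- x) * ?h x) \<partial>potential_measure M \<xi>)"
    using a by (intro nn_integral_cong) (simp add: ennreal_mult' mult.assoc)
  also have "\<dots> = ennreal ?a * (\<integral>\<^sup>+x. ennreal (exp (- x) * ?h x) \<partial>potential_measure M \<xi>)"
    by (rule nn_integral_cmult) measurable
  also have "\<dots> = ennreal ?a * ennreal (1 / ?a + Re (u / \<Phi> (1 - \<i> * of_real s)))"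
    by (simp only: potential_transform[OF real u])
  also have "\<dots> = ennreal (?a * (1 / ?a + Re (u / \<Phi> (1 - \<i> * of_real s))))"
    by (rule ennreal_mult'[symmetric]) (rule less_imp_le[OF a])
  finally have "(\<integral>\<^sup>+x. ennreal (?h x) \<partial>tilted) = ennreal (?a * (1 / ?a + Re (u / \<Phi> (1 - \<i> * of_real s))))" .
  moreover have "?a * (1 / ?a + Re (u / \<Phi> (1 - \<i> * of_real s))) = 1 + ?a * Re (u / \<Phi> (1 - \<i> * of_real s))"
  proof -
    have "b * (1 / b + r) = 1 + b * r" if "b > 0" for b r :: real using that by (simp add: distrib_left)
    from this[OF a] show ?thesis .
  qed
  ultimately show ?thesis by (rule trans[OF _ arg_cong[where f = ennreal]])
qed

lemma tilted_real_distribution: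
  assumes real: "cnj (\<Phi> 1) = \<Phi> 1"
  shows "real_distribution tilted"
proof -
  have sets: "sets tilted = sets borel" unfolding tilted_def by (simp only: sets_density sets_potential)
  have "(\<integral>\<^sup>+x. ennreal (1 + Re (0 * iexp (0 * x))) \<partial>tilted) = ennreal (1 + Re (\<Phi> 1) * Re (0 / \<Phi> (1 - \<i> * of_real 0)))"
    by (rule tilted_transform[OF real]) simp
  hence "(\<integral>\<^sup>+x. 1 \<partial>tilted) = 1"
    by (simp only: mult_zero_left zero_complex.sel add_0_right div_0 mult_zero_right ennreal_1)
  hence "emeasure tilted (space tilted) = 1" by simp
  hence "prob_space tilted" by (rule prob_spaceI)
  moreover have "space tilted = UNIV" using sets_eq_imp_space_eq[OF sets] by simp
  ultimately show ?thesis using sets unfolding real_distribution_def real_distribution_axioms_def by blast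
qed

lemma char_tilted:
  assumes real: "cnj (\<Phi> 1) = \<Phi> 1"
  shows "char tilted s = of_real (Re (\<Phi> 1)) / \<Phi> (1 - \<i> * of_real s)"
proof (rule char_eq_of_transform[OF tilted_real_distribution[OF real]])
  show "Re (\<Phi> 1) > 0" by (rule Phi_pos) auto
  have "Re (\<Phi> (1 - \<i> * of_real s)) > 0" by (rule Phi_pos) (auto simp: complex_eq_iff)
  thus "\<Phi> (1 - \<i> * of_real s) \<noteq> 0" by auto
qed (rule tilted_transform[OF real])

end

section \<open>Fourier inversion in the presence of an atom at the origin\<close>

text \<open>
  The kernel in Levy's inversion formula for the mass of the interval from \<open>a\<close> to \<open>b\<close>; as a function of \<open>t\<close> it is the Fourier
  transform of the indicator of that interval (\<open>levy_kernel_integral\<close>).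
\<close>
definition levy_kernel :: "real \<Rightarrow> real \<Rightarrow> real \<Rightarrow> complex" where
  "levy_kernel a b t = (iexp (-(t * a)) - iexp (-(t * b))) / (\<i> * t)"

lemma levy_kernel_measurable [measurable]: "levy_kernel a b \<in> borel_measurable borel"
  unfolding levy_kernel_def [abs_def] by measurable

lemma levy_kernel_bound: "a \<le> b \<Longrightarrow> cmod (levy_kernel a b t) \<le> b - a"
proof (cases "t = 0")
  case False
  assume "a \<le> b"
  have "levy_kernel a b t = (iexp ((- t) * b) - iexp ((- t) * a)) / (\<i> * (- t))"
    using False by (simp add: levy_kernel_def field_simps)
  thus ?thesis using Levy_Inversion_aux2[OF \<open>a \<le> b\<close>, of "- t"] False by simp
qed (simp add: levy_kernel_def)

lemma levy_kernel_integral: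
  assumes "a \<le> b" "t \<noteq> 0"
  shows "(LINT x|lborel. indicator {a..b} x *\<^sub>R iexp (-(t * x))) = levy_kernel a b t"
proof -
  have "((\<lambda>x. iexp (-(t * x))) has_integral (iexp (-(t * b)) / (- \<i> * t) - iexp (-(t * a)) / (- \<i> * t))) {a..b}"
  proof (rule fundamental_theorem_of_calculus[OF assms(1)])
    fix x :: real
    have ii: "- (\<i> * (e * \<i>)) = e" for e by (simp add: complex_eq_iff)
    have "((\<lambda>z. exp (\<i> * (- (of_real t * z))) / (- \<i> * of_real t)) has_field_derivative (exp (\<i> * (- (of_real t * of_real x))) * (- \<i> * of_real t) / (- \<i> * of_real t))) (at (of_real x))"
      by (auto intro!: derivative_eq_intros simp: ii)
    moreover have "- \<i> * of_real t \<noteq> 0" using assms(2) by simp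
    hence "e * (- \<i> * of_real t) / (- \<i> * of_real t) = e" for e by (rule nonzero_mult_div_cancel_right)
    ultimately have "((\<lambda>z. exp (\<i> * (- (of_real t * z))) / (- \<i> * of_real t)) has_field_derivative exp (\<i> * (- (of_real t * of_real x)))) (at (of_real x))"
      by (simp only:)
    hence "((\<lambda>x. exp (\<i> * (- (of_real t * of_real x))) / (- \<i> * of_real t)) has_vector_derivative exp (\<i> * (- (of_real t * of_real x)))) (at x within {a..b})"
      by (rule has_vector_derivative_real_field)
    thus "((\<lambda>x. iexp (-(t * x)) / (- \<i> * t)) has_vector_derivative iexp (-(t * x))) (at x within {a..b})" by simp
  qed
  moreover have "iexp (-(t * b)) / (- \<i> * t) - iexp (-(t * a)) / (- \<i> * t) = levy_kernel a b t"
    using assms(2) by (simp add: levy_kernel_def field_simps)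
  ultimately have "integral {a..b} (\<lambda>x. iexp (-(t * x))) = levy_kernel a b t" by (simp add: integral_unique)
  moreover have "set_integrable lborel {a..b} (\<lambda>x. iexp (-(t * x)))"
    unfolding set_integrable_def by (intro borel_integrable_compact continuous_intros) auto
  hence "(LINT x:{a..b}|lborel. iexp (-(t * x))) = integral {a..b} (\<lambda>x. iexp (-(t * x)))"
    by (rule set_borel_integral_eq_integral)
  ultimately show ?thesis by (simp add: set_lebesgue_integral_def)
qed

lemma levy_kernel_Fubini:
  assumes "a \<le> b" and f: "integrable lborel f"
  shows "(LINT t|lborel. levy_kernel a b t * f t) =
           (LINT x|lborel. indicator {a..b} x *\<^sub>R (LINT t|lborel. iexp (-(t * x)) * f t))"
proof -
  have [measurable]: "f \<in> borel_measurable borel" using borel_measurable_integrable[OF f] by simp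
  let ?g = "\<lambda>t x. indicator {a..b} x *\<^sub>R (iexp (-(t * x)) * f t)"
  have ng: "norm (?g t x) = indicator {a..b} x * cmod (f t)" for t x
    by (simp add: norm_mult indicator_def)
  have ig: "integrable lborel (\<lambda>x. ?g t x)" for t
  proof -
    have "integrable lborel (\<lambda>x. indicator {a..b} x *\<^sub>R (iexp (-(t * x)) * f t))"
      by (intro borel_integrable_compact continuous_intros) auto
    thus ?thesis .
  qed
  have "integrable (lborel \<Otimes>\<^sub>M lborel) (\<lambda>(t, x). ?g t x)"
  proof (rule lborel_pair.Fubini_integrable)
    show "(\<lambda>(t, x). ?g t x) \<in> borel_measurable (lborel \<Otimes>\<^sub>M lborel)" by measurable
    have "(LINT x|lborel. norm (?g t x)) = (b - a) * cmod (f t)" for t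
      unfolding ng using assms(1) by simp
    thus "integrable lborel (\<lambda>t. LINT x|lborel. norm (case (t, x) of (t, x) \<Rightarrow> ?g t x))"
      using f by simp
    show "AE t in lborel. integrable lborel (\<lambda>x. case (t, x) of (t, x) \<Rightarrow> ?g t x)"
      using ig by (intro AE_I2) simp
  qed
  from lborel_pair.Fubini_integral[OF this]
  have swap: "(LINT x|lborel. (LINT t|lborel. ?g t x)) = (LINT t|lborel. (LINT x|lborel. ?g t x))" .
  have "(LINT t|lborel. (LINT x|lborel. ?g t x)) = (LINT t|lborel. levy_kernel a b t * f t)"
  proof (rule integral_cong_AE)
    have "AE t in lborel. t \<noteq> (0::real)" by (rule AE_lborel_singleton)
    thus "AE t in lborel. (LINT x|lborel. ?g t x) = levy_kernel a b t * f t"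
    proof eventually_elim
      case (elim t)
      have "(LINT x|lborel. ?g t x) = (LINT x|lborel. (indicator {a..b} x *\<^sub>R iexp (-(t * x))) * f t)"
        by (intro Bochner_Integration.integral_cong refl) simp
      also have "\<dots> = (LINT x|lborel. indicator {a..b} x *\<^sub>R iexp (-(t * x))) * f t" by (rule integral_mult_left_zero)
      finally show ?case using levy_kernel_integral[OF assms(1) elim] by simp
    qed
    show "(\<lambda>t. LINT x|lborel. ?g t x) \<in> borel_measurable lborel" by measurable
  qed measurable
  moreover have "(LINT t|lborel. ?g t x) = indicator {a..b} x *\<^sub>R (LINT t|lborel. iexp (-(t * x)) * f t)" for x
    by (rule integral_scaleR_right)
  ultimately show ?thesis using swap by simp
qed

text \<open>
  The constant \<open>p\<close> is \<open>p\<close> times the characteristic function of the unit mass at \<open>0\<close>, to which Levy's formula applies as well.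
  The truncated integrals of the integrable rest converge absolutely, and Fubini's theorem turns them into an
  integral of the inverse Fourier transform of \<open>f\<close> over the interval.
\<close>
lemma inversion_with_atom:
  fixes p :: real and f :: "real \<Rightarrow> complex"
  assumes N: "real_distribution N" and f: "integrable lborel f"
    and char: "\<And>t. char N t = of_real p + f t"
    and ab: "a \<le> b" "a \<noteq> 0" "b \<noteq> 0" "measure N {a} = 0" "measure N {b} = 0"
  shows "complex_of_real (measure N {a<..b}) = of_real (p * indicator {a<..b} 0) +
     1 / (2 * of_real pi) * (LINT x|lborel. indicator {a..b} x *\<^sub>R (LINT t|lborel. iexp (-(t * x)) * f t))"
proof -
  interpret N: real_distribution N by fact
  let ?\<delta> = "return borel (0::real)"
  interpret D: prob_space ?\<delta> by (rule prob_space_return) simp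
  interpret D: real_distribution ?\<delta> by unfold_locales simp_all
  let ?G = "levy_kernel a b"
  have [measurable]: "f \<in> borel_measurable borel" using borel_measurable_integrable[OF f] by simp
  have Gb: "cmod (?G t) \<le> b - a" for t by (rule levy_kernel_bound[OF ab(1)])
  have charD: "char ?\<delta> t = 1" for t unfolding char_def by (subst integral_return) auto
  have mD: "measure ?\<delta> A = indicator A 0" if "A \<in> sets borel" for A using that by (simp add: measure_return)
  have trunc: "(CLBINT t=ereal (real_of_int (- int n))..ereal (real n). (iexp (-(t * a)) - iexp (-(t * b))) / (\<i> * t) * h t)
     = (LINT t|lborel. indicator {-real n..real n} t *\<^sub>R (?G t * h t))" for n h
    by (subst interval_integral_Icc) (simp_all add: set_lebesgue_integral_def levy_kernel_def)
  have LN: "(\<lambda>n. 1 / (2 * pi) * (LINT t|lborel. indicator {-real n..real n} t *\<^sub>R (?G t * char N t))) \<longlonglongrightarrow> complex_of_real (measure N {a<..b})"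
    using N.Levy_Inversion[OF ab(1,4,5)] unfolding trunc .
  have LD: "(\<lambda>n. 1 / (2 * pi) * (LINT t|lborel. indicator {-real n..real n} t *\<^sub>R (?G t * 1))) \<longlonglongrightarrow> complex_of_real (indicator {a<..b} 0)"
    using D.Levy_Inversion[OF ab(1)] ab(2,3) unfolding trunc charD by (simp add: mD)
  have Gf: "integrable lborel (\<lambda>t. ?G t * f t)"
  proof (rule Bochner_Integration.integrable_bound)
    show "integrable lborel (\<lambda>t. (b - a) * cmod (f t))" using f by (intro integrable_mult_right integrable_norm)
    show "AE t in lborel. cmod (?G t * f t) \<le> norm ((b - a) * cmod (f t))"
      using ab(1) Gb by (intro AE_I2) (auto simp: norm_mult abs_mult intro!: mult_right_mono)
  qed measurable
  have Lf: "(\<lambda>n. LINT t|lborel. indicator {-real n..real n} t *\<^sub>R (?G t * f t)) \<longlonglongrightarrow> (LINT t|lborel. ?G t * f t)"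
    by (rule symmetric_truncation_limit[OF Gf])
  have split: "(LINT t|lborel. indicator {-real n..real n} t *\<^sub>R (?G t * char N t)) =
      of_real p * (LINT t|lborel. indicator {-real n..real n} t *\<^sub>R (?G t * 1)) +
      (LINT t|lborel. indicator {-real n..real n} t *\<^sub>R (?G t * f t))" for n
  proof -
    have i1: "integrable lborel (\<lambda>t. indicator {-real n..real n} t *\<^sub>R (?G t * 1))"
    proof (rule Bochner_Integration.integrable_bound)
      show "integrable lborel (\<lambda>t. (b - a) * indicator {-real n..real n} t)"
        by (intro integrable_mult_right integrable_real_indicator) (auto simp: emeasure_lborel_Icc_eq)
      show "AE t in lborel. cmod (indicator {-real n..real n} t *\<^sub>R (?G t * 1)) \<le> norm ((b - a) * indicator {-real n..real n} t)"
        using ab(1) Gb by (intro AE_I2) (auto simp: indicator_def)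
    qed measurable
    have i2: "integrable lborel (\<lambda>t. indicator {-real n..real n} t *\<^sub>R (?G t * f t))"
      using Gf by (intro integrable_mult_indicator) auto
    have "indicator {-real n..real n} t *\<^sub>R (?G t * char N t) = of_real p * (indicator {-real n..real n} t *\<^sub>R (?G t * 1))
       + indicator {-real n..real n} t *\<^sub>R (?G t * f t)" for t
      by (simp add: char algebra_simps indicator_def)
    hence "(LINT t|lborel. indicator {-real n..real n} t *\<^sub>R (?G t * char N t)) =
      (LINT t|lborel. of_real p * (indicator {-real n..real n} t *\<^sub>R (?G t * 1)) + indicator {-real n..real n} t *\<^sub>R (?G t * f t))"
      by (intro Bochner_Integration.integral_cong refl)
    also have "\<dots> = (LINT t|lborel. of_real p * (indicator {-real n..real n} t *\<^sub>R (?G t * 1))) + (LINT t|lborel. indicator {-real n..real n} t *\<^sub>R (?G t * f t))"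
      by (rule Bochner_Integration.integral_add[OF integrable_mult_right[OF i1] i2])
    finally show ?thesis by (simp only: integral_mult_right_zero)
  qed
  have "(\<lambda>n. of_real p * (1 / (2 * pi) * (LINT t|lborel. indicator {-real n..real n} t *\<^sub>R (?G t * 1))) +
      1 / (2 * pi) * (LINT t|lborel. indicator {-real n..real n} t *\<^sub>R (?G t * f t)))
      \<longlonglongrightarrow> of_real p * complex_of_real (indicator {a<..b} 0) + 1 / (2 * pi) * (LINT t|lborel. ?G t * f t)"
    by (intro tendsto_add tendsto_mult_left LD Lf)
  moreover have "1 / (2 * pi) * (LINT t|lborel. indicator {-real n..real n} t *\<^sub>R (?G t * char N t)) =
     of_real p * (1 / (2 * pi) * (LINT t|lborel. indicator {-real n..real n} t *\<^sub>R (?G t * 1))) +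
      1 / (2 * pi) * (LINT t|lborel. indicator {-real n..real n} t *\<^sub>R (?G t * f t))" for n
    unfolding split by (simp only: distrib_left mult.left_commute)
  ultimately have "(\<lambda>n. 1 / (2 * pi) * (LINT t|lborel. indicator {-real n..real n} t *\<^sub>R (?G t * char N t)))
      \<longlonglongrightarrow> of_real p * complex_of_real (indicator {a<..b} 0) + 1 / (2 * pi) * (LINT t|lborel. ?G t * f t)"
    by (simp only:)
  from LIMSEQ_unique[OF LN this] show ?thesis
    unfolding levy_kernel_Fubini[OF ab(1) f] by simp
qed

text \<open>
  The hypothesis speaks only of intervals whose ends are not atoms. A distribution has countably many atoms, so any point
  \<open>x \<noteq> 0\<close> lies in arbitrarily short admissible intervals, whose masses are at most \<open>K\<close> times their length; hence
  there is no atom except at \<open>0\<close>. There, shrinking intervals give mass \<open>p\<close>. After removing this atom, \<open>N\<close> and the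
  measure with density \<open>k\<close> agree on half-lines.
\<close>
lemma distribution_of_interval_masses:
  fixes k :: "real \<Rightarrow> real" and p K :: real
  assumes N: "real_distribution N" and cont: "continuous_on UNIV k" and K: "K > 0" "\<And>x. \<bar>k x\<bar> \<le> K"
    and inv: "\<And>a b. a < b \<Longrightarrow> a \<noteq> 0 \<Longrightarrow> b \<noteq> 0 \<Longrightarrow> measure N {a} = 0 \<Longrightarrow> measure N {b} = 0 \<Longrightarrow>
        measure N {a<..b} = p * indicator {a<..b} 0 + (LINT x|lborel. indicator {a..b} x * k x)"
  shows "x \<noteq> 0 \<Longrightarrow> k x \<ge> 0"
    "f \<in> borel_measurable borel \<Longrightarrow> (\<integral>\<^sup>+x. f x \<partial>N) = ennreal p * f 0 + (\<integral>\<^sup>+x. ennreal (k x) * f x \<partial>lborel)"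
proof -
  interpret N: real_distribution N by fact
  define I where "I = (\<lambda>a b. LINT x|lborel. indicator {a..b} x * k x)"
  have k_meas [measurable]: "k \<in> borel_measurable borel" using cont by (rule borel_measurable_continuous_onI)
  have int: "integrable lborel (\<lambda>x. indicator {a..b} x * k x)" for a b
    using borel_integrable_compact[of "{a..b}" k] continuous_on_subset[OF cont] by simp
  have I_le: "I a b \<le> c * (b - a)" if ab: "a < b" and c: "\<And>x. x \<in> {a..b} \<Longrightarrow> k x \<le> c" for a b c
  proof -
    have "I a b \<le> (LINT x|lborel. indicator {a..b} x * c)"
      unfolding I_def
    proof (rule integral_mono[OF int])
      show "integrable lborel (\<lambda>x. indicator {a..b} x * c)"
        by (intro integrable_mult_left integrable_real_indicator) (auto simp: emeasure_lborel_Icc_eq)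
    qed (use c in \<open>auto simp: indicator_def\<close>)
    also have "\<dots> = c * (b - a)" using ab by simp
    finally show ?thesis .
  qed
  have I_ge: "- (K * (b - a)) \<le> I a b" if ab: "a < b" for a b
  proof -
    have "(LINT x|lborel. indicator {a..b} x * (- K)) \<le> I a b"
      unfolding I_def
    proof (rule integral_mono[OF _ int])
      show "integrable lborel (\<lambda>x. indicator {a..b} x * (- K))"
        by (intro integrable_mult_left integrable_real_indicator) (auto simp: emeasure_lborel_Icc_eq)
      show "indicator {a..b} x * (- K) \<le> indicator {a..b} x * k x" for x
        using K(2)[of x] by (auto simp: indicator_def)
    qed
    moreover have "(LINT x|lborel. indicator {a..b} x * (- K)) = - (K * (b - a))" using ab by simp
    ultimately show ?thesis by (simp only:)
  qed
  have I_leK: "I a b \<le> K * (b - a)" if "a < b" for a b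
    using K(2) by (intro I_le that) (meson abs_le_D1)
  have good: "\<exists>g. c < g \<and> g < d \<and> g \<noteq> 0 \<and> measure N {g} = 0" if "c < d" for c d
  proof -
    have "countable ({x. measure N {x} \<noteq> 0} \<union> {0})" using N.countable_support by simp
    moreover have "uncountable {c<..<d}" using that by (simp add: uncountable_open_interval)
    ultimately have "\<not> {c<..<d} \<subseteq> {x. measure N {x} \<noteq> 0} \<union> {0}" using countable_subset by blast
    thus ?thesis by auto
  qed
  have no_atom: "measure N {x} = 0" if x: "x \<noteq> 0" for x
  proof (rule ccontr)
    assume "measure N {x} \<noteq> 0"
    hence m: "measure N {x} > 0" by (simp add: zero_less_measure_iff)
    \<comment> \<open>intervals within distance \<open>e\<close> of \<open>x\<close> avoid \<open>0\<close> and have at most half the mass of the alleged atom\<close>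
    define e where "e = min \<bar>x\<bar> (measure N {x} / (4 * K))"
    have e: "e > 0" "e \<le> \<bar>x\<bar>" "e \<le> measure N {x} / (4 * K)" using x m K by (auto simp: e_def)
    obtain g where g: "x - e < g" "g < x" "g \<noteq> 0" "measure N {g} = 0" using good[of "x - e" x] e by auto
    obtain h where h: "x < h" "h < x + e" "h \<noteq> 0" "measure N {h} = 0" using good[of x "x + e"] e by auto
    have "0 \<notin> {g<..h}" using g h e(2) by auto
    hence "measure N {g<..h} = I g h" using inv[of g h] g h by (simp add: I_def)
    also have "\<dots> \<le> K * (h - g)" using g h by (intro I_leK) auto
    also have "\<dots> \<le> K * (2 * e)" using g h K by (intro mult_left_mono) auto
    also have "\<dots> \<le> measure N {x} / 2" using e(3) K by (simp add: field_simps)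
    also have "\<dots> < measure N {x}" using m by simp
    also have "measure N {x} \<le> measure N {g<..h}" using g h by (intro N.finite_measure_mono) auto
    finally show False by simp
  qed
  have interval: "measure N {a<..b} = p * indicator {a<..b} 0 + I a b" if "a < b" "a \<noteq> 0" "b \<noteq> 0" for a b
    unfolding I_def using that by (intro inv no_atom)
  show k_nonneg: "k x \<ge> 0" if x: "x \<noteq> 0" for x
  proof (rule ccontr)
    assume "\<not> k x \<ge> 0"
    hence kx: "k x < 0" by simp
    have "isCont k x" using cont by (simp add: continuous_on_eq_continuous_at)
    then obtain d where d: "d > 0" "\<And>y. dist y x < d \<Longrightarrow> dist (k y) (k x) < - k x / 2"
      using kx unfolding continuous_at_eps_delta by (metis half_gt_zero neg_0_less_iff_less)
    define e where "e = min d \<bar>x\<bar>"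
    have e: "e > 0" "e \<le> d" "e \<le> \<bar>x\<bar>" using d x by (auto simp: e_def)
    have "measure N {x - e / 2<..x + e / 2} = I (x - e / 2) (x + e / 2)"
      using interval[of "x - e / 2" "x + e / 2"] e by (auto simp: indicator_def split: if_splits)
    also have "\<dots> \<le> (k x / 2) * ((x + e / 2) - (x - e / 2))"
    proof (rule I_le)
      fix y assume "y \<in> {x - e / 2..x + e / 2}"
      hence "dist y x < d" using e by (auto simp: dist_real_def abs_if)
      from d(2)[OF this] show "k y \<le> k x / 2" by (auto simp: dist_real_def abs_if split: if_splits)
    qed (use e in auto)
    also have "\<dots> < 0" using kx e by (simp add: mult_neg_pos)
    finally show False using measure_nonneg[of N] by (simp add: not_less[symmetric])
  qed
  have atom: "measure N {0} = p"
  proof -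
    let ?A = "\<lambda>n. {- (1 / real (Suc n))<..1 / real (Suc n)}"
    have mono: "1 / real (Suc n) \<le> 1 / real (Suc m)" if "m \<le> n" for m n
      using that by (intro divide_left_mono) auto
    have "(\<lambda>n. measure N (?A n)) \<longlonglongrightarrow> measure N (\<Inter>n. ?A n)"
    proof (rule N.finite_Lim_measure_decseq)
      show "decseq ?A" unfolding decseq_def
      proof (intro allI impI subsetI)
        fix m n x assume "m \<le> n" "x \<in> ?A n"
        thus "x \<in> ?A m" using mono[OF \<open>m \<le> n\<close>] by auto
      qed
    qed auto
    moreover have "(\<Inter>n. ?A n) = {0}"
    proof (intro equalityI subsetI)
      fix x assume x: "x \<in> (\<Inter>n. ?A n)"
      show "x \<in> {0}"
      proof (rule ccontr)
        assume "x \<notin> {0}"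
        then obtain n where "1 / real (Suc n) < \<bar>x\<bar>" using nat_approx_posE[of "\<bar>x\<bar>"] by auto
        thus False using x by (auto simp: abs_if split: if_splits dest!: spec[of _ n])
      qed
    qed (auto simp: divide_less_0_iff)
    moreover have "measure N (?A n) = p + I (- (1 / real (Suc n))) (1 / real (Suc n))" for n
    proof -
      have "0 < 1 / real (Suc n)" by simp
      hence "- (1 / real (Suc n)) < 0" "0 < 1 / real (Suc n)" by linarith+
      thus ?thesis using interval[of "- (1 / real (Suc n))" "1 / real (Suc n)"] by (simp add: indicator_def del: of_nat_Suc)
    qed
    moreover have "(\<lambda>n. p + I (- (1 / real (Suc n))) (1 / real (Suc n))) \<longlonglongrightarrow> p + 0"
    proof (rule tendsto_add[OF tendsto_const], rule Lim_null_comparison)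
      show "\<forall>\<^sub>F n in sequentially. norm (I (- (1 / real (Suc n))) (1 / real (Suc n))) \<le> K * (2 * inverse (real (Suc n)))"
      proof (intro always_eventually allI)
        fix n
        have l: "- (1 / real (Suc n)) < 1 / real (Suc n)" by (simp add: field_simps)
        have "K * (1 / real (Suc n) - (- (1 / real (Suc n)))) = K * (2 * inverse (real (Suc n)))" by (simp add: divide_inverse)
        thus "norm (I (- (1 / real (Suc n))) (1 / real (Suc n))) \<le> K * (2 * inverse (real (Suc n)))"
          using I_leK[OF l] I_ge[OF l] by (simp only: real_norm_def)
      qed
      have "(\<lambda>n. K * (2 * inverse (real (Suc n)))) \<longlonglongrightarrow> K * (2 * 0)"
        by (intro tendsto_mult_left LIMSEQ_inverse_real_of_nat)
      thus "(\<lambda>n. K * (2 * inverse (real (Suc n)))) \<longlonglongrightarrow> 0" by simp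
    qed
    ultimately show ?thesis using LIMSEQ_unique by fastforce
  qed
  define N' where "N' = density N (indicator (- {0}))"
  define D where "D = density lborel (\<lambda>x. ennreal (k x))"
  have N'_em: "emeasure N' A = emeasure N (A - {0})" if "A \<in> sets borel" for A
  proof -
    have "emeasure N' A = (\<integral>\<^sup>+x. indicator (- {0}) x * indicator A x \<partial>N)"
      unfolding N'_def using that by (intro emeasure_density) auto
    also have "\<dots> = (\<integral>\<^sup>+x. indicator (A - {0}) x \<partial>N)" by (intro nn_integral_cong) (auto simp: indicator_def)
    also have "\<dots> = emeasure N (A - {0})" using that by (intro nn_integral_indicator) auto
    finally show ?thesis .
  qed
  have k_AE: "AE x in lborel. 0 \<le> k x"
    using AE_lborel_singleton[of 0] by eventually_elim (rule k_nonneg)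
  have intervals: "emeasure N' {a<..b} = emeasure D {a<..b}" if "a < b" "a \<noteq> 0" "b \<noteq> 0" for a b
  proof -
    have "emeasure N' {a<..b} = ennreal (measure N ({a<..b} - {0}))" by (simp add: N'_em N.emeasure_eq_measure)
    also have "measure N ({a<..b} - {0}) = I a b"
    proof (cases "0 \<in> {a<..b}")
      case True
      hence "measure N ({a<..b} - {0}) = measure N {a<..b} - measure N {0}" by (intro N.finite_measure_Diff) auto
      thus ?thesis using interval[OF that] atom True by simp
    next
      case False
      hence "{a<..b} - {0} = {a<..b}" by auto
      thus ?thesis using interval[OF that] False by simp
    qed
    also have "ennreal (I a b) = (\<integral>\<^sup>+x. ennreal (indicator {a..b} x * k x) \<partial>lborel)"
      unfolding I_def using k_AE by (intro nn_integral_eq_integral[symmetric] int) (auto elim!: eventually_mono)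
    also have "\<dots> = (\<integral>\<^sup>+x. ennreal (k x) * indicator {a<..b} x \<partial>lborel)"
      using AE_lborel_singleton[of a] by (intro nn_integral_cong_AE) (auto elim!: eventually_mono simp: indicator_def)
    also have "\<dots> = emeasure D {a<..b}" unfolding D_def by (intro emeasure_density[symmetric]) auto
    finally show ?thesis .
  qed
  have N'_D: "N' = D"
  proof (rule measure_eqI_lessThan)
    show "sets N' = sets borel" "sets D = sets borel" by (simp_all add: N'_def D_def)
    show "emeasure N' {x<..} < \<infinity>" for x by (simp add: N'_em N.emeasure_eq_measure)
    fix x :: real
    \<comment> \<open>exhaust the half-line by intervals whose end points differ from \<open>0\<close>\<close>
    define a where "a = (\<lambda>n. if x = 0 then 1 / real (Suc n) else x)"
    define b where "b = (\<lambda>n. \<bar>x\<bar> + real n + 2)"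
    have inc: "incseq (\<lambda>n. {a n<..b n})"
    proof (rule incseq_SucI)
      fix n
      have "1 / real (Suc (Suc n)) \<le> 1 / real (Suc n)" by (intro divide_left_mono) auto
      thus "{a n<..b n} \<subseteq> {a (Suc n)<..b (Suc n)}" by (auto simp: a_def b_def)
    qed
    have Un: "(\<Union>n. {a n<..b n}) = {x<..}"
    proof (intro equalityI subsetI)
      fix y assume "y \<in> (\<Union>n. {a n<..b n})"
      then obtain n where n: "a n < y" by auto
      have "0 < 1 / real (Suc n)" by simp
      hence "x \<le> a n" by (simp add: a_def del: of_nat_Suc)
      thus "y \<in> {x<..}" using n by simp
    next
      fix y assume y: "y \<in> {x<..}"
      obtain n1 where n1: "real n1 \<ge> y" using real_arch_simple by blast
      have "\<exists>n2. \<forall>n\<ge>n2. a n < y"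
      proof (cases "x = 0")
        case True
        then obtain n2 where n2: "1 / real (Suc n2) < y" using y nat_approx_posE[of y] by auto
        have "1 / real (Suc n) < y" if "n \<ge> n2" for n
        proof -
          have "1 / real (Suc n) \<le> 1 / real (Suc n2)" using that by (intro divide_left_mono) auto
          thus ?thesis using n2 by simp
        qed
        thus ?thesis using True by (auto simp: a_def)
      qed (use y in \<open>auto simp: a_def\<close>)
      then obtain n2 where n2: "\<forall>n\<ge>n2. a n < y" by blast
      have "a (max n1 n2) < y" using n2 by simp
      moreover have "y \<le> b (max n1 n2)" using n1 by (simp add: b_def)
      ultimately show "y \<in> (\<Union>n. {a n<..b n})" by auto
    qed
    have ab: "a n < b n" "a n \<noteq> 0" "b n \<noteq> 0" for n
    proof -
      show "a n < b n"
      proof (cases "x = 0")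
        case True
        have "1 / real (Suc n) \<le> 1" by simp
        also have "1 < \<bar>x\<bar> + real n + 2" by simp
        finally show ?thesis using True by (simp only: a_def b_def simp_thms if_True)
      qed (simp add: a_def b_def)
      show "a n \<noteq> 0" "b n \<noteq> 0" by (auto simp: a_def b_def)
    qed
    have "emeasure N' {x<..} = (SUP n. emeasure N' {a n<..b n})"
      unfolding Un[symmetric] by (rule SUP_emeasure_incseq[symmetric, OF _ inc]) (auto simp: N'_def)
    also have "\<dots> = (SUP n. emeasure D {a n<..b n})" by (simp only: intervals[OF ab])
    also have "\<dots> = emeasure D {x<..}"
      unfolding Un[symmetric] by (rule SUP_emeasure_incseq[OF _ inc]) (auto simp: D_def)
    finally show "emeasure N' {x<..} = emeasure D {x<..}" .
  qed
  assume f: "f \<in> borel_measurable borel"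
  have [measurable]: "f \<in> borel_measurable N" using f by simp
  have "(\<integral>\<^sup>+x. f x \<partial>N) = (\<integral>\<^sup>+x. f x * indicator {0} x + indicator (- {0}) x * f x \<partial>N)"
    by (intro nn_integral_cong) (auto simp: indicator_def)
  also have "\<dots> = (\<integral>\<^sup>+x. f x * indicator {0} x \<partial>N) + (\<integral>\<^sup>+x. indicator (- {0}) x * f x \<partial>N)"
    by (rule nn_integral_add) auto
  also have "(\<integral>\<^sup>+x. f x * indicator {0} x \<partial>N) = ennreal p * f 0"
  proof -
    have "(\<integral>\<^sup>+x. f x * indicator {0} x \<partial>N) = (\<integral>\<^sup>+x. f 0 * indicator {0} x \<partial>N)"
      by (intro nn_integral_cong) (auto simp: indicator_def)
    also have "\<dots> = f 0 * emeasure N {0}" by (rule nn_integral_cmult_indicator) auto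
    finally show ?thesis by (simp add: N.emeasure_eq_measure atom mult.commute)
  qed
  also have "(\<integral>\<^sup>+x. indicator (- {0}) x * f x \<partial>N) = (\<integral>\<^sup>+x. f x \<partial>N')"
    unfolding N'_def by (rule nn_integral_density[symmetric]) auto
  also have "\<dots> = (\<integral>\<^sup>+x. ennreal (k x) * f x \<partial>lborel)"
    unfolding N'_D D_def using f by (intro nn_integral_density) auto
  finally show "(\<integral>\<^sup>+x. f x \<partial>N) = ennreal p * f 0 + (\<integral>\<^sup>+x. ennreal (k x) * f x \<partial>lborel)" .
qed

section \<open>The density of the potential measure\<close>

context
  fixes \<beta> :: real
  assumes beta_pos: "\<beta> > 0"
begin

lemma inverse_fourier_real: "1 / (2 * of_real pi) * (LINT t|lborel. iexp (t * x) * F \<beta> (Complex 1 t)) = of_real (tilted_density \<beta> x)"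
proof -
  define L where "L = (LINT t|lborel. iexp (t * x) * F \<beta> (Complex 1 t))"
  have "cnj L = (LINT t|lborel. cnj (iexp (t * x) * F \<beta> (Complex 1 t)))"
    unfolding L_def by (rule Bochner_Integration.integral_cnj[symmetric])
  also have "\<dots> = (LINT t|lborel. iexp ((- t) * x) * F \<beta> (Complex 1 (- t)))"
  proof (intro Bochner_Integration.integral_cong refl)
    fix t :: real
    have "Complex 1 (- t) = cnj (Complex 1 t)" by (simp add: complex_eq_iff)
    thus "cnj (iexp (t * x) * F \<beta> (Complex 1 t)) = iexp ((- t) * x) * F \<beta> (Complex 1 (- t))"
      by (simp add: exp_cnj F_cnj[OF beta_pos])
  qed
  also have "\<dots> = L" unfolding L_def by (rule LINT_reflect)
  finally have "L \<in> \<real>" by (simp add: Reals_cnj_iff)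
  hence "1 / (2 * of_real pi) * L \<in> \<real>" by (intro Reals_mult) simp_all
  hence "1 / (2 * of_real pi) * L = of_real (Re (1 / (2 * of_real pi) * L))"
    by (simp only: of_real_Re)
  thus ?thesis unfolding L_def tilted_density_def[OF beta_pos] .
qed

text \<open>
  The tilted potential measure has characteristic function \<open>a \<eta> + a F(1 - i t)\<close> with \<open>a = \<phi>(1)\<close>. The inversion
  theorem gives its atom and its density, and multiplication by \<open>exp x / a\<close> undoes the tilt. As the potential measure
  does not charge the negative half-line, the density vanishes there almost everywhere.
\<close>
theorem potential_measure_decomposition:
  assumes sub: "subordinator M \<xi>" and lap: "has_laplace_exponent M \<xi> (phi \<beta>)"
  shows "x \<noteq> 0 \<Longrightarrow> tilted_density \<beta> x \<ge> 0"
    "A \<in> sets borel \<Longrightarrow> emeasure (potential_measure M \<xi>) A = ennreal (eta \<beta>) * indicator A 0 +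
       (\<integral>\<^sup>+ x \<in> A \<inter> {0<..}. ennreal (exp x * tilted_density \<beta> x) \<partial>lborel)"
proof -
  interpret S: subordinator_exponent M \<xi> "phi \<beta>"
    using sub lap Re_phi_pos[OF beta_pos] by unfold_locales
  have real: "cnj (phi \<beta> 1) = phi \<beta> 1" using phi_cnj[of \<beta> 1] by simp
  define a where "a = Re (phi \<beta> 1)"
  have a: "a > 0" unfolding a_def by (rule Re_phi_pos[OF beta_pos]) auto
  have eta: "eta \<beta> > 0" using B0_pos[OF beta_pos] by (simp add: eta_eq[OF beta_pos])
  let ?k = "\<lambda>x. a * tilted_density \<beta> x"
  let ?f = "\<lambda>t. of_real a * F \<beta> (Complex 1 (- t))"
  have cont: "continuous_on UNIV ?k" by (intro continuous_intros tilted_density_continuous[OF beta_pos])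
  obtain K0 where K0: "K0 > 0" "\<And>x. \<bar>tilted_density \<beta> x\<bar> \<le> K0" using tilted_density_bounded[OF beta_pos] by blast
  have K: "a * K0 > 0" "\<bar>?k x\<bar> \<le> a * K0" for x using a K0 by (auto simp: abs_mult)
  have f: "integrable lborel ?f"
    using lborel_integrable_real_affine[OF F_right(2)[OF beta_pos], of "-1" 0] by (intro integrable_mult_right) simp
  have char: "char S.tilted t = of_real (a * eta \<beta>) + ?f t" for t
  proof -
    have "Complex 1 (- t) = 1 - \<i> * of_real t" by (simp add: complex_eq_iff)
    thus ?thesis unfolding S.char_tilted[OF real] a_def[symmetric] by (simp add: F_def right_diff_distrib)
  qed
  have inv: "measure S.tilted {c<..b} = (a * eta \<beta>) * indicator {c<..b} 0 + (LINT x|lborel. indicator {c..b} x * ?k x)"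
    if cb: "c < b" "c \<noteq> 0" "b \<noteq> 0" "measure S.tilted {c} = 0" "measure S.tilted {b} = 0" for c b
  proof -
    have inner: "1 / (2 * of_real pi) * (LINT t|lborel. iexp (-(t * x)) * ?f t) = of_real (?k x)" for x
    proof -
      have "(LINT t|lborel. iexp (-(t * x)) * ?f t) = (LINT t|lborel. of_real a * (iexp ((- t) * x) * F \<beta> (Complex 1 (- t))))"
        by (intro Bochner_Integration.integral_cong refl) (simp add: mult_ac)
      also have "\<dots> = of_real a * (LINT t|lborel. iexp ((- t) * x) * F \<beta> (Complex 1 (- t)))" by (rule integral_mult_right_zero)
      also have "(LINT t|lborel. iexp ((- t) * x) * F \<beta> (Complex 1 (- t))) = (LINT t|lborel. iexp (t * x) * F \<beta> (Complex 1 t))"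
        by (rule LINT_reflect)
      finally have "1 / (2 * of_real pi) * (LINT t|lborel. iexp (-(t * x)) * ?f t) =
          of_real a * (1 / (2 * of_real pi) * (LINT t|lborel. iexp (t * x) * F \<beta> (Complex 1 t)))"
        by (simp only: mult.left_commute)
      thus ?thesis unfolding inverse_fourier_real by (simp only: of_real_mult)
    qed
    have "1 / (2 * of_real pi) * (LINT x|lborel. indicator {c..b} x *\<^sub>R (LINT t|lborel. iexp (-(t * x)) * ?f t)) =
       (LINT x|lborel. 1 / (2 * of_real pi) * (indicator {c..b} x *\<^sub>R (LINT t|lborel. iexp (-(t * x)) * ?f t)))"
      by (rule integral_mult_right_zero[symmetric])
    also have "\<dots> = (LINT x|lborel. complex_of_real (indicator {c..b} x * ?k x))"
    proof (intro Bochner_Integration.integral_cong refl)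
      fix x :: real
      have "1 / (2 * of_real pi) * (indicator {c..b} x *\<^sub>R (LINT t|lborel. iexp (-(t * x)) * ?f t)) =
         indicator {c..b} x *\<^sub>R (1 / (2 * of_real pi) * (LINT t|lborel. iexp (-(t * x)) * ?f t))" by (rule mult_scaleR_right)
      also have "\<dots> = of_real (indicator {c..b} x * ?k x)" unfolding inner by (simp only: scaleR_conv_of_real of_real_mult)
      finally show "1 / (2 * of_real pi) * (indicator {c..b} x *\<^sub>R (LINT t|lborel. iexp (-(t * x)) * ?f t)) = of_real (indicator {c..b} x * ?k x)" .
    qed
    also have "\<dots> = of_real (LINT x|lborel. indicator {c..b} x * ?k x)" by (rule integral_complex_of_real)
    finally have "complex_of_real (measure S.tilted {c<..b}) = of_real ((a * eta \<beta>) * indicator {c<..b} 0) + of_real (LINT x|lborel. indicator {c..b} x * ?k x)"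
      using inversion_with_atom[OF S.tilted_real_distribution[OF real] f char less_imp_le[OF cb(1)] cb(2-5)] by (simp only:)
    thus ?thesis by (simp only: of_real_add[symmetric] of_real_eq_iff)
  qed
  note dist = distribution_of_interval_masses[OF S.tilted_real_distribution[OF real] cont K]
  show td: "tilted_density \<beta> x \<ge> 0" if "x \<noteq> 0" for x
  proof -
    have "0 \<le> ?k x"
      by (rule dist(1), rule inv, assumption+, rule that)
    thus ?thesis using a by (simp add: zero_le_mult_iff)
  qed
  have td_meas [measurable]: "tilted_density \<beta> \<in> borel_measurable borel"
    using tilted_density_continuous[OF beta_pos] by (rule borel_measurable_continuous_onI)
  have full: "emeasure (potential_measure M \<xi>) A = ennreal (eta \<beta>) * indicator A 0 +
      (\<integral>\<^sup>+x. ennreal (exp x * tilted_density \<beta> x) * indicator A x \<partial>lborel)" if A [measurable]: "A \<in> sets borel" for A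
  proof -
    have "emeasure (potential_measure M \<xi>) A = (\<integral>\<^sup>+x. indicator A x \<partial>potential_measure M \<xi>)" by simp
    also have "\<dots> = (\<integral>\<^sup>+x. ennreal (a * exp (- x)) * (ennreal (exp x / a) * indicator A x) \<partial>potential_measure M \<xi>)"
    proof (intro nn_integral_cong)
      fix x :: real
      have "(a * exp (- x)) * (exp x / a) = 1" using a by (simp add: exp_minus)
      hence "ennreal (a * exp (- x)) * ennreal (exp x / a) = 1" using a by (simp flip: ennreal_mult')
      thus "indicator A x = ennreal (a * exp (- x)) * (ennreal (exp x / a) * indicator A x)" by (simp add: mult.assoc[symmetric])
    qed
    also have "\<dots> = (\<integral>\<^sup>+x. ennreal (exp x / a) * indicator A x \<partial>S.tilted)"
      unfolding S.tilted_def a_def[symmetric] by (rule nn_integral_density[symmetric]) measurable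
    also have "\<dots> = ennreal (a * eta \<beta>) * (ennreal (exp 0 / a) * indicator A 0) + (\<integral>\<^sup>+x. ennreal (?k x) * (ennreal (exp x / a) * indicator A x) \<partial>lborel)"
      by (rule dist(2), rule inv, assumption+) measurable
    also have "ennreal (a * eta \<beta>) * (ennreal (exp 0 / a) * indicator A 0) = ennreal (eta \<beta>) * indicator A 0"
    proof -
      have "(a * eta \<beta>) * (exp 0 / a) = eta \<beta>" using a by simp
      hence "ennreal (a * eta \<beta>) * ennreal (exp 0 / a) = ennreal (eta \<beta>)" using a eta by (metis ennreal_mult' less_imp_le mult_pos_pos)
      thus ?thesis by (simp only: mult.assoc[symmetric])
    qed
    also have "(\<integral>\<^sup>+x. ennreal (?k x) * (ennreal (exp x / a) * indicator A x) \<partial>lborel) = (\<integral>\<^sup>+x. ennreal (exp x * tilted_density \<beta> x) * indicator A x \<partial>lborel)"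
    proof (rule nn_integral_cong_AE)
      show "AE x in lborel. ennreal (?k x) * (ennreal (exp x / a) * indicator A x) = ennreal (exp x * tilted_density \<beta> x) * indicator A x"
        using AE_lborel_singleton[of 0]
      proof eventually_elim
        case (elim x)
        have "?k x * (exp x / a) = exp x * tilted_density \<beta> x" using a by simp
        moreover have "0 \<le> ?k x" using td[OF elim] a by simp
        ultimately have "ennreal (?k x) * ennreal (exp x / a) = ennreal (exp x * tilted_density \<beta> x)" by (metis ennreal_mult')
        thus ?case by (simp only: mult.assoc[symmetric])
      qed
    qed
    finally show ?thesis .
  qed
  have neg: "emeasure (potential_measure M \<xi>) {..<0} = 0"
  proof -
    have "emeasure (potential_measure M \<xi>) {..<0} = (\<integral>\<^sup>+x. indicator {..<0} x \<partial>potential_measure M \<xi>)" by simp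
    also have "\<dots> = (\<integral>\<^sup>+t. (\<integral>\<^sup>+\<omega>. indicator {..<0} (\<xi> t \<omega>) \<partial>M) * indicator {0..} t \<partial>lborel)"
      by (rule S.nn_integral_potential) simp
    also have "\<dots> = (\<integral>\<^sup>+t. 0 \<partial>(lborel :: real measure))"
    proof (rule nn_integral_cong)
      fix t :: real
      show "(\<integral>\<^sup>+\<omega>. indicator {..<0} (\<xi> t \<omega>) \<partial>M) * indicator {0..} t = (0::ennreal)"
      proof (cases "t \<ge> 0")
        case True
        have "(\<integral>\<^sup>+\<omega>. indicator {..<0} (\<xi> t \<omega>) \<partial>M) = (\<integral>\<^sup>+\<omega>. 0 \<partial>M)"
          by (rule nn_integral_cong_AE) (use S.xi_nonneg[OF True] in \<open>auto elim!: eventually_mono\<close>)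
        thus ?thesis by simp
      qed simp
    qed
    finally show ?thesis by simp
  qed
  let ?d = "\<lambda>x. ennreal (exp x * tilted_density \<beta> x)"
  have "(\<integral>\<^sup>+x. ?d x * indicator {..<0} x \<partial>lborel) = 0" using full[of "{..<0}"] neg by simp
  hence zero: "AE x in lborel. ?d x * indicator {..<0} x = 0" by (subst (asm) nn_integral_0_iff_AE) measurable
  assume A: "A \<in> sets borel"
  have "(\<integral>\<^sup>+x. ?d x * indicator A x \<partial>lborel) = (\<integral>\<^sup>+x. ?d x * indicator (A \<inter> {0<..}) x \<partial>lborel)"
  proof (rule nn_integral_cong_AE)
    show "AE x in lborel. ?d x * indicator A x = ?d x * indicator (A \<inter> {0<..}) x"
      using zero AE_lborel_singleton[of 0] by eventually_elim (auto simp: indicator_def split: if_splits)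
  qed
  thus "emeasure (potential_measure M \<xi>) A = ennreal (eta \<beta>) * indicator A 0 +
       (\<integral>\<^sup>+ x \<in> A \<inter> {0<..}. ennreal (exp x * tilted_density \<beta> x) \<partial>lborel)"
    using full[OF A] by simp
qed

end

section \<open>The expansions\<close>

lemma zeros_strip_cnj:
  assumes "\<rho> \<in> zeros_strip \<beta> \<sigma>"
  shows "cnj \<rho> \<in> zeros_strip \<beta> \<sigma>"
  using assms by (auto simp: zeros_strip_def zeros_def isolated_zero_phi_cnj)

lemma sum_zeros_strip_real:
  assumes "\<And>\<rho>. \<rho> \<in> zeros_strip \<beta> \<sigma> \<Longrightarrow> f (cnj \<rho>) = cnj (f \<rho>)"
  shows "(\<Sum>\<rho>\<in>zeros_strip \<beta> \<sigma>. f \<rho>) \<in> \<real>"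
proof -
  have "cnj (\<Sum>\<rho>\<in>zeros_strip \<beta> \<sigma>. f \<rho>) = (\<Sum>\<rho>\<in>zeros_strip \<beta> \<sigma>. f (cnj \<rho>))"
    using assms by simp
  also have "\<dots> = (\<Sum>\<rho>\<in>zeros_strip \<beta> \<sigma>. f \<rho>)"
    by (rule sum.reindex_bij_witness[of _ cnj cnj]) (auto intro: zeros_strip_cnj)
  finally show ?thesis by (simp add: Reals_cnj_iff)
qed

lemma harm_real: "(harm n :: complex) \<in> \<real>"
  unfolding harm_def by (intro sum_in_Reals Reals_inverse) simp

context
  fixes \<beta> :: real
  assumes beta_pos: "\<beta> > 0"
begin

lemma mu_real: "mu \<beta> \<in> \<real>"
  using mu_eq[OF beta_pos] by auto

text \<open>
  By \<open>rice_residue_at_0\<close> with \<open>n = 1\<close> the constant is the residue at the real point \<open>0\<close> of a function that commutes with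
  conjugation.
\<close>
lemma expansion_constant_real: "(deriv ^^ 2) (phi \<beta>) 0 / (2 * (mu \<beta>)\<^sup>2) \<in> \<real>"
proof -
  let ?f = "\<lambda>z. rice_kernel 1 z * (1 / phi \<beta> z)"
  obtain A where A: "open A" "0 \<in> A" "(\<lambda>z. 1 / phi \<beta> z) holomorphic_on A - {0}"
    by (rule phi_reciprocal_punctured[OF beta_pos, of 0])
  have "residue ?f (cnj 0) = cnj (residue ?f 0)"
  proof (rule residue_cnj[OF _ A(1,2)])
    show "?f (cnj z) = cnj (?f z)" for z by (simp add: rice_kernel_def phi_cnj)
    show "?f holomorphic_on A - {0}"
      by (intro holomorphic_on_mult A(3)) (auto simp: rice_kernel_def intro!: holomorphic_intros)
  qed
  hence "residue ?f 0 \<in> \<real>" by (simp add: Reals_cnj_iff)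
  moreover have "residue ?f 0 = (deriv ^^ 2) (phi \<beta>) 0 / (2 * (mu \<beta>)\<^sup>2)"
    using rice_residue_at_0[OF beta_pos, of 1] by (simp add: harm_def)
  ultimately show ?thesis by (simp only:)
qed

lemma u_term_sum_real: "(\<Sum>\<rho>\<in>zeros_strip \<beta> \<sigma>. u_term \<beta> \<rho> x) \<in> \<real>"
  by (rule sum_zeros_strip_real, rule u_term_cnj[OF beta_pos]) (simp add: zeros_strip_def zeros_def)

lemma B_term_sum_real: "n \<ge> 1 \<Longrightarrow> (\<Sum>\<rho>\<in>zeros_strip \<beta> \<sigma>. B_term \<beta> \<rho> n) \<in> \<real>"
  by (rule sum_zeros_strip_real, rule B_term_cnj[OF beta_pos]) (simp_all add: zeros_strip_def zeros_def)

lemma expected_height_expansion: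
  assumes \<sigma>: "\<sigma> > 0" and nz: "\<And>z. Re z = - \<sigma> \<Longrightarrow> \<not> isolated_zero (phi \<beta>) z"
    and trees: "beta_splitting_trees \<beta> M X J"
  shows "(\<lambda>n. of_real (LINT \<omega>|M n. leaf_height (X n) (J n) \<omega>)
            - (harm (n - 1) / mu \<beta> - (deriv ^^ 2) (phi \<beta>) 0 / (2 * (mu \<beta>)\<^sup>2)
               - (\<Sum>\<rho>\<in>zeros_strip \<beta> \<sigma>. B_term \<beta> \<rho> n))) \<in> O(\<lambda>n. of_real (real n powr - \<sigma>))"
    (is "?L \<in> _")
proof -
  have "(LINT \<omega>|M n. leaf_height (X n) (J n) \<omega>) = mean_height \<beta> (n - 1)" if "n \<ge> 2" for n
    using leaf_height_integral[OF beta_pos that, of "M n" "X n" "J n"] trees that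
    by (auto simp: beta_splitting_trees_def has_bochner_integral_iff)
  hence "\<forall>\<^sub>F n in sequentially. ?L n = of_real (mean_height \<beta> (n - 1))
            - (harm (n - 1) / mu \<beta> - (deriv ^^ 2) (phi \<beta>) 0 / (2 * (mu \<beta>)\<^sup>2)
               - (\<Sum>\<rho>\<in>zeros_strip \<beta> \<sigma>. B_term \<beta> \<rho> n))"
    by (intro eventually_sequentiallyI[of 2]) simp
  thus ?thesis
    using mean_height_asymptotics[OF beta_pos \<sigma> nz] by (subst landau_o.big.in_cong) assumption+
qed

lemma potential_measure_expansion:
  assumes \<sigma>: "\<sigma> > 0" and nz: "\<And>z. Re z = - \<sigma> \<Longrightarrow> \<not> isolated_zero (phi \<beta>) z"
    and sub: "subordinator M \<xi>" "has_laplace_exponent M \<xi> (phi \<beta>)"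
  shows "x > 0 \<Longrightarrow> 0 \<le> Re (potential_density \<beta> \<sigma> x)"
    "A \<in> sets borel \<Longrightarrow> emeasure (potential_measure M \<xi>) A = ennreal (eta \<beta>) * indicator A 0 +
        (\<integral>\<^sup>+ x \<in> A \<inter> {0<..}. ennreal (Re (potential_density \<beta> \<sigma> x)) \<partial>lborel)"
proof -
  have eq: "Re (potential_density \<beta> \<sigma> x) = exp x * tilted_density \<beta> x" for x
  proof -
    have "potential_density \<beta> \<sigma> x = of_real (exp x * tilted_density \<beta> x)"
      by (rule potential_density_eq_tilted[OF beta_pos \<sigma> nz])
    thus ?thesis by (simp only: Re_complex_of_real)
  qed
  show "x > 0 \<Longrightarrow> 0 \<le> Re (potential_density \<beta> \<sigma> x)"
    unfolding eq using potential_measure_decomposition(1)[OF beta_pos sub, of x] by simp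
  show "A \<in> sets borel \<Longrightarrow> emeasure (potential_measure M \<xi>) A = ennreal (eta \<beta>) * indicator A 0 +
        (\<integral>\<^sup>+ x \<in> A \<inter> {0<..}. ennreal (Re (potential_density \<beta> \<sigma> x)) \<partial>lborel)"
    unfolding eq by (rule potential_measure_decomposition(2)[OF beta_pos sub])
qed

text \<open>
  The negative real parts of the zeros of a strip form a finite set, which cannot exhaust an interval of candidates for \<open>\<sigma>\<close>.
\<close>
lemma zero_free_line_left_of:
  assumes "finite Z" "Z \<subseteq> zeros \<beta>"
  obtains \<sigma> where "\<sigma> > 0" "K \<le> \<sigma>" "\<And>z. Re z = - \<sigma> \<Longrightarrow> \<not> isolated_zero (phi \<beta>) z" "Z \<subseteq> zeros_strip \<beta> \<sigma>"
proof -
  define L where "L = Max (insert \<bar>K\<bar> ((\<lambda>z. \<bar>Re z\<bar>) ` Z))"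
  have L: "\<bar>K\<bar> \<le> L" "z \<in> Z \<Longrightarrow> \<bar>Re z\<bar> \<le> L" for z
    unfolding L_def using assms(1) by (auto intro!: Max_ge)
  define S where "S = {z. isolated_zero (phi \<beta>) z \<and> \<bar>Re z\<bar> \<le> L + 1}"
  have "finite S" unfolding S_def by (rule finite_zeros_Re[OF beta_pos])
  hence "finite ((\<lambda>z. - Re z) ` S)" by (rule finite_imageI)
  moreover have "infinite {L<..<L + 1}" by (simp add: infinite_Ioo)
  ultimately have "\<not> {L<..<L + 1} \<subseteq> (\<lambda>z. - Re z) ` S" using finite_subset by blast
  then obtain \<sigma> where s: "L < \<sigma>" "\<sigma> < L + 1" "\<sigma> \<notin> (\<lambda>z. - Re z) ` S"
    unfolding subset_iff greaterThanLessThan_iff by blast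
  show thesis
  proof (rule that)
    show "\<sigma> > 0" "K \<le> \<sigma>" using L(1) s(1) by linarith+
    fix z assume z: "Re z = - \<sigma>"
    show "\<not> isolated_zero (phi \<beta>) z"
    proof
      assume "isolated_zero (phi \<beta>) z"
      hence "z \<in> S" using z s L(1) by (simp add: S_def)
      hence "- Re z \<in> (\<lambda>z. - Re z) ` S" by (rule imageI)
      thus False using s(3) z by simp
    qed
  next
    show "Z \<subseteq> zeros_strip \<beta> \<sigma>"
    proof
      fix z assume z: "z \<in> Z"
      hence "z \<in> zeros \<beta>" using assms(2) by blast
      moreover from this have "Re z < 0" using zeros_Re_neg[OF beta_pos, of z] by (simp add: zeros_def)
      moreover have "- \<sigma> < Re z" using L(2)[OF z] s(1) by linarith
      ultimately show "z \<in> zeros_strip \<beta> \<sigma>" by (simp add: zeros_strip_def)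
    qed
  qed
qed

end

theorem theorem2p10:
  fixes \<beta> :: real
  assumes "\<beta> > 0"
  shows
    "(\<forall>\<sigma>>0. (\<forall>z. Re z = - \<sigma> \<longrightarrow> \<not> isolated_zero (phi \<beta>) z) \<longrightarrow>
        finite (zeros_strip \<beta> \<sigma>) \<and>
        (\<forall>x>0. integrable lborel (remainder_integrand \<beta> \<sigma> x)) \<and>
        remainder \<beta> \<sigma> \<in> O[at_top](\<lambda>x. of_real (exp (- \<sigma> * x))) \<and>
        (\<forall>(M :: 'a measure) \<xi>. subordinator M \<xi> \<and> has_laplace_exponent M \<xi> (phi \<beta>) \<longrightarrow>
           (\<forall>x>0. 0 \<le> Re (potential_density \<beta> \<sigma> x)) \<and>
           (\<forall>A\<in>sets borel.
              emeasure (potential_measure M \<xi>) A =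
                ennreal (eta \<beta>) * indicator A 0 +
                (\<integral>\<^sup>+ x \<in> A \<inter> {0<..}. ennreal (Re (potential_density \<beta> \<sigma> x)) \<partial>lborel))) \<and>
        (\<forall>(M :: nat \<Rightarrow> 'b measure) X J. beta_splitting_trees \<beta> M X J \<longrightarrow>
           (\<forall>n\<ge>2. integrable (M n) (leaf_height (X n) (J n))) \<and>
           (\<lambda>n. of_real (LINT \<omega>|M n. leaf_height (X n) (J n) \<omega>)
                 - (harm (n - 1) / mu \<beta> - (deriv ^^ 2) (phi \<beta>) 0 / (2 * (mu \<beta>)\<^sup>2)
                    - (\<Sum>\<rho>\<in>zeros_strip \<beta> \<sigma>. B_term \<beta> \<rho> n)))
             \<in> O(\<lambda>n. of_real (real n powr - \<sigma>))) \<and>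
        (\<forall>\<rho>\<in>zeros_strip \<beta> \<sigma>. cnj \<rho> \<in> zeros_strip \<beta> \<sigma> \<and>
           (\<forall>x>0. u_term \<beta> (cnj \<rho>) x = cnj (u_term \<beta> \<rho> x)) \<and>
           (\<forall>n\<ge>2. B_term \<beta> (cnj \<rho>) n = cnj (B_term \<beta> \<rho> n))) \<and>
        (\<forall>x>0. (\<Sum>\<rho>\<in>zeros_strip \<beta> \<sigma>. u_term \<beta> \<rho> x) \<in> \<real> \<and> remainder \<beta> \<sigma> x \<in> \<real> \<and>
               potential_density \<beta> \<sigma> x \<in> \<real>) \<and>
        (\<forall>n\<ge>2. (\<Sum>\<rho>\<in>zeros_strip \<beta> \<sigma>. B_term \<beta> \<rho> n) \<in> \<real> \<and>
               harm (n - 1) / mu \<beta> - (deriv ^^ 2) (phi \<beta>) 0 / (2 * (mu \<beta>)\<^sup>2)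
                 - (\<Sum>\<rho>\<in>zeros_strip \<beta> \<sigma>. B_term \<beta> \<rho> n) \<in> \<real>))
     \<and>
     (\<forall>Z K. finite Z \<and> Z \<subseteq> zeros \<beta> \<longrightarrow>
        (\<exists>\<sigma>>0. K \<le> \<sigma> \<and> (\<forall>z. Re z = - \<sigma> \<longrightarrow> \<not> isolated_zero (phi \<beta>) z) \<and>
           finite (zeros_strip \<beta> \<sigma>) \<and> Z \<subseteq> zeros_strip \<beta> \<sigma> \<and>
           (\<forall>(M :: nat \<Rightarrow> 'b measure) X J. beta_splitting_trees \<beta> M X J \<longrightarrow>
              (\<lambda>n. of_real (LINT \<omega>|M n. leaf_height (X n) (J n) \<omega>)
                    - (harm (n - 1) / mu \<beta> - (deriv ^^ 2) (phi \<beta>) 0 / (2 * (mu \<beta>)\<^sup>2)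
                       - (\<Sum>\<rho>\<in>zeros_strip \<beta> \<sigma>. B_term \<beta> \<rho> n)))
                \<in> O(\<lambda>n. of_real (real n powr - \<sigma>)))))"
proof (intro conjI allI impI)
  fix \<sigma> :: real
  assume \<sigma>: "\<sigma> > 0" and "\<forall>z. Re z = - \<sigma> \<longrightarrow> \<not> isolated_zero (phi \<beta>) z"
  hence nz: "\<not> isolated_zero (phi \<beta>) z" if "Re z = - \<sigma>" for z using that by blast
  show "finite (zeros_strip \<beta> \<sigma>)" by (rule finite_zeros_strip[OF assms])
  show "integrable lborel (remainder_integrand \<beta> \<sigma> x)" for x by (rule remainder_integrable[OF assms nz])
  show "remainder \<beta> \<sigma> \<in> O[at_top](\<lambda>x. of_real (exp (- \<sigma> * x)))" by (rule remainder_bigo[OF assms nz])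
  show "0 \<le> Re (potential_density \<beta> \<sigma> x)"
    if "subordinator M \<xi> \<and> has_laplace_exponent M \<xi> (phi \<beta>)" "0 < x" for M :: "'a measure" and \<xi> x
    by (rule potential_measure_expansion(1)[OF assms \<sigma> nz conjunct1[OF that(1)] conjunct2[OF that(1)] that(2)])
  show "\<forall>A\<in>sets borel. emeasure (potential_measure M \<xi>) A = ennreal (eta \<beta>) * indicator A 0 +
          (\<integral>\<^sup>+ x \<in> A \<inter> {0<..}. ennreal (Re (potential_density \<beta> \<sigma> x)) \<partial>lborel)"
    if "subordinator M \<xi> \<and> has_laplace_exponent M \<xi> (phi \<beta>)" for M :: "'a measure" and \<xi>
    by (rule ballI, rule potential_measure_expansion(2)[OF assms \<sigma> nz conjunct1[OF that] conjunct2[OF that]])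
  show "integrable (M n) (leaf_height (X n) (J n))"
    if "beta_splitting_trees \<beta> M X J" "2 \<le> n" for M :: "nat \<Rightarrow> 'b measure" and X J n
    using leaf_height_integral[OF assms that(2), of "M n" "X n" "J n"] that
    by (auto simp: beta_splitting_trees_def has_bochner_integral_iff)
  show "(\<lambda>n. of_real (LINT \<omega>|M n. leaf_height (X n) (J n) \<omega>)
                 - (harm (n - 1) / mu \<beta> - (deriv ^^ 2) (phi \<beta>) 0 / (2 * (mu \<beta>)\<^sup>2)
                    - (\<Sum>\<rho>\<in>zeros_strip \<beta> \<sigma>. B_term \<beta> \<rho> n)))
             \<in> O(\<lambda>n. of_real (real n powr - \<sigma>))"
    if "beta_splitting_trees \<beta> M X J" for M :: "nat \<Rightarrow> 'b measure" and X J
    by (rule expected_height_expansion[OF assms \<sigma> nz that])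
  show "\<forall>\<rho>\<in>zeros_strip \<beta> \<sigma>. cnj \<rho> \<in> zeros_strip \<beta> \<sigma> \<and>
           (\<forall>x>0. u_term \<beta> (cnj \<rho>) x = cnj (u_term \<beta> \<rho> x)) \<and>
           (\<forall>n\<ge>2. B_term \<beta> (cnj \<rho>) n = cnj (B_term \<beta> \<rho> n))"
  proof (intro ballI conjI allI impI)
    fix \<rho> assume \<rho>: "\<rho> \<in> zeros_strip \<beta> \<sigma>"
    show "cnj \<rho> \<in> zeros_strip \<beta> \<sigma>" by (rule zeros_strip_cnj[OF \<rho>])
    have iz: "isolated_zero (phi \<beta>) \<rho>" "Re \<rho> < 0" using \<rho> by (simp_all add: zeros_strip_def zeros_def)
    show "u_term \<beta> (cnj \<rho>) x = cnj (u_term \<beta> \<rho> x)" for x by (rule u_term_cnj[OF assms iz(1)])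
    show "B_term \<beta> (cnj \<rho>) n = cnj (B_term \<beta> \<rho> n)" if "2 \<le> n" for n
      using that by (intro B_term_cnj[OF assms iz]) simp
  qed
  show "(\<Sum>\<rho>\<in>zeros_strip \<beta> \<sigma>. u_term \<beta> \<rho> x) \<in> \<real>" for x by (rule u_term_sum_real[OF assms])
  show "remainder \<beta> \<sigma> x \<in> \<real>" for x by (rule remainder_real[OF assms])
  show "potential_density \<beta> \<sigma> x \<in> \<real>" for x
    unfolding potential_density_def
    by (intro Reals_add Reals_divide Reals_1 mu_real[OF assms] u_term_sum_real[OF assms] remainder_real[OF assms])
  fix n :: nat assume n: "2 \<le> n"
  show B: "(\<Sum>\<rho>\<in>zeros_strip \<beta> \<sigma>. B_term \<beta> \<rho> n) \<in> \<real>" using n by (intro B_term_sum_real[OF assms]) simp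
  show "harm (n - 1) / mu \<beta> - (deriv ^^ 2) (phi \<beta>) 0 / (2 * (mu \<beta>)\<^sup>2)
          - (\<Sum>\<rho>\<in>zeros_strip \<beta> \<sigma>. B_term \<beta> \<rho> n) \<in> \<real>"
    by (rule Reals_diff[OF Reals_diff[OF Reals_divide[OF harm_real mu_real[OF assms]] expansion_constant_real[OF assms]] B])
next
  fix Z :: "complex set" and K :: real
  assume Z: "finite Z \<and> Z \<subseteq> zeros \<beta>"
  obtain \<sigma> where \<sigma>: "\<sigma> > 0" "K \<le> \<sigma>" "\<And>z. Re z = - \<sigma> \<Longrightarrow> \<not> isolated_zero (phi \<beta>) z" "Z \<subseteq> zeros_strip \<beta> \<sigma>"
    using zero_free_line_left_of[OF assms conjunct1[OF Z] conjunct2[OF Z], of K] by blast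
  show "\<exists>\<sigma>>0. K \<le> \<sigma> \<and> (\<forall>z. Re z = - \<sigma> \<longrightarrow> \<not> isolated_zero (phi \<beta>) z) \<and>
           finite (zeros_strip \<beta> \<sigma>) \<and> Z \<subseteq> zeros_strip \<beta> \<sigma> \<and>
           (\<forall>(M :: nat \<Rightarrow> 'b measure) X J. beta_splitting_trees \<beta> M X J \<longrightarrow>
              (\<lambda>n. of_real (LINT \<omega>|M n. leaf_height (X n) (J n) \<omega>)
                    - (harm (n - 1) / mu \<beta> - (deriv ^^ 2) (phi \<beta>) 0 / (2 * (mu \<beta>)\<^sup>2)
                       - (\<Sum>\<rho>\<in>zeros_strip \<beta> \<sigma>. B_term \<beta> \<rho> n)))
                \<in> O(\<lambda>n. of_real (real n powr - \<sigma>)))"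
  proof (intro exI[of _ \<sigma>] conjI allI impI)
    show "finite (zeros_strip \<beta> \<sigma>)" by (rule finite_zeros_strip[OF assms])
  qed (fact \<sigma> | rule \<sigma>(3), assumption | rule expected_height_expansion[OF assms \<sigma>(1,3)], assumption+)+
qed

end
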